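(* For a prime $p\ge5$, a local condition $\mathcal{LC}$ at $p$, and a group $G\in\{\mathbb{Z}/2\mathbb{Z},\mathbb{Z}/3\mathbb{Z},\mathbb{Z}/4\mathbb{Z},\mathbb{Z}/2\mathbb{Z}\times\mathbb{Z}/2\mathbb{Z}\}$, $$|\mathcal{E}_{G,p}^{\mathcal{LC}}(X)|=c(G)\cdot c_{G,\mathcal{LC}}(p)\cdot\frac{p^{12/d(G)}}{p^{12/d(G)}-1}X^{1/d(G)}+O\left(h_{G,\mathcal{LC}}(p,X)\right),$$ where $c_{G,\mathcal{LC}}(p)$ is a constant depending on $G,p,\mathcal{LC}$, and $h_{G,\mathcal{LC}}(p,X)$ is a function whose order of magnitude is less than $pX^{1/e(G)}+p^2X^{1/12}$.
   Context: $\mathcal{E}_G(X)$ is the set of elliptic curves $E_{A,B}:y^2=x^3+Ax+B$ with $(A,B)\in\mathbb{Z}^2$, $4A^3+27B^2\ne0$, no prime $q$ with both $q^4\mid A$ and $q^6\mid B$, $|A|\le X^{1/3}$, $|B|\le X^{1/2}$, such that $E_{A,B}(\mathbb{Q})$ contains a subgroup isomorphic to $G$. A local condition at a prime $p$ is a property of an elliptic curve $E$ when reduced modulo $p$. For example, $E$ satisfies the local condition good, mult, addi, or $a$ at $p$ if its reduction modulo $p$ has good reduction, multiplicative reduction, additive reduction, or $a_E(p)=p+1-|E(\mathbb{F}_p)|=a$, respectively. $\mathcal{E}_{G,p}^{\mathcal{LC}}(X)$ is the subset of curves in $\mathcal{E}_G(X)$ satisfying $\mathcal{LC}$ at $p$.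 For $G=\mathbb{Z}/2\mathbb{Z},\ \mathbb{Z}/3\mathbb{Z},\ \mathbb{Z}/4\mathbb{Z},\ \mathbb{Z}/2\mathbb{Z}\times\mathbb{Z}/2\mathbb{Z}$ respectively: $d(G)=2,3,4,3$; $e(G)=3,4,6,6$; $r(G)=1,2,2,6$. Polynomials $(f_G,g_G)$ in $(a,b)$: - $\mathbb{Z}/2\mathbb{Z}$: $(a,\ b^3+ab)$; - $\mathbb{Z}/3\mathbb{Z}$: $(6ab+27a^4,\ b^2-27a^6)$; - $\mathbb{Z}/4\mathbb{Z}$: $(-3a^2+6ab^2-2b^4,\ (2a-b^2)(a^2+2ab^2-b^4))$; - $\mathbb{Z}/2\mathbb{Z}\times\mathbb{Z}/2\mathbb{Z}$: $(-(a^2+3b^2)/4,\ (b^3-a^2b)/4)$. $R_G(1)=\{(a,b)\in\mathbb{R}^2:|f_G(a,b)|\le1,\ |g_G(a,b)|\le1\}$, and $c(G)=\dfrac{\mathrm{Area}(R_G(1))}{2^{\delta}r(G)\zeta(12/d(G))}$, with $\delta=1$ if $G=\mathbb{Z}/2\mathbb{Z}\times\mathbb{Z}/2\mathbb{Z}$ and $\delta=0$ otherwise. *)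

theory Defs
  imports "HOL-Analysis.Analysis" "HOL-Algebra.Elementary_Groups" "HOL-Number_Theory.Cong"
begin

section \<open>The group of rational points of \<open>y\<^sup>2 = x\<^sup>3 + A x + B\<close>\<close>

datatype ec_point = Infinity | Affine rat rat

definition ec_points :: "int \<Rightarrow> int \<Rightarrow> ec_point set" where
  "ec_points A B =
     insert Infinity {Affine x y | x y. y ^ 2 = x ^ 3 + of_int A * x + of_int B}"

text \<open>
  Chord-tangent addition. On the curve, if \<open>x1 = x2\<close> and \<open>y1 \<noteq> - y2\<close> then
  \<open>y1 = y2 \<noteq> 0\<close>, so the tangent slope below has a nonzero denominator.
\<close>

fun ec_add :: "int \<Rightarrow> ec_point \<Rightarrow> ec_point \<Rightarrow> ec_point" where
  "ec_add A Infinity Q = Q"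
| "ec_add A P Infinity = P"
| "ec_add A (Affine x1 y1) (Affine x2 y2) =
     (if x1 = x2 \<and> y1 = - y2 then Infinity
      else let m = (if x1 = x2 then (3 * x1 ^ 2 + of_int A) / (2 * y1)
                    else (y2 - y1) / (x2 - x1));
               x3 = m ^ 2 - x1 - x2
           in Affine x3 (m * (x1 - x3) - y1))"

definition ec_group :: "int \<Rightarrow> int \<Rightarrow> ec_point monoid" where
  "ec_group A B = \<lparr>carrier = ec_points A B, mult = ec_add A, one = Infinity\<rparr>"

definition has_subgroup_iso :: "('a, 'x) monoid_scheme \<Rightarrow> 'b monoid \<Rightarrow> bool" where
  "has_subgroup_iso E G \<longleftrightarrow> (\<exists>H. subgroup H E \<and> E\<lparr>carrier := H\<rparr> \<cong> G)"

section \<open>The four groups and their parameters\<close>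

datatype torsion_group = Z2 | Z3 | Z4 | Z2xZ2

fun contains_torsion :: "torsion_group \<Rightarrow> int \<Rightarrow> int \<Rightarrow> bool" where
  "contains_torsion Z2 A B = has_subgroup_iso (ec_group A B) (integer_mod_group 2)"
| "contains_torsion Z3 A B = has_subgroup_iso (ec_group A B) (integer_mod_group 3)"
| "contains_torsion Z4 A B = has_subgroup_iso (ec_group A B) (integer_mod_group 4)"
| "contains_torsion Z2xZ2 A B =
     has_subgroup_iso (ec_group A B) (integer_mod_group 2 \<times>\<times> integer_mod_group 2)"

fun d_of :: "torsion_group \<Rightarrow> real" where
  "d_of Z2 = 2" | "d_of Z3 = 3" | "d_of Z4 = 4" | "d_of Z2xZ2 = 3"

fun e_of :: "torsion_group \<Rightarrow> real" where
  "e_of Z2 = 3" | "e_of Z3 = 4" | "e_of Z4 = 6" | "e_of Z2xZ2 = 6"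

fun r_of :: "torsion_group \<Rightarrow> real" where
  "r_of Z2 = 1" | "r_of Z3 = 2" | "r_of Z4 = 2" | "r_of Z2xZ2 = 6"

fun delta_of :: "torsion_group \<Rightarrow> nat" where
  "delta_of Z2xZ2 = 1" | "delta_of _ = 0"

fun f_of :: "torsion_group \<Rightarrow> real \<Rightarrow> real \<Rightarrow> real" where
  "f_of Z2 a b = a"
| "f_of Z3 a b = 6 * a * b + 27 * a ^ 4"
| "f_of Z4 a b = - 3 * a ^ 2 + 6 * a * b ^ 2 - 2 * b ^ 4"
| "f_of Z2xZ2 a b = - (a ^ 2 + 3 * b ^ 2) / 4"

fun g_of :: "torsion_group \<Rightarrow> real \<Rightarrow> real \<Rightarrow> real" where
  "g_of Z2 a b = b ^ 3 + a * b"
| "g_of Z3 a b = b ^ 2 - 27 * a ^ 6"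
| "g_of Z4 a b = (2 * a - b ^ 2) * (a ^ 2 + 2 * a * b ^ 2 - b ^ 4)"
| "g_of Z2xZ2 a b = (b ^ 3 - a ^ 2 * b) / 4"

definition region1 :: "torsion_group \<Rightarrow> (real \<times> real) set" where
  "region1 G = {(a, b). \<bar>f_of G a b\<bar> \<le> 1 \<and> \<bar>g_of G a b\<bar> \<le> 1}"

text \<open>The Riemann zeta function at real arguments \<open>s > 1\<close>, where the series converges.\<close>

definition zeta_real :: "real \<Rightarrow> real" where
  "zeta_real s = (\<Sum>n. 1 / real (Suc n) powr s)"

definition c_of :: "torsion_group \<Rightarrow> real" where
  "c_of G = measure lborel (region1 G) /
              (2 ^ delta_of G * r_of G * zeta_real (12 / d_of G))"

section \<open>The curves of bounded height, and local conditions\<close>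

text \<open>The curve \<open>y\<^sup>2 = x\<^sup>3 + A x + B\<close> is represented by its coefficient pair \<open>(A, B)\<close>.\<close>

definition curves :: "torsion_group \<Rightarrow> real \<Rightarrow> (int \<times> int) set" where
  "curves G X = {(A, B).
     4 * A ^ 3 + 27 * B ^ 2 \<noteq> 0 \<and>
     \<not> (\<exists>q::nat. prime q \<and> int q ^ 4 dvd A \<and> int q ^ 6 dvd B) \<and>
     \<bar>real_of_int A\<bar> \<le> X powr (1 / 3) \<and>
     \<bar>real_of_int B\<bar> \<le> X powr (1 / 2) \<and>
     contains_torsion G A B}"

text \<open>
  The equations in \<open>curves\<close> are minimal at every prime \<open>p \<ge> 5\<close>, so the reduction of
  such a curve modulo \<open>p\<close> is the Weierstrass equation over \<open>\<int>/p\<close> whose coefficients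
  are the residues of \<open>A\<close> and \<open>B\<close>. A local condition at \<open>p\<close> is an arbitrary property
  of this reduced equation.
\<close>

type_synonym local_condition = "int \<times> int \<Rightarrow> bool"

definition reduce :: "nat \<Rightarrow> int \<times> int \<Rightarrow> int \<times> int" where
  "reduce p E = (fst E mod int p, snd E mod int p)"

definition curves_LC ::
    "torsion_group \<Rightarrow> nat \<Rightarrow> local_condition \<Rightarrow> real \<Rightarrow> (int \<times> int) set" where
  "curves_LC G p LC X = {E \<in> curves G X. LC (reduce p E)}"

text \<open>
  The standard instances, for \<open>p \<ge> 5\<close>. A singular reduction has a node if
  \<open>A \<noteq> 0\<close> in \<open>\<int>/p\<close> and a cusp if \<open>A = 0\<close>.
\<close>

definition good_LC :: "nat \<Rightarrow> local_condition" where
  "good_LC p = (\<lambda>(A, B). \<not> int p dvd 4 * A ^ 3 + 27 * B ^ 2)"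

definition mult_LC :: "nat \<Rightarrow> local_condition" where
  "mult_LC p = (\<lambda>(A, B). int p dvd 4 * A ^ 3 + 27 * B ^ 2 \<and> \<not> int p dvd A)"

definition addi_LC :: "nat \<Rightarrow> local_condition" where
  "addi_LC p = (\<lambda>(A, B). int p dvd 4 * A ^ 3 + 27 * B ^ 2 \<and> int p dvd A)"

text \<open>The summand 1 in the point count is the point at infinity.\<close>

definition trace_LC :: "nat \<Rightarrow> int \<Rightarrow> local_condition" where
  "trace_LC p a = (\<lambda>(A, B).
     int p + 1
       - int (1 + card {(x, y). x \<in> {0..<int p} \<and> y \<in> {0..<int p} \<and>
                                [y ^ 2 = x ^ 3 + A * x + B] (mod int p)})
     = a)"

end

theory Submission
  imports Defs "HOL-Computational_Algebra.Squarefree"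
begin

text \<open>
  Curves with a subgroup \<open>G\<close> are exactly those with \<open>(A, B) = (f(a, b), g(a, b))\<close> for integers
  \<open>a, b\<close>, where \<open>f\<close> and \<open>g\<close> are weighted homogeneous of degrees 4 and 6 for weights
  \<open>u, v\<close> with \<open>u + v = 12 / d(G)\<close> and \<open>max u v = 12 / e(G)\<close>. With
  \<open>H = max(\<bar>f\<bar>\<^sup>3, g\<^sup>2)\<close> and \<open>t = X\<^bsup>1/12\<^esup>\<close>, the curves of height at most
  \<open>X\<close> come from integer points with \<open>H \<le> t\<^sup>12\<close>, and minimality means that no prime \<open>q\<close>
  satisfies \<open>q\<^sup>u | a\<close> and \<open>q\<^sup>v | b\<close>.

  The boundary \<open>H = 1\<close> is a union of four Lipschitz arcs, parametrised by the boundary of the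
  square \<open>max(\<bar>\<xi>\<bar>, \<bar>\<eta>\<bar>) = 1\<close> along the curves \<open>(s\<^sup>u \<xi>, s\<^sup>v \<eta>)\<close>. Hence each of the \<open>p\<^sup>2\<close>
  residue classes contains \<open>area * t\<^bsup>u+v\<^esup> / p\<^sup>2 + O(t\<^bsup>max u v\<^esup> / p + 1)\<close> such points. Moebius inversion
  over \<open>n = O(t)\<close> imposes minimality; summing the \<open>p\<^sup>2\<close> error terms with \<open>t\<close> replaced by
  \<open>t / n\<close> gives \<open>O(p t\<^bsup>max u v\<^esup> + p\<^sup>2 t)\<close>. Finally the map \<open>(a, b) \<mapsto> (A, B)\<close> has fibres
  of size exactly \<open>r(G)\<close> outside a set of \<open>O(t\<^bsup>max u v\<^esup>)\<close> points.
\<close>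

section \<open>Lattice points in regions bounded by Lipschitz curves\<close>

text \<open>The error constant must be the same for all p and all local conditions, while the
  leading coefficient may depend on both. So each counting statement fixes its error constant first
  and produces the coefficient afterwards. The delicate point is the sieve. When p divides n, the
  map (a, b) -> (n^u a, n^v b) does not permute the residues mod p, so the density of admissible
  classes varies with n in an irregular way. It is enough that it lies between 0 and the area of the
  region: the coefficient is then an absolutely convergent series over n, which is left unevaluated.
  The theorem leaves c_{G,LC}(p) open, so this series is divided by c(G) and by the factor in p;
  what has to be shown about c(G) is that it is positive. Integrality of rational parameters is used
  twice: it makes every curve come from an integer point, and, applied to (A / q^4, B / q^6), it
  identifies minimality with primitivity at every prime, 2 and 3 included.\<close>

definition lip :: "(real \<Rightarrow> real) \<Rightarrow> bool" where
  "lip f \<longleftrightarrow> (\<exists>L. L-lipschitz_on {-1..1} f)"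

lemma lip_const [intro]: "lip (\<lambda>_. c)"
  and lip_ident [intro]: "lip (\<lambda>x. x)"
  unfolding lip_def using lipschitz_on_constant lipschitz_on_id by blast+

lemma lip_add [intro]: "lip f \<Longrightarrow> lip g \<Longrightarrow> lip (\<lambda>x. f x + g x)"
  and lip_diff [intro]: "lip f \<Longrightarrow> lip g \<Longrightarrow> lip (\<lambda>x. f x - g x)"
  and lip_minus [intro]: "lip f \<Longrightarrow> lip (\<lambda>x. - f x)"
  unfolding lip_def using lipschitz_on_add lipschitz_on_diff lipschitz_on_minus by blast+

lemma lip_bounded:
  assumes "lip f"
  obtains K where "K > 0" "\<And>x. x \<in> {-1..1} \<Longrightarrow> \<bar>f x\<bar> \<le> K"
proof -
  obtain L where L: "L-lipschitz_on {-1..1} f"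
    using assms lip_def by blast
  have "continuous_on {-1..1} f"
    by (rule lipschitz_on_continuous_on[OF L])
  hence "bounded (f ` {-1..1})"
    by (intro compact_imp_bounded compact_continuous_image) auto
  thus ?thesis
    using that unfolding bounded_pos by (auto simp: real_norm_def)
qed

lemma lip_mult [intro]:
  assumes "lip f" "lip g"
  shows "lip (\<lambda>x. f x * g x)"
proof -
  obtain L M where L: "L-lipschitz_on {-1..1} f" and M: "M-lipschitz_on {-1..1} g"
    using assms lip_def by blast
  obtain K where K: "K > 0" "\<And>x. x \<in> {-1..1} \<Longrightarrow> \<bar>f x\<bar> \<le> K"
    using lip_bounded[OF assms(1)] by blast
  obtain K' where K': "K' > 0" "\<And>x. x \<in> {-1..1} \<Longrightarrow> \<bar>g x\<bar> \<le> K'"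
    using lip_bounded[OF assms(2)] by blast
  have nn: "L \<ge> 0" "M \<ge> 0"
    using L M lipschitz_on_nonneg by blast+
  have "(K * M + K' * L)-lipschitz_on {-1..1} (\<lambda>x. f x * g x)"
  proof (rule lipschitz_onI)
    fix x y :: real assume xy: "x \<in> {-1..1}" "y \<in> {-1..1}"
    have "f x * g x - f y * g y = f x * (g x - g y) + g y * (f x - f y)"
      by (simp add: algebra_simps)
    hence "\<bar>f x * g x - f y * g y\<bar> \<le> \<bar>f x\<bar> * \<bar>g x - g y\<bar> + \<bar>g y\<bar> * \<bar>f x - f y\<bar>"
      by (metis abs_mult abs_triangle_ineq)
    also have "\<dots> \<le> K * (M * \<bar>x - y\<bar>) + K' * (L * \<bar>x - y\<bar>)"
      using lipschitz_onD[OF L xy] lipschitz_onD[OF M xy] K K' xy nn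
      by (intro add_mono mult_mono) (auto simp: dist_real_def)
    finally show "dist (f x * g x) (f y * g y) \<le> (K * M + K' * L) * dist x y"
      by (simp add: dist_real_def algebra_simps)
  qed (use K K' nn in auto)
  thus ?thesis
    unfolding lip_def by blast
qed

lemma lip_power [intro]: "lip f \<Longrightarrow> lip (\<lambda>x. f x ^ n)"
  by (induction n) auto

lemma lip_compose:
  assumes "lip f" "\<And>x. x \<in> {-1..1} \<Longrightarrow> f x \<in> S" "L-lipschitz_on S h"
  shows "lip (\<lambda>x. h (f x))"
proof -
  obtain M where M: "M-lipschitz_on {-1..1} f"
    using assms(1) lip_def by blast
  have "(L * M)-lipschitz_on {-1..1} (\<lambda>x. h (f x))"
    by (rule lipschitz_on_compose2[OF M])
       (use assms in \<open>auto intro: lipschitz_on_subset\<close>)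
  thus ?thesis
    unfolding lip_def by blast
qed

lemma lip_abs [intro]: "lip f \<Longrightarrow> lip (\<lambda>x. \<bar>f x\<bar>)"
  by (rule lip_compose[where S = UNIV and L = 1])
     (auto intro!: lipschitz_onI simp: dist_real_def)

lemma lip_max [intro]:
  assumes "lip f" "lip g"
  shows "lip (\<lambda>x. max (f x) (g x))"
proof -
  have "lip (\<lambda>x. (1/2) * (f x + g x + \<bar>f x - g x\<bar>))"
    using assms by (intro lip_mult lip_const lip_add lip_abs lip_diff)
  moreover have "(1/2) * (f x + g x + \<bar>f x - g x\<bar>) = max (f x) (g x)" for x
    by (simp add: max_def)
  ultimately show ?thesis
    by simp
qed

text \<open>The exponents used later are negative, so the power is not Lipschitz near 0. The bound
  \<open>m\<close> confines the values of \<open>f\<close> to a compact interval of positive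
  numbers, where the derivative is bounded.\<close>

lemma lip_powr:
  assumes "lip f" "m > 0" "\<And>x. x \<in> {-1..1} \<Longrightarrow> m \<le> f x"
  shows "lip (\<lambda>x. f x powr e)"
proof -
  obtain K where K: "K > 0" "\<And>x. x \<in> {-1..1} \<Longrightarrow> \<bar>f x\<bar> \<le> K"
    using lip_bounded[OF assms(1)] by blast
  have "bounded ((\<lambda>x. e * x powr (e - 1)) ` {m..K})"
    using assms(2) by (intro compact_imp_bounded compact_continuous_image continuous_intros) auto
  then obtain B where B: "B > 0" "\<And>x. x \<in> {m..K} \<Longrightarrow> \<bar>e * x powr (e - 1)\<bar> \<le> B"
    unfolding bounded_pos by (auto simp: real_norm_def)
  have "B-lipschitz_on {m..K} (\<lambda>x. x powr e)"
  proof (rule lipschitz_onI)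
    fix x y assume xy: "x \<in> {m..K}" "y \<in> {m..K}"
    have "norm (x powr e - y powr e) \<le> B * norm (x - y)"
    proof (rule field_differentiable_bound[of "{m..K}"])
      fix z assume z: "z \<in> {m..K}"
      show "((\<lambda>x. x powr e) has_field_derivative e * z powr (e - 1)) (at z within {m..K})"
        using z assms(2) by (auto intro!: derivative_eq_intros has_real_derivative_powr[THEN DERIV_subset])
    qed (use xy B in auto)
    thus "dist (x powr e) (y powr e) \<le> B * dist x y"
      by (simp add: dist_real_def)
  qed (use B in auto)
  moreover have "f x \<in> {m..K}" if "x \<in> {-1..1}" for x
    using K(2)[OF that] assms(3)[OF that] by auto
  ultimately show ?thesis
    using lip_compose[OF assms(1)] by blast
qed

section \<open>Grid cells, and how many of them a curve can meet\<close>

definition closed_cell :: "real \<Rightarrow> real \<Rightarrow> real \<Rightarrow> real \<Rightarrow> int \<times> int \<Rightarrow> (real \<times> real) set" where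
  "closed_cell \<delta>\<^sub>1 \<delta>\<^sub>2 x y = (\<lambda>(i, j).
     {x + \<delta>\<^sub>1 * of_int i .. x + \<delta>\<^sub>1 * (of_int i + 1)} \<times> {y + \<delta>\<^sub>2 * of_int j .. y + \<delta>\<^sub>2 * (of_int j + 1)})"

text \<open>A cell is indexed by the grid point at its lower left corner, so counting grid points
  amounts to counting cells. The half-open cells tile the plane and make areas add up; the closed
  ones serve to detect the boundary.\<close>

definition cell :: "real \<Rightarrow> real \<Rightarrow> real \<Rightarrow> real \<Rightarrow> int \<times> int \<Rightarrow> (real \<times> real) set" where
  "cell \<delta>\<^sub>1 \<delta>\<^sub>2 x y = (\<lambda>(i, j).
     {x + \<delta>\<^sub>1 * of_int i ..< x + \<delta>\<^sub>1 * (of_int i + 1)} \<times> {y + \<delta>\<^sub>2 * of_int j ..< y + \<delta>\<^sub>2 * (of_int j + 1)})"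

lemma cell_index_near:
  fixes \<delta> x :: real
  assumes "\<delta> > 0" "\<bar>z - w\<bar> \<le> \<delta>" "x + \<delta> * of_int i \<le> z" "z \<le> x + \<delta> * (of_int i + 1)"
  shows "i \<in> {\<lfloor>(w - x) / \<delta>\<rfloor> - 2 .. \<lfloor>(w - x) / \<delta>\<rfloor> + 2}"
proof -
  define r where "r = (w - x) / \<delta>"
  have w: "w = x + \<delta> * r"
    using assms(1) by (simp add: r_def)
  have "\<delta> * (of_int i) \<le> \<delta> * (r + 1)" "\<delta> * r \<le> \<delta> * (of_int i + 2)"
    using assms unfolding w by (simp_all add: algebra_simps abs_le_iff)
  hence "of_int i \<le> r + 1" "r \<le> of_int i + 2"
    using assms(1) by auto
  thus ?thesis
    unfolding r_def[symmetric] by simp linarith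
qed

text \<open>Sample the curve so densely that neither coordinate moves by more than one mesh width
  between a point and the last sample before it. A cell met by the curve then has its index in a 5
  by 5 window around one of the samples.\<close>

lemma cells_meeting_curve:
  fixes \<gamma> :: "real \<Rightarrow> real \<times> real" and x y :: real
  assumes L: "L-lipschitz_on {-1..1} (\<lambda>t. fst (\<gamma> t))" "L-lipschitz_on {-1..1} (\<lambda>t. snd (\<gamma> t))"
    and \<delta>: "\<delta>\<^sub>1 > 0" "\<delta>\<^sub>2 > 0"
  defines "B \<equiv> {c. \<exists>t\<in>{-1..1}. \<gamma> t \<in> closed_cell \<delta>\<^sub>1 \<delta>\<^sub>2 x y c}"
  shows "finite B" "real (card B) \<le> (75 * L + 75) * (1 / \<delta>\<^sub>1 + 1 / \<delta>\<^sub>2 + 1)"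
proof -
  have L0: "L \<ge> 0"
    using L(1) lipschitz_on_nonneg by blast
  \<comment> \<open>A step of 2 / K in the parameter moves each coordinate by at most 2 L / K, which
    is at most either mesh width. The summand 1 keeps K positive when L = 0.\<close>
  define K where "K = nat \<lceil>2 * L * (1 / \<delta>\<^sub>1 + 1 / \<delta>\<^sub>2)\<rceil> + 1"
  have K_ge: "2 * L * (1 / \<delta>\<^sub>1 + 1 / \<delta>\<^sub>2) \<le> real K"
    unfolding K_def by linarith
  have nn: "0 \<le> 2 * L * (1 / \<delta>\<^sub>1 + 1 / \<delta>\<^sub>2)"
    using L0 \<delta> by simp
  have K_le: "real K \<le> 2 * L * (1 / \<delta>\<^sub>1 + 1 / \<delta>\<^sub>2) + 2"
    unfolding K_def using nn by linarith
  have K0: "K > 0"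
    by (simp add: K_def)
  have "2 * L / \<delta>\<^sub>1 \<le> real K" "2 * L / \<delta>\<^sub>2 \<le> real K"
    using K_ge L0 \<delta> by (auto simp: distrib_left intro: order_trans[rotated])
  hence step: "L * (2 / real K) \<le> \<delta>\<^sub>1" "L * (2 / real K) \<le> \<delta>\<^sub>2"
    using \<delta> K0 by (simp_all add: field_simps)
  define \<tau> where "\<tau> = (\<lambda>k. -1 + 2 * real k / real K)"
  define q where "q = 2 * L * (1 / \<delta>\<^sub>1 + 1 / \<delta>\<^sub>2)"
  define I where "I = (\<lambda>k. {\<lfloor>(fst (\<gamma> (\<tau> k)) - x) / \<delta>\<^sub>1\<rfloor> - 2 .. \<lfloor>(fst (\<gamma> (\<tau> k)) - x) / \<delta>\<^sub>1\<rfloor> + 2}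
      \<times> {\<lfloor>(snd (\<gamma> (\<tau> k)) - y) / \<delta>\<^sub>2\<rfloor> - 2 .. \<lfloor>(snd (\<gamma> (\<tau> k)) - y) / \<delta>\<^sub>2\<rfloor> + 2})"
  have sub: "B \<subseteq> (\<Union>k\<in>{..K}. I k)"
  proof
    fix c assume "c \<in> B"
    then obtain t where t: "t \<in> {-1..1}" "\<gamma> t \<in> closed_cell \<delta>\<^sub>1 \<delta>\<^sub>2 x y c"
      by (auto simp: B_def)
    define r where "r = (t + 1) * real K / 2"
    define k where "k = nat \<lfloor>r\<rfloor>"
    have "(t + 1) * real K \<le> 2 * real K"
      using t(1) by (intro mult_right_mono) auto
    hence r: "0 \<le> r" "r \<le> real K"
      using t(1) by (simp_all add: r_def)
    have k: "real k \<le> r" "r \<le> real k + 1"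
      unfolding k_def using r by linarith+
    have kK: "k \<le> K"
      using k r by linarith
    have tr: "t = -1 + 2 * r / real K"
      using K0 by (simp add: r_def)
    have \<tau>k: "\<tau> k \<in> {-1..1}"
      using kK K0 by (auto simp: \<tau>_def field_simps)
    have "t - \<tau> k = 2 * (r - real k) / real K"
      unfolding tr \<tau>_def by (simp add: diff_divide_distrib right_diff_distrib)
    hence "\<bar>t - \<tau> k\<bar> \<le> 2 / real K"
      using k K0 by (auto simp: abs_mult intro!: divide_right_mono)
    hence "L * \<bar>t - \<tau> k\<bar> \<le> L * (2 / real K)"
      using L0 by (intro mult_left_mono)
    hence "\<bar>fst (\<gamma> t) - fst (\<gamma> (\<tau> k))\<bar> \<le> \<delta>\<^sub>1" "\<bar>snd (\<gamma> t) - snd (\<gamma> (\<tau> k))\<bar> \<le> \<delta>\<^sub>2"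
      using lipschitz_onD[OF L(1) t(1) \<tau>k] lipschitz_onD[OF L(2) t(1) \<tau>k] step
      by (auto simp: dist_real_def)
    hence "c \<in> I k"
      using t(2) \<delta> cell_index_near[of \<delta>\<^sub>1 "fst (\<gamma> t)" "fst (\<gamma> (\<tau> k))" x]
        cell_index_near[of \<delta>\<^sub>2 "snd (\<gamma> t)" "snd (\<gamma> (\<tau> k))" y]
      unfolding I_def closed_cell_def by (cases c; cases "\<gamma> t") force
    thus "c \<in> (\<Union>k\<in>{..K}. I k)"
      using kK by blast
  qed
  have cI: "finite (I k)" "card (I k) = 25" for k
    by (simp_all add: I_def card_cartesian_product)
  show "finite B"
    by (rule finite_subset[OF sub]) (use cI in auto)
  have "card B \<le> card (\<Union>k\<in>{..K}. I k)"
    by (rule card_mono[OF _ sub]) (use cI in auto)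
  also have "\<dots> \<le> (\<Sum>k\<in>{..K}. card (I k))"
    by (rule card_UN_le) auto
  \<comment> \<open>25 indices per window and K + 1 samples. The 75 below is 25 * 3, from K + 1
    \<le> q + 3.\<close>
  finally have "real (card B) \<le> 25 * (real K + 1)"
    by (simp add: cI)
  also have "\<dots> \<le> 25 * (q + 3)"
    using K_le unfolding q_def[symmetric] by simp
  also have "\<dots> = 50 * L * (1 / \<delta>\<^sub>1 + 1 / \<delta>\<^sub>2) + 75"
    by (simp add: q_def algebra_simps)
  finally have *: "real (card B) \<le> 50 * L * (1 / \<delta>\<^sub>1 + 1 / \<delta>\<^sub>2) + 75" .
  show "real (card B) \<le> (75 * L + 75) * (1 / \<delta>\<^sub>1 + 1 / \<delta>\<^sub>2 + 1)"
  proof -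
    have "(75 * L + 75) * (1 / \<delta>\<^sub>1 + 1 / \<delta>\<^sub>2 + 1) - (50 * L * (1 / \<delta>\<^sub>1 + 1 / \<delta>\<^sub>2) + 75)
      = 25 * L * (1 / \<delta>\<^sub>1 + 1 / \<delta>\<^sub>2) + 75 * L + 75 * (1 / \<delta>\<^sub>1 + 1 / \<delta>\<^sub>2)"
      by (simp add: algebra_simps)
    moreover have "\<dots> \<ge> 0"
      using L0 \<delta> by simp
    ultimately show ?thesis
      using * by linarith
  qed
qed


section \<open>Weighted homogeneous heights\<close>

lemma abs_le_power_of_root_le:
  fixes a :: real
  assumes "n > 0" "root n \<bar>a\<bar> \<le> s"
  shows "\<bar>a\<bar> \<le> s ^ n"
proof -
  have "root n \<bar>a\<bar> ^ n \<le> s ^ n"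
    using assms by (intro power_mono) auto
  thus ?thesis
    using assms(1) by simp
qed

text \<open>Abstracts the height of a two-parameter family, so that the counting is done once for
  all four groups. The Lipschitz condition is placed on the lines through the sides of the square,
  since scaling determines H from its values there.\<close>

locale weighted_height =
  fixes H :: "real \<Rightarrow> real \<Rightarrow> real" and u v :: nat
  assumes u_pos: "u > 0" and v_pos: "v > 0"
    and H_scale: "t \<ge> 0 \<Longrightarrow> H (t ^ u * a) (t ^ v * b) = t ^ 12 * H a b"
    and H_pos: "(a, b) \<noteq> (0, 0) \<Longrightarrow> H a b > 0"
    and H_cont: "continuous_on UNIV (\<lambda>(a, b). H a b)"
    and H_lip: "\<sigma> \<in> {-1, 1} \<Longrightarrow> lip (H \<sigma>)" "\<sigma> \<in> {-1, 1} \<Longrightarrow> lip (\<lambda>t. H t \<sigma>)"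
begin

text \<open>Weighted polar coordinates: \<open>s\<close> is the radius, and the point of the square
  is the direction.\<close>

lemma radial_cases:
  assumes "(a, b) \<noteq> (0, 0)"
  obtains s \<xi> \<eta> where "s > 0" "s = max (root u \<bar>a\<bar>) (root v \<bar>b\<bar>)"
    "a = s ^ u * \<xi>" "b = s ^ v * \<eta>" "max \<bar>\<xi>\<bar> \<bar>\<eta>\<bar> = 1"
proof -
  define s where "s = max (root u \<bar>a\<bar>) (root v \<bar>b\<bar>)"
  have s: "s > 0"
    using assms u_pos v_pos by (auto simp: s_def less_max_iff_disj)
  have le: "\<bar>a\<bar> \<le> s ^ u" "\<bar>b\<bar> \<le> s ^ v"
    using u_pos v_pos by (auto simp: s_def intro!: abs_le_power_of_root_le)
  have eq: "\<bar>a\<bar> = s ^ u \<or> \<bar>b\<bar> = s ^ v"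
    using u_pos v_pos by (auto simp: s_def max_def)
  show ?thesis
  proof (rule that[OF s s_def, of "a / s ^ u" "b / s ^ v"])
    have "\<bar>a / s ^ u\<bar> \<le> 1" "\<bar>b / s ^ v\<bar> \<le> 1" "\<bar>a / s ^ u\<bar> = 1 \<or> \<bar>b / s ^ v\<bar> = 1"
      using le eq s by (auto simp: abs_div field_simps)
    thus "max \<bar>a / s ^ u\<bar> \<bar>b / s ^ v\<bar> = 1"
      by linarith
  qed (use s in auto)
qed

lemma H_zero [simp]: "H 0 0 = 0"
  using H_scale[of 0 0 0] u_pos v_pos by simp

lemma H_nonneg: "H a b \<ge> 0"
  using H_pos[of a b] by (cases "(a, b) = (0, 0)") auto

text \<open>The boundary of the square is compact and misses the origin, so the continuous positive
  function H has a positive minimum on it.\<close>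

lemma H_lower:
  obtains m where "m > 0" "\<And>\<xi> \<eta>. max \<bar>\<xi>\<bar> \<bar>\<eta>\<bar> = 1 \<Longrightarrow> m \<le> H \<xi> \<eta>"
proof -
  define Q :: "(real \<times> real) set" where "Q = {-1, 1} \<times> {-1..1} \<union> {-1..1} \<times> {-1, 1}"
  have "compact Q"
    unfolding Q_def by (intro compact_Un compact_Times) auto
  moreover have "Q \<noteq> {}"
    by (auto simp: Q_def)
  moreover have "continuous_on Q (\<lambda>(a, b). H a b)"
    using H_cont continuous_on_subset by blast
  ultimately obtain q where q: "q \<in> Q" "\<forall>z\<in>Q. (\<lambda>(a, b). H a b) q \<le> (\<lambda>(a, b). H a b) z"
    using continuous_attains_inf by metis
  show ?thesis
  proof (rule that[of "(\<lambda>(a, b). H a b) q"])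
    show "0 < (\<lambda>(a, b). H a b) q"
      using q(1) H_pos by (auto simp: Q_def)
    fix \<xi> \<eta> :: real assume "max \<bar>\<xi>\<bar> \<bar>\<eta>\<bar> = 1"
    hence "(\<xi>, \<eta>) \<in> Q"
      by (auto simp: Q_def max_def abs_if split: if_splits)
    thus "(\<lambda>(a, b). H a b) q \<le> H \<xi> \<eta>"
      using q(2) by force
  qed
qed

lemma H_radial_lower:
  obtains m where "m > 0" "\<And>a b. m * max (root u \<bar>a\<bar>) (root v \<bar>b\<bar>) ^ 12 \<le> H a b"
proof -
  obtain m where m: "m > 0" "\<And>\<xi> \<eta>. max \<bar>\<xi>\<bar> \<bar>\<eta>\<bar> = 1 \<Longrightarrow> m \<le> H \<xi> \<eta>"
    using H_lower by blast
  show ?thesis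
  proof (rule that[OF m(1)])
    fix a b
    show "m * max (root u \<bar>a\<bar>) (root v \<bar>b\<bar>) ^ 12 \<le> H a b"
    proof (cases "(a, b) = (0, 0)")
      case False
      then obtain s \<xi> \<eta> where *: "s > 0" "s = max (root u \<bar>a\<bar>) (root v \<bar>b\<bar>)"
        "a = s ^ u * \<xi>" "b = s ^ v * \<eta>" "max \<bar>\<xi>\<bar> \<bar>\<eta>\<bar> = 1"
        using radial_cases by blast
      have "m * s ^ 12 \<le> H \<xi> \<eta> * s ^ 12"
        using m(2)[OF *(5)] *(1) by (intro mult_right_mono) auto
      also have "\<dots> = H a b"
        using H_scale[of s \<xi> \<eta>] *(1) unfolding *(3,4) by (simp add: mult.commute)
      finally show ?thesis
        using *(2) by simp
    qed (use u_pos v_pos in auto)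
  qed
qed

text \<open>The minimum m on the square bounds the weighted radius by (Y / m)^(1/12), and the
  coordinates are at most its u-th and v-th powers. \<open>K\<close> collects the two resulting
  powers of 1 / m.\<close>

lemma coordinate_bounds:
  obtains K where "K > 0"
    "\<And>Y a b. H a b \<le> Y \<Longrightarrow> \<bar>a\<bar> \<le> K * Y powr (u / 12) \<and> \<bar>b\<bar> \<le> K * Y powr (v / 12)"
proof -
  obtain m where m: "m > 0" "\<And>a b. m * max (root u \<bar>a\<bar>) (root v \<bar>b\<bar>) ^ 12 \<le> H a b"
    using H_radial_lower by blast
  define K where "K = max ((1 / m) powr (u / 12)) ((1 / m) powr (v / 12))"
  show ?thesis
  proof (rule that[of K])
    show "K > 0"
      using m(1) by (simp add: K_def less_max_iff_disj)
    fix Y a b assume HY: "H a b \<le> Y"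
    define s where "s = max (root u \<bar>a\<bar>) (root v \<bar>b\<bar>)"
    have s0: "s \<ge> 0"
      using u_pos v_pos by (auto simp: s_def le_max_iff_disj)
    have Y: "Y \<ge> 0"
      using HY H_nonneg[of a b] by linarith
    have s12: "s ^ 12 \<le> Y / m"
      using m(2)[of a b] HY m(1) unfolding s_def by (simp add: field_simps)
    have pw: "s ^ k \<le> (1 / m) powr (k / 12) * Y powr (k / 12)" if "k > 0" for k :: nat
    proof (cases "s = 0")
      case False
      hence s: "s > 0"
        using s0 by simp
      have "s ^ k = (s powr 12) powr (k / 12)"
        unfolding powr_powr using powr_realpow[OF s, of k] by simp
      also have "\<dots> = (s ^ 12) powr (k / 12)"
        using s by simp
      also have "\<dots> \<le> (Y / m) powr (k / 12)"
        using s12 s by (intro powr_mono2) auto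
      also have "\<dots> = (1 / m) powr (k / 12) * Y powr (k / 12)"
        using m(1) Y by (simp add: powr_mult[symmetric])
      finally show ?thesis .
    qed (use that in \<open>simp add: zero_power\<close>)
    have "\<bar>a\<bar> \<le> s ^ u" "\<bar>b\<bar> \<le> s ^ v"
      using u_pos v_pos by (auto simp: s_def intro!: abs_le_power_of_root_le)
    moreover have "(1 / m) powr (u / 12) * Y powr (u / 12) \<le> K * Y powr (u / 12)"
      "(1 / m) powr (v / 12) * Y powr (v / 12) \<le> K * Y powr (v / 12)"
      by (auto simp: K_def intro!: mult_right_mono)
    ultimately show "\<bar>a\<bar> \<le> K * Y powr (u / 12) \<and> \<bar>b\<bar> \<le> K * Y powr (v / 12)"
      using pw[OF u_pos] pw[OF v_pos] by linarith
  qed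
qed

text \<open>By homogeneity the curve (s^u \<xi>, s^v \<eta>) reaches level 1 at s = H(\<xi>,
  \<eta>)^(-1/12). Each side of the square thus gives one arc, which is Lipschitz because H stays
  above m along the side.\<close>

lemma boundary_cover:
  obtains \<Gamma> :: "(real \<Rightarrow> real \<times> real) set" and L where "finite \<Gamma>"
    "\<And>\<gamma>. \<gamma> \<in> \<Gamma> \<Longrightarrow> L-lipschitz_on {-1..1} (\<lambda>t. fst (\<gamma> t)) \<and> L-lipschitz_on {-1..1} (\<lambda>t. snd (\<gamma> t))"
    "\<And>a b. H a b = 1 \<Longrightarrow> \<exists>\<gamma>\<in>\<Gamma>. \<exists>t\<in>{-1..1}. \<gamma> t = (a, b)"
proof -
  obtain m where m: "m > 0" "\<And>\<xi> \<eta>. max \<bar>\<xi>\<bar> \<bar>\<eta>\<bar> = 1 \<Longrightarrow> m \<le> H \<xi> \<eta>"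
    using H_lower by blast
  define vert where "vert = (\<lambda>\<sigma> t. (H \<sigma> t powr (- real u / 12) * \<sigma>, H \<sigma> t powr (- real v / 12) * t))"
  define hori where "hori = (\<lambda>\<sigma> t. (H t \<sigma> powr (- real u / 12) * t, H t \<sigma> powr (- real v / 12) * \<sigma>))"
  define \<Gamma> where "\<Gamma> = vert ` {-1, 1} \<union> hori ` {-1, 1}"
  have lip: "lip (\<lambda>t. fst (\<gamma> t))" "lip (\<lambda>t. snd (\<gamma> t))" if "\<gamma> \<in> \<Gamma>" for \<gamma>
  proof -
    have lower: "m \<le> H \<sigma> t" "m \<le> H t \<sigma>" if "\<sigma> \<in> {-1, 1}" "t \<in> {-1..1}" for \<sigma> t
      using that m(2)[of \<sigma> t] m(2)[of t \<sigma>] by (auto simp: max_def abs_if split: if_splits)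
    have "lip (\<lambda>t. H \<sigma> t powr e)" "lip (\<lambda>t. H t \<sigma> powr e)" if "\<sigma> \<in> {-1, 1}" for \<sigma> e
      using that lip_powr[OF H_lip(1) m(1) lower(1)] lip_powr[OF H_lip(2) m(1) lower(2)] by auto
    thus "lip (\<lambda>t. fst (\<gamma> t))" "lip (\<lambda>t. snd (\<gamma> t))"
      using that unfolding \<Gamma>_def vert_def hori_def by (auto intro!: lip_mult lip_minus)
  qed
  have fin: "finite \<Gamma>"
    by (simp add: \<Gamma>_def)
  obtain L1 where L1: "\<And>\<gamma>. \<gamma> \<in> \<Gamma> \<Longrightarrow> (L1 \<gamma>)-lipschitz_on {-1..1} (\<lambda>t. fst (\<gamma> t))"
    using lip(1) unfolding lip_def by metis
  obtain L2 where L2: "\<And>\<gamma>. \<gamma> \<in> \<Gamma> \<Longrightarrow> (L2 \<gamma>)-lipschitz_on {-1..1} (\<lambda>t. snd (\<gamma> t))"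
    using lip(2) unfolding lip_def by metis
  define L where "L = (\<Sum>\<gamma>\<in>\<Gamma>. L1 \<gamma> + L2 \<gamma>)"
  have nn: "0 \<le> L1 \<gamma>" "0 \<le> L2 \<gamma>" if "\<gamma> \<in> \<Gamma>" for \<gamma>
    using L1[OF that] L2[OF that] lipschitz_on_nonneg by blast+
  have "L1 \<gamma> + L2 \<gamma> \<le> L" if "\<gamma> \<in> \<Gamma>" for \<gamma>
    unfolding L_def using nn that fin by (intro member_le_sum) auto
  hence le: "L1 \<gamma> \<le> L" "L2 \<gamma> \<le> L" if "\<gamma> \<in> \<Gamma>" for \<gamma>
    using nn that by (metis add_increasing2 add_increasing order_refl order_trans)+
  show ?thesis
  proof (rule that[OF fin, of L])
    show "L-lipschitz_on {-1..1} (\<lambda>t. fst (\<gamma> t)) \<and> L-lipschitz_on {-1..1} (\<lambda>t. snd (\<gamma> t))" if "\<gamma> \<in> \<Gamma>" for \<gamma>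
      using lipschitz_on_mono[OF L1[OF that] order_refl le(1)[OF that]]
        lipschitz_on_mono[OF L2[OF that] order_refl le(2)[OF that]] by blast
    fix a b assume H1: "H a b = 1"
    hence "(a, b) \<noteq> (0, 0)"
      by auto
    then obtain s \<xi> \<eta> where *: "s > 0" "a = s ^ u * \<xi>" "b = s ^ v * \<eta>" "max \<bar>\<xi>\<bar> \<bar>\<eta>\<bar> = 1"
      using radial_cases by metis
    have "s ^ 12 * H \<xi> \<eta> = 1"
      using H1 H_scale[of s \<xi> \<eta>] * by simp
    hence "H \<xi> \<eta> = 1 / s ^ 12"
      using *(1) by (simp add: field_simps)
    also have "\<dots> = s powr (- 12)"
      using *(1) by (simp add: powr_minus inverse_eq_divide)
    finally have Hs: "H \<xi> \<eta> = s powr (- 12)" .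
    have "H \<xi> \<eta> powr (- real k / 12) = s ^ k" for k
      unfolding Hs powr_powr using powr_realpow[OF *(1), of k] by simp
    hence "(H \<xi> \<eta> powr (- real u / 12) * \<xi>, H \<xi> \<eta> powr (- real v / 12) * \<eta>) = (a, b)"
      using * by simp
    moreover have "\<xi> \<in> {-1, 1} \<and> \<eta> \<in> {-1..1} \<or> \<eta> \<in> {-1, 1} \<and> \<xi> \<in> {-1..1}"
      using *(4) by (auto simp: max_def abs_if split: if_splits)
    ultimately show "\<exists>\<gamma>\<in>\<Gamma>. \<exists>t\<in>{-1..1}. \<gamma> t = (a, b)"
      unfolding \<Gamma>_def vert_def hori_def by auto
  qed
qed

end

section \<open>Comparing the number of grid points with the area\<close>

lemma mem_cell_floor:
  assumes "\<delta>\<^sub>1 > 0" "\<delta>\<^sub>2 > 0"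
  shows "(a, b) \<in> cell \<delta>\<^sub>1 \<delta>\<^sub>2 x y (\<lfloor>(a - x) / \<delta>\<^sub>1\<rfloor>, \<lfloor>(b - y) / \<delta>\<^sub>2\<rfloor>)"
proof -
  have "x + \<delta> * of_int \<lfloor>(a - x) / \<delta>\<rfloor> \<le> a" "a < x + \<delta> * (of_int \<lfloor>(a - x) / \<delta>\<rfloor> + 1)"
    if "\<delta> > 0" for a x \<delta> :: real
  proof -
    define r where "r = (a - x) / \<delta>"
    have a: "a = x + \<delta> * r"
      using that by (simp add: r_def)
    show "x + \<delta> * of_int \<lfloor>(a - x) / \<delta>\<rfloor> \<le> a" "a < x + \<delta> * (of_int \<lfloor>(a - x) / \<delta>\<rfloor> + 1)"
      unfolding r_def[symmetric] a using that by (simp_all add: floor_less_iff[symmetric])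
  qed
  thus ?thesis
    using assms by (simp add: cell_def)
qed

lemma cell_index_unique:
  fixes a x \<delta> :: real
  assumes "\<delta> > 0" "x + \<delta> * of_int i \<le> a" "a < x + \<delta> * (of_int i + 1)"
  shows "i = \<lfloor>(a - x) / \<delta>\<rfloor>"
proof -
  have "\<delta> * of_int i \<le> a - x" "a - x < \<delta> * (of_int i + 1)"
    using assms by simp_all
  hence "of_int i \<le> (a - x) / \<delta>" "(a - x) / \<delta> < of_int i + 1"
    using assms(1) by (simp_all add: field_simps)
  thus ?thesis
    by linarith
qed

lemma disjoint_cells: "\<delta>\<^sub>1 > 0 \<Longrightarrow> \<delta>\<^sub>2 > 0 \<Longrightarrow> disjoint_family_on (cell \<delta>\<^sub>1 \<delta>\<^sub>2 x y) S"
  unfolding disjoint_family_on_def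
proof (intro ballI impI equals0I)
  fix c d z assume \<delta>: "\<delta>\<^sub>1 > 0" "\<delta>\<^sub>2 > 0" and "c \<noteq> d" and z: "z \<in> cell \<delta>\<^sub>1 \<delta>\<^sub>2 x y c \<inter> cell \<delta>\<^sub>1 \<delta>\<^sub>2 x y d"
  have "e = (\<lfloor>(fst z - x) / \<delta>\<^sub>1\<rfloor>, \<lfloor>(snd z - y) / \<delta>\<^sub>2\<rfloor>)" if "z \<in> cell \<delta>\<^sub>1 \<delta>\<^sub>2 x y e" for e
    using that cell_index_unique[OF \<delta>(1), of x "fst e" "fst z"] cell_index_unique[OF \<delta>(2), of y "snd e" "snd z"]
    by (auto simp: cell_def split: prod.splits)
  thus False
    using z \<open>c \<noteq> d\<close> by blast
qed

lemma cell_subset_closed_cell: "cell \<delta>\<^sub>1 \<delta>\<^sub>2 x y c \<subseteq> closed_cell \<delta>\<^sub>1 \<delta>\<^sub>2 x y c"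
  by (auto simp: cell_def closed_cell_def)

lemma connected_closed_cell: "connected (closed_cell \<delta>\<^sub>1 \<delta>\<^sub>2 x y c)"
  by (auto simp: closed_cell_def split: prod.splits intro!: connected_Times)

lemma cell_fmeasurable:
  assumes "\<delta>\<^sub>1 > 0" "\<delta>\<^sub>2 > 0"
  shows "cell \<delta>\<^sub>1 \<delta>\<^sub>2 x y c \<in> fmeasurable lborel" "measure lborel (cell \<delta>\<^sub>1 \<delta>\<^sub>2 x y c) = \<delta>\<^sub>1 * \<delta>\<^sub>2"
proof -
  obtain i j where c: "c = (i, j)"
    by (cases c)
  have "emeasure lborel (cell \<delta>\<^sub>1 \<delta>\<^sub>2 x y c) = ennreal (\<delta>\<^sub>1 * \<delta>\<^sub>2)"
    using assms unfolding c cell_def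
    by (simp add: lborel_prod[symmetric] lborel.emeasure_pair_measure_Times ennreal_mult[symmetric] algebra_simps)
  moreover have "cell \<delta>\<^sub>1 \<delta>\<^sub>2 x y c \<in> sets lborel"
    unfolding c cell_def by (simp add: lborel_prod[symmetric])
  ultimately show "cell \<delta>\<^sub>1 \<delta>\<^sub>2 x y c \<in> fmeasurable lborel" "measure lborel (cell \<delta>\<^sub>1 \<delta>\<^sub>2 x y c) = \<delta>\<^sub>1 * \<delta>\<^sub>2"
    using assms by (simp_all add: fmeasurable_def measure_def)
qed

lemma finite_int_affine_bounded:
  fixes x \<delta> K :: real
  assumes "\<delta> > 0"
  shows "finite {i::int. \<bar>x + \<delta> * of_int i\<bar> \<le> K}"
proof (rule finite_subset)
  show "{i::int. \<bar>x + \<delta> * of_int i\<bar> \<le> K} \<subseteq> {\<lfloor>(-K - x) / \<delta>\<rfloor> .. \<lceil>(K - x) / \<delta>\<rceil>}"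
  proof
    fix i :: int assume "i \<in> {i. \<bar>x + \<delta> * of_int i\<bar> \<le> K}"
    hence "(-K - x) / \<delta> \<le> of_int i" "of_int i \<le> (K - x) / \<delta>"
      using assms by (auto simp: field_simps abs_le_iff)
    thus "i \<in> {\<lfloor>(-K - x) / \<delta>\<rfloor> .. \<lceil>(K - x) / \<delta>\<rceil>}"
      by simp linarith
  qed
qed auto

context weighted_height
begin

definition area :: real where
  "area = measure lborel {(a, b). H a b \<le> 1}"

lemma region_fmeasurable: "{(a, b). H a b \<le> 1} \<in> fmeasurable lborel"
proof -
  obtain K where K: "K > 0" "\<And>Y a b. H a b \<le> Y \<Longrightarrow> \<bar>a\<bar> \<le> K * Y powr (u / 12) \<and> \<bar>b\<bar> \<le> K * Y powr (v / 12)"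
    using coordinate_bounds by blast
  have "{(a, b). H a b \<le> 1} \<subseteq> {-K..K} \<times> {-K..K}"
    using K(2)[of _ _ 1] by (force simp: abs_le_iff)
  hence "bounded {(a, b). H a b \<le> 1}"
    by (rule bounded_subset[rotated]) (intro bounded_Times bounded_closed_interval)
  moreover have "closed {(a, b). H a b \<le> 1}"
  proof -
    have "closed {z. (\<lambda>(a, b). H a b) z \<le> 1}"
      by (intro closed_Collect_le H_cont continuous_intros)
    thus ?thesis
      by (simp add: case_prod_unfold)
  qed
  ultimately have "compact {(a, b). H a b \<le> 1}"
    by (simp add: compact_eq_bounded_closed)
  thus ?thesis
    by (rule fmeasurable_compact)
qed

text \<open>Intermediate value theorem. It charges a cell with points on both sides of the boundary
  to one of the arcs of \<open>boundary_cover\<close>.\<close>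

lemma crossing:
  assumes "connected S" "z \<in> S" "w \<in> S" "H (fst z) (snd z) \<le> 1" "H (fst w) (snd w) > 1"
  shows "\<exists>(a, b)\<in>S. H a b = 1"
proof -
  have "connected ((\<lambda>(a, b). H a b) ` S)"
    using assms(1) H_cont by (intro connected_continuous_image) (auto intro: continuous_on_subset)
  moreover have "H (fst z) (snd z) \<in> (\<lambda>(a, b). H a b) ` S" "H (fst w) (snd w) \<in> (\<lambda>(a, b). H a b) ` S"
    using assms(2,3) by force+
  ultimately have "{H (fst z) (snd z)..H (fst w) (snd w)} \<subseteq> (\<lambda>(a, b). H a b) ` S"
    by (rule connected_contains_Icc)
  moreover have "1 \<in> {H (fst z) (snd z)..H (fst w) (snd w)}"
    using assms(4,5) by simp
  ultimately obtain z where "z \<in> S" "1 = (\<lambda>(a, b). H a b) z"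
    by blast
  thus ?thesis
    by (intro bexI[of _ z]) (auto split: prod.splits)
qed

text \<open>The region stays fixed while the mesh shrinks, instead of the region growing. The
  offsets \<open>x\<close>, \<open>y\<close> allow for arbitrary residue classes.\<close>

definition grid_points :: "real \<Rightarrow> real \<Rightarrow> real \<Rightarrow> real \<Rightarrow> (int \<times> int) set" where
  "grid_points \<delta>\<^sub>1 \<delta>\<^sub>2 x y = {(i, j). H (x + \<delta>\<^sub>1 * of_int i) (y + \<delta>\<^sub>2 * of_int j) \<le> 1}"

lemma finite_grid_points:
  assumes "\<delta>\<^sub>1 > 0" "\<delta>\<^sub>2 > 0"
  shows "finite (grid_points \<delta>\<^sub>1 \<delta>\<^sub>2 x y)"
proof -
  obtain K where K: "K > 0" "\<And>Y a b. H a b \<le> Y \<Longrightarrow> \<bar>a\<bar> \<le> K * Y powr (u / 12) \<and> \<bar>b\<bar> \<le> K * Y powr (v / 12)"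
    using coordinate_bounds by blast
  have "grid_points \<delta>\<^sub>1 \<delta>\<^sub>2 x y \<subseteq> {i. \<bar>x + \<delta>\<^sub>1 * of_int i\<bar> \<le> K} \<times> {j. \<bar>y + \<delta>\<^sub>2 * of_int j\<bar> \<le> K}"
    using K(2)[of _ _ 1] by (force simp: grid_points_def)
  thus ?thesis
    by (rule finite_subset) (intro finite_cartesian_product finite_int_affine_bounded assms)
qed

text \<open>Compare the region with the union of the cells whose corner lies in it. A cell missed by
  the boundary is wholly inside or wholly outside, so the two areas differ by at most the total area
  of the cells in \<open>B\<close>.\<close>

lemma grid_points_count:
  obtains C where "C \<ge> 0"
    "\<And>\<delta>\<^sub>1 \<delta>\<^sub>2 x y. \<delta>\<^sub>1 > 0 \<Longrightarrow> \<delta>\<^sub>2 > 0 \<Longrightarrow>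
       \<bar>real (card (grid_points \<delta>\<^sub>1 \<delta>\<^sub>2 x y)) - area / (\<delta>\<^sub>1 * \<delta>\<^sub>2)\<bar> \<le> C * (1 / \<delta>\<^sub>1 + 1 / \<delta>\<^sub>2 + 1)"
proof -
  obtain \<Gamma> :: "(real \<Rightarrow> real \<times> real) set" and L where \<Gamma>: "finite \<Gamma>"
    "\<And>\<gamma>. \<gamma> \<in> \<Gamma> \<Longrightarrow> L-lipschitz_on {-1..1} (\<lambda>t. fst (\<gamma> t)) \<and> L-lipschitz_on {-1..1} (\<lambda>t. snd (\<gamma> t))"
    "\<And>a b. H a b = 1 \<Longrightarrow> \<exists>\<gamma>\<in>\<Gamma>. \<exists>t\<in>{-1..1}. \<gamma> t = (a, b)"
    using boundary_cover by metis
  \<comment> \<open>The Lipschitz condition makes \<open>L\<close> nonnegative as soon as there is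
    an arc; \<open>max L 0\<close> gives C \<ge> 0 in every case.\<close>
  define C where "C = card \<Gamma> * (75 * max L 0 + 75)"
  show ?thesis
  proof (rule that[of C])
    show "C \<ge> 0"
      by (simp add: C_def)
    fix \<delta>\<^sub>1 \<delta>\<^sub>2 x y :: real assume \<delta>: "\<delta>\<^sub>1 > 0" "\<delta>\<^sub>2 > 0"
    define R where "R = {(a, b). H a b \<le> 1}"
    define P where "P = grid_points \<delta>\<^sub>1 \<delta>\<^sub>2 x y"
    define Q where "Q = closed_cell \<delta>\<^sub>1 \<delta>\<^sub>2 x y"
    define q where "q = cell \<delta>\<^sub>1 \<delta>\<^sub>2 x y"
    define B where "B = (\<Union>\<gamma>\<in>\<Gamma>. {c. \<exists>t\<in>{-1..1}. \<gamma> t \<in> Q c})"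
    have finB: "finite B"
      unfolding B_def Q_def using \<Gamma>(1,2) cells_meeting_curve(1)[OF _ _ \<delta>] by blast
    have "real (card B) \<le> (\<Sum>\<gamma>\<in>\<Gamma>. real (card {c. \<exists>t\<in>{-1..1}. \<gamma> t \<in> Q c}))"
      unfolding B_def of_nat_sum[symmetric] of_nat_le_iff by (rule card_UN_le[OF \<Gamma>(1)])
    also have "\<dots> \<le> (\<Sum>\<gamma>\<in>\<Gamma>. (75 * max L 0 + 75) * (1 / \<delta>\<^sub>1 + 1 / \<delta>\<^sub>2 + 1))"
    proof (rule sum_mono)
      fix \<gamma> assume \<gamma>: "\<gamma> \<in> \<Gamma>"
      have "L-lipschitz_on {-1..1} (\<lambda>t. fst (\<gamma> t))"
        using \<Gamma>(2)[OF \<gamma>] by blast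
      hence "max L 0 = L"
        using lipschitz_on_nonneg by fastforce
      thus "real (card {c. \<exists>t\<in>{-1..1}. \<gamma> t \<in> Q c}) \<le> (75 * max L 0 + 75) * (1 / \<delta>\<^sub>1 + 1 / \<delta>\<^sub>2 + 1)"
        using cells_meeting_curve(2)[of L \<gamma>, OF _ _ \<delta>] \<Gamma>(2)[OF \<gamma>] unfolding Q_def by simp
    qed
    finally have cardB: "real (card B) \<le> C * (1 / \<delta>\<^sub>1 + 1 / \<delta>\<^sub>2 + 1)"
      by (simp add: C_def)
    have hits: "c \<in> B" if "z \<in> Q c" "w \<in> Q c" "H (fst z) (snd z) \<le> 1" "H (fst w) (snd w) > 1" for c z w
    proof -
      have "\<exists>(a, b)\<in>Q c. H a b = 1"
        using that unfolding Q_def by (intro crossing[OF connected_closed_cell]) auto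
      then obtain a b where ab: "(a, b) \<in> Q c" "H a b = 1"
        by blast
      then obtain \<gamma> t where "\<gamma> \<in> \<Gamma>" "t \<in> {-1..1}" "\<gamma> t = (a, b)"
        using \<Gamma>(3) by blast
      moreover from this have "\<gamma> t \<in> Q c"
        using ab(1) by simp
      ultimately show ?thesis
        unfolding B_def by blast
    qed
    have corner: "(x + \<delta>\<^sub>1 * of_int (fst c), y + \<delta>\<^sub>2 * of_int (snd c)) \<in> Q c" for c
      using \<delta> by (cases c) (auto simp: Q_def closed_cell_def)
    have qQ: "q c \<subseteq> Q c" for c
      unfolding q_def Q_def by (rule cell_subset_closed_cell)
    have P_iff: "c \<in> P \<longleftrightarrow> H (x + \<delta>\<^sub>1 * of_int (fst c)) (y + \<delta>\<^sub>2 * of_int (snd c)) \<le> 1" for c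
      by (cases c) (simp add: P_def grid_points_def)
    have inner: "(\<Union>c\<in>P - B. q c) \<subseteq> R"
    proof clarify
      fix i j a b assume c: "(i, j) \<in> P" "(i, j) \<notin> B" "(a, b) \<in> q (i, j)"
      thus "(a, b) \<in> R"
        using hits[OF corner, of "(a, b)" "(i, j)"] qQ[of "(i, j)"] P_iff[of "(i, j)"]
        by (force simp: R_def)
    qed
    have outer: "R \<subseteq> (\<Union>c\<in>P \<union> B. q c)"
    proof clarify
      fix a b assume ab: "(a, b) \<in> R"
      define c where "c = (\<lfloor>(a - x) / \<delta>\<^sub>1\<rfloor>, \<lfloor>(b - y) / \<delta>\<^sub>2\<rfloor>)"
      have c: "(a, b) \<in> q c"
        unfolding q_def c_def by (rule mem_cell_floor[OF \<delta>])
      have "c \<in> P \<union> B"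
        using hits[OF _ corner, of "(a, b)" c] qQ[of c] c ab P_iff[of c] by (force simp: R_def)
      thus "(a, b) \<in> (\<Union>c\<in>P \<union> B. q c)"
        using c by blast
    qed
    have finP: "finite P"
      unfolding P_def by (rule finite_grid_points[OF \<delta>])
    have q: "q c \<in> fmeasurable lborel" "measure lborel (q c) = \<delta>\<^sub>1 * \<delta>\<^sub>2" for c
      unfolding q_def using cell_fmeasurable[OF \<delta>] by blast+
    have R: "R \<in> fmeasurable lborel"
      unfolding R_def by (rule region_fmeasurable)
    have "real (card (P - B)) * (\<delta>\<^sub>1 * \<delta>\<^sub>2) = (\<Sum>c\<in>P - B. measure lborel (q c))"
      by (simp add: q)
    also have "\<dots> = measure lborel (\<Union>c\<in>P - B. q c)"
    proof (rule measure_finite_Union[symmetric])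
      show "disjoint_family_on q (P - B)"
        unfolding q_def using disjoint_cells[OF \<delta>] .
      show "emeasure lborel (q c) \<noteq> \<infinity>" for c
        using q(1)[of c] by (simp add: fmeasurable_def less_top)
    qed (use finP q in \<open>auto simp: fmeasurable_def\<close>)
    also have "\<dots> \<le> measure lborel R"
      by (rule measure_mono_fmeasurable[OF inner _ R]) (use finP q in \<open>auto intro!: sets.finite_UN simp: fmeasurable_def\<close>)
    finally have "real (card (P - B)) * (\<delta>\<^sub>1 * \<delta>\<^sub>2) \<le> area"
      by (simp add: area_def R_def)
    moreover have "real (card P) \<le> real (card (P - B)) + real (card B)"
      using finP finB by (metis card_Un_le le_add_same_cancel1 Un_Diff_cancel2 Un_upper1 card_mono finite_Un le_trans of_nat_add of_nat_mono)
    hence "real (card P) * (\<delta>\<^sub>1 * \<delta>\<^sub>2) \<le> (real (card (P - B)) + real (card B)) * (\<delta>\<^sub>1 * \<delta>\<^sub>2)"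
      using \<delta> by (intro mult_right_mono) auto
    ultimately have 1: "real (card P) * (\<delta>\<^sub>1 * \<delta>\<^sub>2) \<le> area + real (card B) * (\<delta>\<^sub>1 * \<delta>\<^sub>2)"
      by (simp add: distrib_right)
    have "area \<le> measure lborel (\<Union>c\<in>P \<union> B. q c)"
      unfolding area_def R_def[symmetric]
      by (rule measure_mono_fmeasurable[OF outer])
         (use finP finB q R in \<open>auto intro!: fmeasurable.finite_UN simp: fmeasurableD\<close>)
    also have "\<dots> \<le> (\<Sum>c\<in>P \<union> B. measure lborel (q c))"
      by (rule measure_UNION_le) (use finP finB fmeasurableD[OF q(1)] in auto)
    also have "\<dots> = real (card (P \<union> B)) * (\<delta>\<^sub>1 * \<delta>\<^sub>2)"
      by (simp add: q)
    also have "\<dots> \<le> (real (card P) + real (card B)) * (\<delta>\<^sub>1 * \<delta>\<^sub>2)"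
      using \<delta> card_Un_le[of P B] by (intro mult_right_mono) (auto simp flip: of_nat_add)
    finally have 2: "area \<le> real (card P) * (\<delta>\<^sub>1 * \<delta>\<^sub>2) + real (card B) * (\<delta>\<^sub>1 * \<delta>\<^sub>2)"
      by (simp add: distrib_right)
    have "\<bar>real (card P) * (\<delta>\<^sub>1 * \<delta>\<^sub>2) - area\<bar> \<le> real (card B) * (\<delta>\<^sub>1 * \<delta>\<^sub>2)"
      using 1 2 by linarith
    moreover have "real (card P) - area / (\<delta>\<^sub>1 * \<delta>\<^sub>2) = (real (card P) * (\<delta>\<^sub>1 * \<delta>\<^sub>2) - area) / (\<delta>\<^sub>1 * \<delta>\<^sub>2)"
      using \<delta> by (simp add: field_simps)
    ultimately have "\<bar>real (card P) - area / (\<delta>\<^sub>1 * \<delta>\<^sub>2)\<bar> \<le> real (card B)"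
      using \<delta> by (simp add: abs_divide pos_divide_le_eq)
    thus "\<bar>real (card (grid_points \<delta>\<^sub>1 \<delta>\<^sub>2 x y)) - area / (\<delta>\<^sub>1 * \<delta>\<^sub>2)\<bar> \<le> C * (1 / \<delta>\<^sub>1 + 1 / \<delta>\<^sub>2 + 1)"
      using cardB unfolding P_def by linarith
  qed
qed

end

section \<open>Sieving for primitive points\<close>

definition moebius_mu :: "nat \<Rightarrow> real" where
  "moebius_mu n = (if squarefree n then (-1) ^ card (prime_factors n) else 0)"

lemma abs_moebius_mu_le: "\<bar>moebius_mu n\<bar> \<le> 1"
  by (simp add: moebius_mu_def power_abs)

lemma squarefree_prime_mult:
  fixes q n :: nat
  assumes "prime q" "\<not> q dvd n" "squarefree n"
  shows "squarefree (q * n)"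
  by (rule squarefree_mult_coprime[OF prime_imp_coprime[OF assms(1,2)] squarefree_prime[OF assms(1)] assms(3)])

lemma moebius_mu_times_prime:
  assumes "prime q" "\<not> q dvd n" "squarefree n"
  shows "moebius_mu (q * n) = - moebius_mu n"
proof -
  have n: "n \<noteq> 0"
    using assms(3) by (auto intro: Nat.gr0I)
  have sq: "squarefree (q * n)"
    by (rule squarefree_prime_mult[OF assms])
  have "prime_factors (q * n) = insert q (prime_factors n)"
    using assms(1) n by (simp add: prime_factors_product prime_prime_factors)
  moreover have "q \<notin> prime_factors n"
    using assms(2) by auto
  ultimately show ?thesis
    using sq assms(3) by (simp add: moebius_mu_def)
qed

text \<open>If D contains a prime q, multiplication by q pairs the squarefree members prime to q
  with those divisible by q and reverses the sign; if it contains none, D is {1}. In the application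
  D consists of the divisors of a single number, and the two closure properties stand in for that
  number.\<close>

lemma sum_moebius:
  fixes D :: "nat set"
  assumes fin: "finite D" and one: "1 \<in> D" and zero: "0 \<notin> D"
    and down: "\<And>m n. n \<in> D \<Longrightarrow> m dvd n \<Longrightarrow> m \<in> D"
    and up: "\<And>q n. n \<in> D \<Longrightarrow> q \<in> D \<Longrightarrow> prime q \<Longrightarrow> \<not> q dvd n \<Longrightarrow> q * n \<in> D"
  shows "(\<Sum>n\<in>D. moebius_mu n) = (if \<exists>q\<in>D. prime q then 0 else 1)"
proof (cases "\<exists>q\<in>D. prime q")
  case True
  then obtain q where q: "q \<in> D" "prime q"
    by blast
  define A where "A = {n \<in> D. squarefree n \<and> \<not> q dvd n}"
  define B where "B = {n \<in> D. squarefree n \<and> q dvd n}"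
  have B: "B = (*) q ` A"
  proof (intro Set.set_eqI iffI)
    fix n assume n: "n \<in> B"
    then obtain k where k: "n = q * k"
      by (auto simp: B_def)
    have "\<not> q dvd k"
    proof
      assume "q dvd k"
      hence "q\<^sup>2 dvd n"
        by (simp add: k power2_eq_square)
      hence "q dvd 1"
        using n unfolding B_def squarefree_def by blast
      thus False
        using q(2) by auto
    qed
    moreover have "squarefree k" "k \<in> D"
      using n k down[of n k] by (auto simp: B_def dest: squarefree_multD)
    ultimately show "n \<in> (*) q ` A"
      by (auto simp: A_def k)
  next
    fix n assume "n \<in> (*) q ` A"
    thus "n \<in> B"
      using up q squarefree_prime_mult by (auto simp: A_def B_def)
  qed
  have "inj_on ((*) q) A"
    using q(2) by (auto simp: inj_on_def)
  hence "sum moebius_mu B = (\<Sum>n\<in>A. moebius_mu (q * n))"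
    by (simp add: B sum.reindex)
  also have "\<dots> = (\<Sum>n\<in>A. - moebius_mu n)"
    by (intro sum.cong refl moebius_mu_times_prime[OF q(2)]) (auto simp: A_def)
  finally have "sum moebius_mu B = - sum moebius_mu A"
    by (simp add: sum_negf)
  moreover have "sum moebius_mu D = sum moebius_mu (A \<union> B)"
    by (rule sum.mono_neutral_right[OF fin]) (auto simp: A_def B_def moebius_mu_def)
  moreover have "sum moebius_mu (A \<union> B) = sum moebius_mu A + sum moebius_mu B"
    by (rule sum.union_disjoint) (use fin in \<open>auto simp: A_def B_def\<close>)
  ultimately show ?thesis
    using True by simp
next
  case False
  have "D = {1}"
  proof -
    have "n = 1" if "n \<in> D" for n
      using that zero False down prime_factor_nat[of n] by metis
    thus ?thesis
      using one by blast
  qed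
  thus ?thesis
    using False by (simp add: moebius_mu_def)
qed

section \<open>Counting primitive points in residue classes\<close>

context weighted_height
begin

lemma scaled_le_iff:
  assumes "s > 0"
  shows "H a b \<le> (s * t) ^ 12 \<longleftrightarrow> H (a / s ^ u) (b / s ^ v) \<le> t ^ 12"
proof -
  have "H a b = s ^ 12 * H (a / s ^ u) (b / s ^ v)"
    using H_scale[of s "a / s ^ u" "b / s ^ v"] assms by simp
  thus ?thesis
    using assms by (simp only: power_mult_distrib) simp
qed

lemma residue_class_count:
  obtains C where "C \<ge> 0"
    "\<And>t p x y. t > 0 \<Longrightarrow> p > 0 \<Longrightarrow>
       \<bar>real (card {(a :: int, b :: int). H a b \<le> t ^ 12 \<and> a mod int p = x mod int p \<and> b mod int p = y mod int p})
          - area * t ^ (u + v) / (real p)\<^sup>2\<bar> \<le> C * (t ^ u / real p + t ^ v / real p + 1)"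
proof -
  obtain C where C: "C \<ge> 0"
    "\<And>\<delta>\<^sub>1 \<delta>\<^sub>2 x y. \<delta>\<^sub>1 > 0 \<Longrightarrow> \<delta>\<^sub>2 > 0 \<Longrightarrow>
       \<bar>real (card (grid_points \<delta>\<^sub>1 \<delta>\<^sub>2 x y)) - area / (\<delta>\<^sub>1 * \<delta>\<^sub>2)\<bar> \<le> C * (1 / \<delta>\<^sub>1 + 1 / \<delta>\<^sub>2 + 1)"
    using grid_points_count by blast
  show ?thesis
  proof (rule that[OF C(1)])
    fix t :: real and p :: nat and x y :: int assume t: "t > 0" and p: "p > 0"
    let ?A = "{(a :: int, b :: int). H a b \<le> t ^ 12 \<and> a mod int p = x mod int p \<and> b mod int p = y mod int p}"
    \<comment> \<open>Substituting a = x + p i, b = y + p j and scaling the region H \<le> t^12 back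
      to H \<le> 1 gives this grid.\<close>
    let ?G = "grid_points (p / t ^ u) (p / t ^ v) (x / t ^ u) (y / t ^ v)"
    have le_iff: "H (of_int (x + int p * i)) (of_int (y + int p * j)) \<le> t ^ 12 \<longleftrightarrow> (i, j) \<in> ?G" for i j
      using scaled_le_iff[OF t, of "of_int (x + int p * i)" "of_int (y + int p * j)" 1]
      by (simp add: grid_points_def add_divide_distrib)
    have "?A = (\<lambda>(i, j). (x + int p * i, y + int p * j)) ` ?G"
    proof (intro Set.set_eqI iffI)
      fix c assume c: "c \<in> ?A"
      obtain a b where ab: "c = (a, b)"
        by (cases c)
      have "int p dvd a - x" "int p dvd b - y"
        using c ab by (auto simp: mod_eq_dvd_iff)
      then obtain i j where "a - x = int p * i" "b - y = int p * j"
        by (auto elim!: dvdE)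
      hence "a = x + int p * i" "b = y + int p * j"
        by simp_all
      thus "c \<in> (\<lambda>(i, j). (x + int p * i, y + int p * j)) ` ?G"
        using c ab le_iff[of i j] by force
    next
      fix c assume "c \<in> (\<lambda>(i, j). (x + int p * i, y + int p * j)) ` ?G"
      then obtain i j where "c = (x + int p * i, y + int p * j)" "(i, j) \<in> ?G"
        by auto
      thus "c \<in> ?A"
        using le_iff[of i j] by simp
    qed
    moreover have "inj_on (\<lambda>(i, j). (x + int p * i, y + int p * j)) ?G"
      using p by (auto simp: inj_on_def)
    ultimately have "card ?A = card ?G"
      by (simp add: card_image)
    moreover have "area / (p / t ^ u * (p / t ^ v)) = area * t ^ (u + v) / (real p)\<^sup>2"
      by (simp add: power_add power2_eq_square)
    ultimately show "\<bar>real (card ?A) - area * t ^ (u + v) / (real p)\<^sup>2\<bar> \<le> C * (t ^ u / real p + t ^ v / real p + 1)"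
      using C(2)[of "p / t ^ u" "p / t ^ v" "x / t ^ u" "y / t ^ v"] t p by simp
  qed
qed

lemma finite_int_points: "finite {(a :: int, b :: int). H a b \<le> Y}"
proof -
  obtain K where K: "K > 0" "\<And>Y a b. H a b \<le> Y \<Longrightarrow> \<bar>a\<bar> \<le> K * Y powr (u / 12) \<and> \<bar>b\<bar> \<le> K * Y powr (v / 12)"
    using coordinate_bounds by blast
  have "{(a :: int, b :: int). H a b \<le> Y} \<subseteq>
      {i. \<bar>0 + 1 * real_of_int i\<bar> \<le> K * Y powr (u / 12)} \<times> {i. \<bar>0 + 1 * real_of_int i\<bar> \<le> K * Y powr (v / 12)}"
    using K(2) by force
  thus ?thesis
    by (rule finite_subset) (intro finite_cartesian_product finite_int_affine_bounded, simp_all)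
qed

text \<open>A nonzero integer point has weighted radius at least 1. The bound is written as a
  twelfth power so that comparison with t^12 gives the cut-off n \<le> t / m of the sieve.\<close>

lemma H_int_lower:
  obtains m where "m > 0" "\<And>(a::int) (b::int). (a, b) \<noteq> (0::int, 0::int) \<Longrightarrow> m ^ 12 \<le> H a b"
proof -
  obtain m where m: "m > 0" "\<And>a b. m * max (root u \<bar>a\<bar>) (root v \<bar>b\<bar>) ^ 12 \<le> H a b"
    using H_radial_lower by blast
  show ?thesis
  proof (rule that[of "root 12 m"])
    fix a b :: int assume "(a, b) \<noteq> (0::int, 0::int)"
    hence "1 \<le> \<bar>real_of_int a\<bar> \<or> 1 \<le> \<bar>real_of_int b\<bar>"
      by (auto simp: abs_if of_int_le_iff[of 1, unfolded of_int_1] split: if_splits)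
    hence "1 \<le> max (root u \<bar>real_of_int a\<bar>) (root v \<bar>real_of_int b\<bar>)"
      using u_pos v_pos by (auto simp: le_max_iff_disj real_root_ge_1_iff)
    hence "1 \<le> max (root u \<bar>real_of_int a\<bar>) (root v \<bar>real_of_int b\<bar>) ^ 12"
      by (rule one_le_power)
    hence "m \<le> m * max (root u \<bar>real_of_int a\<bar>) (root v \<bar>real_of_int b\<bar>) ^ 12"
      using m(1) by simp
    also have "\<dots> \<le> H a b"
      by (rule m(2))
    finally show "root 12 m ^ 12 \<le> H a b"
      using m(1) by simp
  qed (use m(1) in simp)
qed

definition primitive :: "int \<Rightarrow> int \<Rightarrow> bool" where
  "primitive a b \<longleftrightarrow> \<not> (\<exists>q::nat. prime q \<and> int q ^ u dvd a \<and> int q ^ v dvd b)"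

lemma not_primitive_zero: "\<not> primitive 0 0"
  unfolding primitive_def using two_is_prime_nat by blast

text \<open>By \<open>bound\<close> the range {1..N} misses no n with n^u | a and n^v | b. The set
  of these n is closed under divisors, and under multiplication by a new prime because powers of
  coprime numbers that divide a number do so jointly.\<close>

lemma sum_moebius_weighted:
  fixes a b :: int
  assumes "(a, b) \<noteq> (0::int, 0::int)"
    and bound: "\<And>n. n > 0 \<Longrightarrow> int n ^ u dvd a \<Longrightarrow> int n ^ v dvd b \<Longrightarrow> n \<le> N"
  shows "(\<Sum>n | n \<in> {1..N} \<and> int n ^ u dvd a \<and> int n ^ v dvd b. moebius_mu n) = (if primitive a b then 1 else 0)"
proof -
  define D where "D = {n \<in> {1..N}. int n ^ u dvd a \<and> int n ^ v dvd b}"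
  have D: "n \<in> D \<longleftrightarrow> n > 0 \<and> int n ^ u dvd a \<and> int n ^ v dvd b" for n
    using bound[of n] by (auto simp: D_def)
  have "(\<Sum>n\<in>D. moebius_mu n) = (if \<exists>q\<in>D. prime q then 0 else 1)"
  proof (rule sum_moebius)
    show "1 \<in> D"
      by (simp add: D)
    show "m \<in> D" if n: "n \<in> D" and "m dvd n" for m n
    proof -
      have "int m ^ u dvd int n ^ u" "int m ^ v dvd int n ^ v"
        using that(2) by (intro dvd_power_same; simp)+
      moreover have "m > 0"
        using that D[of n] by (intro Nat.gr0I) auto
      ultimately show ?thesis
        using n D dvd_trans by blast
    qed
    show "q * n \<in> D" if "n \<in> D" "q \<in> D" "prime q" "\<not> q dvd n" for q n
    proof -
      have "coprime q n"
        using that(3,4) by (rule prime_imp_coprime)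
      hence "coprime (int q ^ k) (int n ^ k)" for k
        by simp
      hence "int q ^ u * int n ^ u dvd a" "int q ^ v * int n ^ v dvd b"
        using that(1,2) by (auto simp: D intro!: divides_mult)
      thus ?thesis
        using that(1,2) by (simp add: D power_mult_distrib)
    qed
  qed (auto simp: D_def)
  moreover have "(\<exists>q\<in>D. prime q) \<longleftrightarrow> \<not> primitive a b"
    using prime_gt_0_nat by (auto simp: primitive_def D)
  ultimately show ?thesis
    by (simp add: D_def)
qed

text \<open>The origin is left out because every n divides it; without it the set is empty for n > t
  / m, with \<open>m\<close> as in \<open>H_int_lower\<close>.\<close>

definition multiples :: "(int \<times> int \<Rightarrow> bool) \<Rightarrow> real \<Rightarrow> nat \<Rightarrow> (int \<times> int) set" where
  "multiples S t n = {(a, b). (a, b) \<noteq> (0::int, 0::int) \<and> H a b \<le> t ^ 12 \<and> S (a, b) \<and> int n ^ u dvd a \<and> int n ^ v dvd b}"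

text \<open>If n^u | a and n^v | b, then H(a, b) is n^12 times the height of a nonzero integer
  point, so n m \<le> t. Every N beyond t / m therefore gives an exact formula, which leaves N free
  to tend to infinity.\<close>

lemma card_primitive_moebius:
  assumes m: "m > 0" "\<And>(a::int) (b::int). (a, b) \<noteq> (0::int, 0::int) \<Longrightarrow> m ^ 12 \<le> H a b"
    and "t > 0" "t / m \<le> real N"
  shows "real (card {(a, b). H a b \<le> t ^ 12 \<and> primitive a b \<and> S (a, b)}) =
    (\<Sum>n = 1..N. moebius_mu n * real (card (multiples S t n)))"
proof -
  define T where "T = {(a :: int, b :: int). (a, b) \<noteq> (0::int, 0::int) \<and> H a b \<le> t ^ 12 \<and> S (a, b)}"
  have fin: "finite T"
    by (rule finite_subset[OF _ finite_int_points[of "t ^ 12"]]) (auto simp: T_def)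
  have bound: "n \<le> N" if *: "(a, b) \<in> T" "n > 0" "int n ^ u dvd a" "int n ^ v dvd b" for a b n
  proof -
    obtain a' b' where ab: "a = int n ^ u * a'" "b = int n ^ v * b'"
      using *(3,4) by (auto elim!: dvdE)
    have "real n ^ 12 * m ^ 12 \<le> real n ^ 12 * H a' b'"
      using that(1) ab by (intro mult_left_mono m(2)) (auto simp: T_def)
    also have "\<dots> = H a b"
      using H_scale[of "real n" a' b'] by (simp add: ab)
    also have "\<dots> \<le> t ^ 12"
      using that(1) by (simp add: T_def)
    finally have "(real n * m) ^ 12 \<le> t ^ 12"
      by (simp add: power_mult_distrib)
    hence "real n * m \<le> t"
      using assms(3) by (simp add: power_mono_iff m(1) less_imp_le)
    hence "real n \<le> t / m"
      using m(1) by (simp add: field_simps)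
    thus ?thesis
      using assms(4) by linarith
  qed
  have "(\<Sum>n = 1..N. moebius_mu n * real (card (multiples S t n))) =
      (\<Sum>n = 1..N. \<Sum>z\<in>T. if int n ^ u dvd fst z \<and> int n ^ v dvd snd z then moebius_mu n else 0)"
  proof (rule sum.cong[OF refl])
    fix n
    have "multiples S t n = {z \<in> T. int n ^ u dvd fst z \<and> int n ^ v dvd snd z}"
      by (auto simp: multiples_def T_def)
    thus "moebius_mu n * real (card (multiples S t n)) =
        (\<Sum>z\<in>T. if int n ^ u dvd fst z \<and> int n ^ v dvd snd z then moebius_mu n else 0)"
      using fin by (simp add: sum.inter_filter[symmetric])
  qed
  also have "\<dots> = (\<Sum>z\<in>T. \<Sum>n = 1..N. if int n ^ u dvd fst z \<and> int n ^ v dvd snd z then moebius_mu n else 0)"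
    by (rule sum.swap)
  also have "\<dots> = (\<Sum>z\<in>T. if primitive (fst z) (snd z) then 1 else 0)"
  proof (rule sum.cong[OF refl])
    fix z assume z: "z \<in> T"
    have "(\<Sum>n | n \<in> {1..N} \<and> int n ^ u dvd fst z \<and> int n ^ v dvd snd z. moebius_mu n) = (if primitive (fst z) (snd z) then 1 else 0)"
      using z bound[of "fst z" "snd z"] by (intro sum_moebius_weighted) (auto simp: T_def)
    thus "(\<Sum>n = 1..N. if int n ^ u dvd fst z \<and> int n ^ v dvd snd z then moebius_mu n else 0) =
        (if primitive (fst z) (snd z) then 1 else 0)"
      by (simp add: sum.inter_filter[symmetric])
  qed
  also have "\<dots> = real (card {z \<in> T. primitive (fst z) (snd z)})"
    using fin by (simp add: sum.inter_filter[symmetric])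
  also have "{z \<in> T. primitive (fst z) (snd z)} = {(a, b). H a b \<le> t ^ 12 \<and> primitive a b \<and> S (a, b)}"
    using not_primitive_zero by (auto simp: T_def)
  finally show ?thesis ..
qed

lemma area_nonneg: "area \<ge> 0"
  by (simp add: area_def)

text \<open>The constant is independent of \<open>S\<close>, because the sieve applies this to a set
  of residues that changes with n.\<close>

lemma residue_set_count:
  obtains C where "C \<ge> 0"
    "\<And>t p S. t > 0 \<Longrightarrow> p > 0 \<Longrightarrow> S \<subseteq> {0..<int p} \<times> {0..<int p} \<Longrightarrow>
       \<bar>real (card {(a :: int, b :: int). H a b \<le> t ^ 12 \<and> (a mod int p, b mod int p) \<in> S})
          - real (card S) * area / (real p)\<^sup>2 * t ^ (u + v)\<bar> \<le> C * (real p * t ^ u + real p * t ^ v + (real p)\<^sup>2)"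
proof -
  obtain C where C: "C \<ge> 0"
    "\<And>t p x y. t > 0 \<Longrightarrow> p > 0 \<Longrightarrow>
       \<bar>real (card {(a :: int, b :: int). H a b \<le> t ^ 12 \<and> a mod int p = x mod int p \<and> b mod int p = y mod int p})
          - area * t ^ (u + v) / (real p)\<^sup>2\<bar> \<le> C * (t ^ u / real p + t ^ v / real p + 1)"
    using residue_class_count by blast
  show ?thesis
  proof (rule that[OF C(1)])
    fix t :: real and p :: nat and S assume t: "t > 0" and p: "p > 0" and S: "S \<subseteq> {0..<int p} \<times> {0..<int p}"
    have finS: "finite S"
      by (rule finite_subset[OF S]) auto
    have "card S \<le> card ({0..<int p} \<times> {0..<int p})"
      by (rule card_mono[OF _ S]) auto
    hence cardS: "real (card S) \<le> (real p)\<^sup>2"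
      by (simp add: card_cartesian_product power2_eq_square flip: of_nat_mult)
    define F where "F = (\<lambda>z. {(a :: int, b :: int). H a b \<le> t ^ 12 \<and> a mod int p = fst z mod int p \<and> b mod int p = snd z mod int p})"
    let ?A = "{(a :: int, b :: int). H a b \<le> t ^ 12 \<and> (a mod int p, b mod int p) \<in> S}"
    have "fst z mod int p = fst z" "snd z mod int p = snd z" if "z \<in> S" for z
      using that S by (auto intro!: mod_pos_pos_trivial)
    hence F': "F z = {(a :: int, b :: int). H a b \<le> t ^ 12 \<and> (a mod int p, b mod int p) = z}" if "z \<in> S" for z
      using that unfolding F_def by (cases z) force
    have "?A = (\<Union>z\<in>S. F z)"
      using F' by auto
    moreover have "card (\<Union>z\<in>S. F z) = (\<Sum>z\<in>S. card (F z))"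
    proof (rule card_UN_disjoint[OF finS])
      show "\<forall>z\<in>S. finite (F z)"
        by (auto simp: F_def intro!: finite_subset[OF _ finite_int_points[of "t ^ 12"]])
      show "\<forall>z\<in>S. \<forall>z'\<in>S. z \<noteq> z' \<longrightarrow> F z \<inter> F z' = {}"
        using F' by auto
    qed
    ultimately have "real (card ?A) - real (card S) * area / (real p)\<^sup>2 * t ^ (u + v)
        = (\<Sum>z\<in>S. real (card (F z)) - area * t ^ (u + v) / (real p)\<^sup>2)"
      by (simp add: sum_subtractf)
    also have "\<bar>\<dots>\<bar> \<le> (\<Sum>z\<in>S. C * (t ^ u / real p + t ^ v / real p + 1))"
      unfolding F_def by (rule order_trans[OF sum_abs sum_mono[OF C(2)[OF t p]]])
    also have "\<dots> \<le> (real p)\<^sup>2 * (C * (t ^ u / real p + t ^ v / real p + 1))"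
      using cardS t C(1) by (simp add: mult_right_mono)
    also have "\<dots> = C * (real p * t ^ u + real p * t ^ v + (real p)\<^sup>2)"
      using p by (simp add: field_simps power2_eq_square)
    finally show "\<bar>real (card ?A) - real (card S) * area / (real p)\<^sup>2 * t ^ (u + v)\<bar>
        \<le> C * (real p * t ^ u + real p * t ^ v + (real p)\<^sup>2)" .
  qed
qed

lemma card_multiples:
  assumes "n > 0" "t > 0"
  shows "card (multiples S t n) =
    card ({(a :: int, b :: int). H a b \<le> (t / n) ^ 12 \<and> S (int n ^ u * a, int n ^ v * b)} - {(0, 0)})"
proof -
  have le: "H (int n ^ u * a) (int n ^ v * b) \<le> t ^ 12 \<longleftrightarrow> H a b \<le> (t / n) ^ 12" for a b :: int
    using scaled_le_iff[of "real n" "int n ^ u * a" "int n ^ v * b" "t / n"] assms by simp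
  have "multiples S t n = (\<lambda>(a, b). (int n ^ u * a, int n ^ v * b)) `
      ({(a :: int, b :: int). H a b \<le> (t / n) ^ 12 \<and> S (int n ^ u * a, int n ^ v * b)} - {(0, 0)})"
    (is "_ = ?f ` ?B")
  proof (intro Set.set_eqI iffI)
    fix z assume z: "z \<in> multiples S t n"
    then obtain a b where "z = (int n ^ u * a, int n ^ v * b)"
      unfolding multiples_def by (auto elim!: dvdE)
    moreover from this have "(a, b) \<in> ?B"
      using z le[of a b] by (auto simp: multiples_def)
    ultimately show "z \<in> ?f ` ?B"
      by force
  next
    fix z assume "z \<in> ?f ` ?B"
    then obtain a b where z: "z = (int n ^ u * a, int n ^ v * b)" and "(a, b) \<in> ?B"
      by auto
    thus "z \<in> multiples S t n"
      using le[of a b] assms(1) by (auto simp: multiples_def)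
  qed
  moreover have "inj_on ?f ?B"
    using assms(1) by (auto simp: inj_on_def)
  ultimately show ?thesis
    by (simp add: card_image)
qed

text \<open>\<open>m\<close> may be less than 1, so x^k \<le> x^w can fail; it holds for x / m,
  which is at least 1.\<close>

lemma power_le_scaled_power:
  fixes x m :: real
  assumes "0 < m" "m \<le> x" "k \<le> w"
  shows "x ^ k \<le> (m ^ k / m ^ w) * x ^ w"
proof -
  have "(x / m) ^ k \<le> (x / m) ^ w"
    using assms by (intro power_increasing) auto
  thus ?thesis
    using assms by (simp add: power_divide field_simps)
qed

text \<open>The density \<open>s n\<close> is fixed before t, since the sieve sums it into a
  coefficient valid for all t. The main term is kept even for n > t / m, where the set is empty, so
  that the sum over n can run to infinity; in that range it is itself an error term.\<close>

lemma multiples_count: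
  assumes m: "m > 0" "\<And>(a::int) (b::int). (a, b) \<noteq> (0::int, 0::int) \<Longrightarrow> m ^ 12 \<le> H a b"
  obtains C where "C \<ge> 0"
    "\<And>p S. p > 0 \<Longrightarrow> \<exists>s. \<forall>n>0. 0 \<le> s n \<and> s n \<le> area \<and> (\<forall>t>0.
       \<bar>real (card (multiples (\<lambda>(a, b). S (a mod int p, b mod int p)) t n)) - s n * (t / real n) ^ (u + v)\<bar>
         \<le> C * (real p * (t / real n) ^ max u v + (if real n \<le> t / m then (real p)\<^sup>2 else 0)))"
proof -
  obtain C where C: "C \<ge> 0"
    "\<And>t p S. t > 0 \<Longrightarrow> p > 0 \<Longrightarrow> S \<subseteq> {0..<int p} \<times> {0..<int p} \<Longrightarrow>
       \<bar>real (card {(a :: int, b :: int). H a b \<le> t ^ 12 \<and> (a mod int p, b mod int p) \<in> S})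
          - real (card S) * area / (real p)\<^sup>2 * t ^ (u + v)\<bar> \<le> C * (real p * t ^ u + real p * t ^ v + (real p)\<^sup>2)"
    using residue_set_count by blast
  define w where "w = max u v"
  define c where "c = m ^ u / m ^ w + m ^ v / m ^ w"
  \<comment> \<open>The summands cover, in turn, the boundary terms with both powers raised to the
    exponent \<open>w\<close>, the p^2 term together with the removed origin, and the main term in
    the range n > t / m.\<close>
  define C' where "C' = C * c + (C + 1) + area * m ^ min u v"
  have c: "c \<ge> 0"
    using m(1) by (simp add: c_def)
  have mp: "m ^ min u v \<ge> 0"
    using m(1) by simp
  show ?thesis
  proof (rule that[of C'])
    show C'0: "C' \<ge> 0"
      using C(1) c mp area_nonneg by (simp add: C'_def)
    fix p :: nat and S :: "int \<times> int \<Rightarrow> bool" assume p: "p > 0"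
    \<comment> \<open>The condition pulled back along (x, y) -> (n^u x, n^v y), a map that is not
      injective on residues when p divides n.\<close>
    define S' where "S' = (\<lambda>n::nat. {(x, y) \<in> {0..<int p} \<times> {0..<int p}.
        S ((int n ^ u * x) mod int p, (int n ^ v * y) mod int p)})"
    define s where "s = (\<lambda>n. real (card (S' n)) * area / (real p)\<^sup>2)"
    let ?S = "\<lambda>(a, b). S (a mod int p, b mod int p)"
    show "\<exists>s. \<forall>n>0. 0 \<le> s n \<and> s n \<le> area \<and> (\<forall>t>0.
       \<bar>real (card (multiples ?S t n)) - s n * (t / real n) ^ (u + v)\<bar>
         \<le> C' * (real p * (t / real n) ^ max u v + (if real n \<le> t / m then (real p)\<^sup>2 else 0)))"
    proof (intro exI[of _ s] allI impI conjI)
      fix n :: nat assume n: "n > 0"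
      have S'sub: "S' n \<subseteq> {0..<int p} \<times> {0..<int p}"
        by (auto simp: S'_def)
      have "card (S' n) \<le> card ({0..<int p} \<times> {0..<int p})"
        by (rule card_mono[OF _ S'sub]) auto
      hence cardS: "real (card (S' n)) \<le> (real p)\<^sup>2"
        by (simp add: card_cartesian_product power2_eq_square flip: of_nat_mult)
      show s0: "0 \<le> s n"
        using area_nonneg by (simp add: s_def)
      have "real (card (S' n)) * area \<le> (real p)\<^sup>2 * area"
        using cardS area_nonneg by (rule mult_right_mono)
      thus s1: "s n \<le> area"
        using p by (simp add: s_def field_simps)
      fix t :: real assume t: "t > 0"
      define x where "x = t / real n"
      have x: "x > 0"
        using t n by (simp add: x_def)
      define A where "A = {(a :: int, b :: int). H a b \<le> x ^ 12 \<and> (a mod int p, b mod int p) \<in> S' n}"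
      have "A = {(a :: int, b :: int). H a b \<le> x ^ 12 \<and> ?S (int n ^ u * a, int n ^ v * b)}"
        using p by (auto simp: A_def S'_def mod_mult_right_eq)
      hence card: "card (multiples ?S t n) = card (A - {(0, 0)})"
        using card_multiples[OF n t, of ?S] by (simp add: x_def)
      have finA: "finite A"
        by (rule finite_subset[OF _ finite_int_points[of "x ^ 12"]]) (auto simp: A_def)
      show "\<bar>real (card (multiples ?S t n)) - s n * (t / real n) ^ (u + v)\<bar>
         \<le> C' * (real p * (t / real n) ^ max u v + (if real n \<le> t / m then (real p)\<^sup>2 else 0))"
      proof (cases "real n \<le> t / m")
        case True
        hence mx: "m \<le> x"
          using m(1) n by (simp add: x_def field_simps)
        \<comment> \<open>Removing the origin changes the count by at most 1, which is absorbed by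
          p^2.\<close>
        have "real (card A) - 1 \<le> real (card (A - {(0, 0)}))"
          using finA by (simp add: card_Diff_singleton_if) linarith
        moreover have "real (card (A - {(0, 0)})) \<le> real (card A)"
          using finA by (simp add: card_mono)
        moreover have "\<bar>real (card A) - s n * x ^ (u + v)\<bar> \<le> C * (real p * x ^ u + real p * x ^ v + (real p)\<^sup>2)"
          unfolding A_def s_def by (rule C(2)[OF x p S'sub])
        ultimately have "\<bar>real (card (A - {(0, 0)})) - s n * x ^ (u + v)\<bar>
            \<le> C * (real p * x ^ u + real p * x ^ v + (real p)\<^sup>2) + 1"
          by linarith
        also have "x ^ u \<le> (m ^ u / m ^ w) * x ^ w" "x ^ v \<le> (m ^ v / m ^ w) * x ^ w"
          using power_le_scaled_power[OF m(1) mx] by (auto simp: w_def)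
        hence "real p * x ^ u + real p * x ^ v \<le> real p * ((m ^ u / m ^ w) * x ^ w) + real p * ((m ^ v / m ^ w) * x ^ w)"
          by (intro add_mono mult_left_mono) auto
        hence "C * (real p * x ^ u + real p * x ^ v + (real p)\<^sup>2) \<le> C * (c * (real p * x ^ w) + (real p)\<^sup>2)"
          using C(1) by (intro mult_left_mono) (simp_all add: c_def algebra_simps)
        also have "(1::real) \<le> (real p)\<^sup>2"
          using p by simp
        also have "C * (c * (real p * x ^ w) + (real p)\<^sup>2) + (real p)\<^sup>2
            = C * c * (real p * x ^ w) + (C + 1) * (real p)\<^sup>2"
          by (simp add: algebra_simps)
        also have "\<dots> \<le> C' * (real p * x ^ w) + C' * (real p)\<^sup>2"
          using C(1) c mp area_nonneg x by (intro add_mono mult_right_mono) (auto simp: C'_def)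
        finally show ?thesis
          using True card by (simp add: x_def w_def distrib_left)
      next
        \<comment> \<open>No point is left, and the main term splits as x^(min u v) * x^(max u v),
          where x \<le> m bounds the first factor.\<close>
        case False
        hence xm: "x \<le> m"
          using m(1) n by (simp add: x_def field_simps)
        have "A - {(0, 0)} = {}"
        proof -
          have "(a, b) = (0, 0)" if "(a, b) \<in> A" for a b
          proof (rule ccontr)
            assume "(a, b) \<noteq> (0, 0)"
            hence "m ^ 12 \<le> x ^ 12"
              using m(2)[of a b] that by (simp add: A_def)
            hence "m \<le> x"
              using m(1) x by (simp add: power_mono_iff)
            hence "real n \<le> t / m"
              using m(1) n by (simp add: x_def field_simps)
            thus False
              using False by simp
          qed
          thus ?thesis
            by auto
        qed
        hence "card (multiples ?S t n) = 0"
          using card by (metis card.empty)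
        hence "\<bar>real (card (multiples ?S t n)) - s n * x ^ (u + v)\<bar> = s n * x ^ (u + v)"
          using s0 x by simp
        also have "\<dots> \<le> area * x ^ (u + v)"
          using s1 x by (intro mult_right_mono) auto
        also have "area * x ^ (u + v) = area * x ^ min u v * x ^ w"
        proof -
          have "u + v = min u v + w"
            by (simp add: w_def)
          thus ?thesis
            by (simp only: power_add mult.assoc)
        qed
        also have "\<dots> \<le> area * m ^ min u v * (real p * x ^ w)"
        proof (rule mult_mono)
          show "area * x ^ min u v \<le> area * m ^ min u v"
            using x xm area_nonneg by (intro mult_left_mono power_mono) auto
          show "x ^ w \<le> real p * x ^ w"
            using p x by simp
        qed (use x area_nonneg mp in auto)
        also have "\<dots> \<le> C' * (real p * x ^ w)"
          using C(1) c x by (intro mult_right_mono) (auto simp: C'_def)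
        finally show ?thesis
          using False by (simp add: x_def w_def)
      qed
    qed
  qed
qed

text \<open>Telescoping with 1 / (N + 1)^2 \<le> 1 / N - 1 / (N + 1); the induction needs the
  sharper bound 2 - 1 / N.\<close>

lemma sum_inverse_squares_le: "(\<Sum>n = 1..N. 1 / (real n)\<^sup>2) \<le> 2"
proof -
  have "(\<Sum>n = 1..N. 1 / (real n)\<^sup>2) \<le> 2 - 1 / real N" if "N > 0"
    using that
  proof (induction N rule: nat_induct_non_zero)
    case (Suc N)
    have "1 / (real (Suc N))\<^sup>2 \<le> 1 / (real N * real (Suc N))"
      using Suc.hyps by (intro divide_left_mono) (auto simp: power2_eq_square)
    also have "\<dots> = 1 / real N - 1 / real (Suc N)"
      using Suc.hyps by (simp add: field_simps)
    finally show ?case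
      using Suc.IH by simp
  qed auto
  thus ?thesis
    by (cases "N = 0") (auto intro: order_trans)
qed

text \<open>The error of the sieve up to N \<ge> t / m is bounded independently of N, so the limit N
  -> \<infinity> turns the partial sums into a coefficient independent of t. Exponent max u v \<ge>
  2 makes the errors p (t / n)^(max u v) summable over n, while the p^2 terms occur for at most t /
  m values of n.\<close>

theorem primitive_count:
  assumes uv: "max u v \<ge> 2"
  obtains C where "C \<ge> 0"
    "\<And>p S. p > 0 \<Longrightarrow> \<exists>\<kappa>. \<forall>t>0.
       \<bar>real (card {(a :: int, b :: int). H a b \<le> t ^ 12 \<and> primitive a b \<and> S (a mod int p, b mod int p)}) - \<kappa> * t ^ (u + v)\<bar>
         \<le> C * (real p * t ^ max u v + (real p)\<^sup>2 * t)"
proof -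
  obtain m where m: "m > 0" "\<And>(a::int) (b::int). (a, b) \<noteq> (0::int, 0::int) \<Longrightarrow> m ^ 12 \<le> H a b"
    using H_int_lower by blast
  obtain C where C: "C \<ge> 0"
    "\<And>p S. p > 0 \<Longrightarrow> \<exists>s. \<forall>n>0. 0 \<le> s n \<and> s n \<le> area \<and> (\<forall>t>0.
       \<bar>real (card (multiples (\<lambda>(a, b). S (a mod int p, b mod int p)) t n)) - s n * (t / real n) ^ (u + v)\<bar>
         \<le> C * (real p * (t / real n) ^ max u v + (if real n \<le> t / m then (real p)\<^sup>2 else 0)))"
    using multiples_count[OF m] by metis
  define w where "w = max u v"
  \<comment> \<open>2 bounds the sum of the inverse squares, and 1 / m comes from the number of n
    \<le> t / m.\<close>
  define C' where "C' = C * (2 + 1 / m)"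
  show ?thesis
  proof (rule that[of C'])
    show "C' \<ge> 0"
      using C(1) m(1) by (simp add: C'_def)
    fix p :: nat and S :: "int \<times> int \<Rightarrow> bool" assume p: "p > 0"
    let ?S = "\<lambda>(a, b). S (a mod int p, b mod int p)"
    obtain s where s: "\<And>n. n > 0 \<Longrightarrow> 0 \<le> s n \<and> s n \<le> area"
      "\<And>n t. n > 0 \<Longrightarrow> t > 0 \<Longrightarrow>
       \<bar>real (card (multiples ?S t n)) - s n * (t / real n) ^ (u + v)\<bar>
         \<le> C * (real p * (t / real n) ^ w + (if real n \<le> t / m then (real p)\<^sup>2 else 0))"
      using C(2)[OF p, of S] unfolding w_def by blast
    \<comment> \<open>The n-th sieve term divided by t^(u + v). It is at most area / n^2 in absolute
      value because u + v \<ge> 2.\<close>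
    define \<kappa> where "\<kappa> = (\<lambda>n. moebius_mu n * s n / real n ^ (u + v))"
    have pw: "real n ^ 2 \<le> real n ^ k" if "k \<ge> 2" "n > 0" for n k :: nat
      using that by (intro power_increasing) auto
    have "summable (\<lambda>n. area * (1 / real n ^ 2))"
      using inverse_power_summable[of 2] by (intro summable_mult) (simp add: inverse_eq_divide)
    hence "summable (\<lambda>n. area * (1 / real (Suc n) ^ 2))"
      by (subst (asm) summable_Suc_iff[symmetric])
    hence summ: "summable (\<lambda>n. \<kappa> (Suc n))"
    proof (rule summable_comparison_test'[where N = 0])
      fix n :: nat
      have "norm (\<kappa> (Suc n)) = \<bar>moebius_mu (Suc n)\<bar> * s (Suc n) / real (Suc n) ^ (u + v)"
        using s(1)[of "Suc n"] by (simp add: \<kappa>_def abs_mult)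
      also have "\<dots> \<le> 1 * area / real (Suc n) ^ 2"
        using s(1)[of "Suc n"] area_nonneg uv u_pos v_pos
        by (intro frac_le mult_mono abs_moebius_mu_le pw) auto
      finally show "norm (\<kappa> (Suc n)) \<le> area * (1 / real (Suc n) ^ 2)"
        by simp
    qed
    show "\<exists>\<kappa>. \<forall>t>0. \<bar>real (card {(a :: int, b :: int). H a b \<le> t ^ 12 \<and> primitive a b \<and> S (a mod int p, b mod int p)}) - \<kappa> * t ^ (u + v)\<bar>
         \<le> C' * (real p * t ^ max u v + (real p)\<^sup>2 * t)"
    proof (intro exI[of _ "\<Sum>n. \<kappa> (Suc n)"] allI impI)
      fix t :: real assume t: "t > 0"
      define R where "R = real (card {(a, b). H (real_of_int a) (real_of_int b) \<le> t ^ 12 \<and> primitive a b \<and> ?S (a, b)})"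
      define E where "E = C' * (real p * t ^ w + (real p)\<^sup>2 * t)"
      have partial: "\<bar>R - (\<Sum>n = 1..N. \<kappa> n) * t ^ (u + v)\<bar> \<le> E" if N: "t / m \<le> real N" for N
      proof -
        have "R = (\<Sum>n = 1..N. moebius_mu n * real (card (multiples ?S t n)))"
          unfolding R_def using card_primitive_moebius[OF m t N] .
        hence "R - (\<Sum>n = 1..N. \<kappa> n) * t ^ (u + v)
            = (\<Sum>n = 1..N. moebius_mu n * (real (card (multiples ?S t n)) - s n * (t / real n) ^ (u + v)))"
          by (simp add: \<kappa>_def sum_distrib_right sum_subtractf right_diff_distrib power_divide mult.assoc)
        also have "\<bar>\<dots>\<bar> \<le> (\<Sum>n = 1..N. C * (real p * (t ^ w * (1 / (real n)\<^sup>2)) + (if real n \<le> t / m then (real p)\<^sup>2 else 0)))"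
        proof (rule order_trans[OF sum_abs sum_mono])
          fix n assume "n \<in> {1..N}"
          hence n: "n > 0"
            by simp
          have "\<bar>moebius_mu n * (real (card (multiples ?S t n)) - s n * (t / real n) ^ (u + v))\<bar>
            \<le> 1 * \<bar>real (card (multiples ?S t n)) - s n * (t / real n) ^ (u + v)\<bar>"
            unfolding abs_mult by (intro mult_right_mono abs_moebius_mu_le) auto
          also have "\<dots> \<le> C * (real p * (t / real n) ^ w + (if real n \<le> t / m then (real p)\<^sup>2 else 0))"
            using s(2)[OF n t] by simp
          also have "(t / real n) ^ w \<le> t ^ w * (1 / (real n)\<^sup>2)"
            unfolding power_divide using pw[of w n] uv n t
            by (simp add: w_def divide_left_mono)
          finally show "\<bar>moebius_mu n * (real (card (multiples ?S t n)) - s n * (t / real n) ^ (u + v))\<bar>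
              \<le> C * (real p * (t ^ w * (1 / (real n)\<^sup>2)) + (if real n \<le> t / m then (real p)\<^sup>2 else 0))"
            using C(1) by (simp add: mult_left_mono)
        qed
        also have "\<dots> = C * (real p * t ^ w * (\<Sum>n = 1..N. 1 / (real n)\<^sup>2)
            + (real p)\<^sup>2 * real (card {n \<in> {1..N}. real n \<le> t / m}))"
        proof -
          have "(\<Sum>n = 1..N. real p * (t ^ w * (1 / (real n)\<^sup>2))) = real p * t ^ w * (\<Sum>n = 1..N. 1 / (real n)\<^sup>2)"
            by (simp only: sum_distrib_left mult.assoc)
          moreover have "(\<Sum>n = 1..N. if real n \<le> t / m then (real p)\<^sup>2 else 0)
              = (real p)\<^sup>2 * real (card {n \<in> {1..N}. real n \<le> t / m})"
            by (simp add: sum.inter_filter[symmetric])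
          ultimately show ?thesis
            by (simp only: sum_distrib_left[symmetric] sum.distrib)
        qed
        also have "\<dots> \<le> C * (real p * t ^ w * 2 + (real p)\<^sup>2 * (t / m))"
        proof -
          have "{n \<in> {1..N}. real n \<le> t / m} \<subseteq> {1..nat \<lfloor>t / m\<rfloor>}"
            by (auto simp: le_nat_iff le_floor_iff)
          hence "card {n \<in> {1..N}. real n \<le> t / m} \<le> nat \<lfloor>t / m\<rfloor>"
            using card_mono[of "{1..nat \<lfloor>t / m\<rfloor>}"] by fastforce
          moreover have "0 \<le> t / m"
            using t m(1) by simp
          ultimately have "real (card {n \<in> {1..N}. real n \<le> t / m}) \<le> t / m"
            by linarith
          thus ?thesis
            using C(1) t sum_inverse_squares_le[of N] by (intro mult_left_mono add_mono) auto
        qed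
        also have "\<dots> \<le> C * ((2 + 1 / m) * (real p * t ^ w) + (2 + 1 / m) * ((real p)\<^sup>2 * t))"
          using C(1) t m(1) by (intro mult_left_mono add_mono) (simp_all add: field_simps)
        also have "\<dots> = E"
          by (simp add: E_def C'_def algebra_simps)
        finally show ?thesis .
      qed
      have lim: "(\<lambda>N. \<bar>R - (\<Sum>n = 1..N. \<kappa> n) * t ^ (u + v)\<bar>) \<longlonglongrightarrow> \<bar>R - (\<Sum>n. \<kappa> (Suc n)) * t ^ (u + v)\<bar>"
      proof (intro tendsto_intros)
        have "(\<lambda>N. \<Sum>n<N. \<kappa> (Suc n)) \<longlonglongrightarrow> (\<Sum>n. \<kappa> (Suc n))"
          using summ by (rule summable_LIMSEQ)
        moreover have "(\<Sum>n<N. \<kappa> (Suc n)) = (\<Sum>n = 1..N. \<kappa> n)" for N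
          by (rule sum.reindex_bij_witness[of _ "\<lambda>n. n - 1" Suc]) auto
        ultimately show "(\<lambda>N. \<Sum>n = 1..N. \<kappa> n) \<longlonglongrightarrow> (\<Sum>n. \<kappa> (Suc n))"
          by simp
      qed
      have "eventually (\<lambda>N. t / m \<le> real N) sequentially"
        using filterlim_real_sequentially by (simp add: filterlim_at_top)
      hence "eventually (\<lambda>N. \<bar>R - (\<Sum>n = 1..N. \<kappa> n) * t ^ (u + v)\<bar> \<le> E) sequentially"
        by (rule eventually_mono) (rule partial)
      hence "\<bar>R - (\<Sum>n. \<kappa> (Suc n)) * t ^ (u + v)\<bar> \<le> E"
        by (rule tendsto_upperbound[OF lim]) simp
      thus "\<bar>real (card {(a :: int, b :: int). H a b \<le> t ^ 12 \<and> primitive a b \<and> S (a mod int p, b mod int p)})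
          - (\<Sum>n. \<kappa> (Suc n)) * t ^ (u + v)\<bar> \<le> C' * (real p * t ^ max u v + (real p)\<^sup>2 * t)"
        by (simp add: R_def E_def w_def)
    qed
  qed
qed

end

section \<open>Parametrisation of curves with prescribed torsion\<close>

text \<open>
  For \<open>Z3\<close>, \<open>y = 3 a x + b\<close> is the tangent at a flex; for \<open>Z4\<close>, \<open>b\<close> is the slope of the
  tangent at a point of order 4 with abscissa \<open>a\<close>. For \<open>Z2xZ2\<close> the parameters are two of the
  three roots, instead of a root and the difference of the other two; this avoids the
  congruence \<open>a = b (mod 2)\<close> needed for \<open>f_of\<close> and \<open>g_of\<close> to be integral.
\<close>

fun param_f :: "torsion_group \<Rightarrow> 'a::comm_ring_1 \<Rightarrow> 'a \<Rightarrow> 'a" where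
  "param_f Z2 a b = a"
| "param_f Z3 a b = 6 * a * b + 27 * a ^ 4"
| "param_f Z4 a b = - 3 * a ^ 2 + 6 * a * b ^ 2 - 2 * b ^ 4"
| "param_f Z2xZ2 a b = - (a ^ 2 + a * b + b ^ 2)"

fun param_g :: "torsion_group \<Rightarrow> 'a::comm_ring_1 \<Rightarrow> 'a \<Rightarrow> 'a" where
  "param_g Z2 a b = b ^ 3 + a * b"
| "param_g Z3 a b = b ^ 2 - 27 * a ^ 6"
| "param_g Z4 a b = (2 * a - b ^ 2) * (a ^ 2 + 2 * a * b ^ 2 - b ^ 4)"
| "param_g Z2xZ2 a b = a * b * (a + b)"

lemma of_int_param: "of_int (param_f G a b) = param_f G (of_int a) (of_int b)"
  "of_int (param_g G a b) = param_g G (of_int a) (of_int b)"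
  by (cases G; simp)+

section \<open>Finite groups inside the chord-tangent law\<close>

lemma ec_add_Infinity_right [simp]: "ec_add A P Infinity = P"
  by (cases P) auto

lemma ec_group_simps [simp]:
  "carrier (ec_group A B) = ec_points A B" "mult (ec_group A B) = ec_add A" "one (ec_group A B) = Infinity"
  by (simp_all add: ec_group_def)

lemma Infinity_in_ec_points [simp]: "Infinity \<in> ec_points A B"
  by (simp add: ec_points_def)

lemma Affine_in_ec_points [simp]:
  "Affine x y \<in> ec_points A B \<longleftrightarrow> y ^ 2 = x ^ 3 + of_int A * x + of_int B"
  by (auto simp: ec_points_def)

text \<open>Both points must be the reflection of \<open>P\<close>. This evaluates the definite
  description behind \<open>m_inv\<close>.\<close>

lemma ec_add_eq_Infinity_unique:
  assumes "ec_add A P Q = Infinity" "ec_add A P R = Infinity"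
  shows "Q = R"
  using assms
  by (cases P; cases Q; cases R) (auto simp: Let_def split: if_splits)

lemma ec_add_eq_Infinity_sym: "ec_add A P Q = Infinity \<Longrightarrow> ec_add A Q P = Infinity"
  by (cases P; cases Q) (auto simp: Let_def split: if_splits)

text \<open>A subgroup isomorphic to K is the image of an injection carrying the law of K to
  \<open>ec_add\<close>; closure and inverses of the image are transported from K. Containment of a
  torsion group thus becomes a finite table of sums of points.\<close>

lemma has_subgroup_iso_ec_group_iff:
  assumes "group K"
  shows "has_subgroup_iso (ec_group A B) K \<longleftrightarrow>
    (\<exists>\<psi>. inj_on \<psi> (carrier K) \<and> \<psi> ` carrier K \<subseteq> ec_points A B \<and> \<psi> \<one>\<^bsub>K\<^esub> = Infinity \<and>
      (\<forall>x\<in>carrier K. \<forall>y\<in>carrier K. \<psi> (x \<otimes>\<^bsub>K\<^esub> y) = ec_add A (\<psi> x) (\<psi> y)))"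
    (is "?lhs \<longleftrightarrow> ?rhs")
proof
  assume ?lhs
  then obtain H \<phi> where H: "subgroup H (ec_group A B)" and \<phi>: "\<phi> \<in> iso (ec_group A B\<lparr>carrier := H\<rparr>) K"
    unfolding has_subgroup_iso_def is_iso_def by auto
  interpret K: group K by (rule assms)
  have bij: "bij_betw \<phi> H (carrier K)"
    and hom: "\<And>P Q. P \<in> H \<Longrightarrow> Q \<in> H \<Longrightarrow> \<phi> (ec_add A P Q) = \<phi> P \<otimes>\<^bsub>K\<^esub> \<phi> Q"
    using \<phi> by (auto simp: iso_def hom_def)
  have Hsub: "H \<subseteq> ec_points A B" and one: "Infinity \<in> H"
    and closed: "\<And>P Q. P \<in> H \<Longrightarrow> Q \<in> H \<Longrightarrow> ec_add A P Q \<in> H"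
    using subgroup.subset[OF H] subgroup.one_closed[OF H] subgroup.m_closed[OF H] by auto
  define \<psi> where "\<psi> = inv_into H \<phi>"
  have \<psi>: "\<psi> x \<in> H" "\<phi> (\<psi> x) = x" if "x \<in> carrier K" for x
    using that bij by (auto simp: \<psi>_def bij_betw_def inv_into_into f_inv_into_f)
  have \<psi>\<phi>: "\<psi> (\<phi> P) = P" if "P \<in> H" for P
    using that bij by (simp add: \<psi>_def bij_betw_def)
  \<comment> \<open>An idempotent element of a group is its unit.\<close>
  have "\<phi> Infinity \<otimes>\<^bsub>K\<^esub> \<phi> Infinity = \<phi> Infinity"
    using hom[OF one one] by simp
  moreover have "\<phi> Infinity \<in> carrier K"
    using bij one by (auto simp: bij_betw_def)
  ultimately have \<phi>_one: "\<phi> Infinity = \<one>\<^bsub>K\<^esub>"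
    by (simp add: K.l_cancel_one)
  show ?rhs
  proof (intro exI[of _ \<psi>] conjI ballI)
    show "inj_on \<psi> (carrier K)"
      using \<psi>(2) by (metis inj_onI)
    show "\<psi> ` carrier K \<subseteq> ec_points A B"
      using \<psi>(1) Hsub by auto
    show "\<psi> \<one>\<^bsub>K\<^esub> = Infinity"
      using \<psi>\<phi>[OF one] \<phi>_one by simp
    fix x y assume "x \<in> carrier K" "y \<in> carrier K"
    thus "\<psi> (x \<otimes>\<^bsub>K\<^esub> y) = ec_add A (\<psi> x) (\<psi> y)"
      using hom[of "\<psi> x" "\<psi> y"] \<psi> closed \<psi>\<phi> by metis
  qed
next
  assume ?rhs
  then obtain \<psi> where inj: "inj_on \<psi> (carrier K)" and sub: "\<psi> ` carrier K \<subseteq> ec_points A B"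
    and one: "\<psi> \<one>\<^bsub>K\<^esub> = Infinity"
    and hom: "\<And>x y. x \<in> carrier K \<Longrightarrow> y \<in> carrier K \<Longrightarrow> \<psi> (x \<otimes>\<^bsub>K\<^esub> y) = ec_add A (\<psi> x) (\<psi> y)"
    by blast
  interpret K: group K by (rule assms)
  define H where "H = \<psi> ` carrier K"
  have "subgroup H (ec_group A B)"
  proof
    show "H \<subseteq> carrier (ec_group A B)"
      using sub by (simp add: H_def)
    show "\<one>\<^bsub>ec_group A B\<^esub> \<in> H"
      using one K.one_closed unfolding H_def by (metis ec_group_simps(3) imageI)
    show "P \<otimes>\<^bsub>ec_group A B\<^esub> Q \<in> H" if PQ: "P \<in> H" "Q \<in> H" for P Q
    proof -
      obtain x y where xy: "x \<in> carrier K" "y \<in> carrier K" "P = \<psi> x" "Q = \<psi> y"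
        using PQ by (auto simp: H_def)
      hence "ec_add A P Q = \<psi> (x \<otimes>\<^bsub>K\<^esub> y)"
        using hom by simp
      thus ?thesis
        using K.m_closed[OF xy(1,2)] by (simp add: H_def)
    qed
    fix P assume "P \<in> H"
    then obtain x where x: "x \<in> carrier K" "P = \<psi> x"
      by (auto simp: H_def)
    define Q where "Q = \<psi> (inv\<^bsub>K\<^esub> x)"
    have PQ: "ec_add A P Q = Infinity"
      using hom[OF x(1) K.inv_closed[OF x(1)]] x one by (simp add: Q_def)
    have Q: "Q \<in> H"
      using x(1) by (simp add: Q_def H_def)
    have "inv\<^bsub>ec_group A B\<^esub> P = Q"
      unfolding m_inv_def
    proof (rule the_equality)
      show "Q \<in> carrier (ec_group A B) \<and> P \<otimes>\<^bsub>ec_group A B\<^esub> Q = \<one>\<^bsub>ec_group A B\<^esub> \<and> Q \<otimes>\<^bsub>ec_group A B\<^esub> P = \<one>\<^bsub>ec_group A B\<^esub>"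
        using Q sub PQ ec_add_eq_Infinity_sym[OF PQ] by (auto simp: H_def)
    qed (use PQ ec_add_eq_Infinity_unique in auto)
    thus "inv\<^bsub>ec_group A B\<^esub> P \<in> H"
      using Q by simp
  qed
  moreover have "inv_into (carrier K) \<psi> \<in> iso (ec_group A B\<lparr>carrier := H\<rparr>) K"
  proof (rule isoI)
    show "bij_betw (inv_into (carrier K) \<psi>) (carrier (ec_group A B\<lparr>carrier := H\<rparr>)) (carrier K)"
      using inj by (simp add: H_def bij_betw_inv_into inj_on_imp_bij_betw)
    show "inv_into (carrier K) \<psi> \<in> hom (ec_group A B\<lparr>carrier := H\<rparr>) K"
    proof (rule homI)
      fix P assume "P \<in> carrier (ec_group A B\<lparr>carrier := H\<rparr>)"
      thus "inv_into (carrier K) \<psi> P \<in> carrier K"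
        by (simp add: H_def inv_into_into)
    next
      fix P Q assume "P \<in> carrier (ec_group A B\<lparr>carrier := H\<rparr>)" "Q \<in> carrier (ec_group A B\<lparr>carrier := H\<rparr>)"
      then obtain x y where xy: "x \<in> carrier K" "y \<in> carrier K" "P = \<psi> x" "Q = \<psi> y"
        by (auto simp: H_def)
      have "inv_into (carrier K) \<psi> (\<psi> (x \<otimes>\<^bsub>K\<^esub> y)) = x \<otimes>\<^bsub>K\<^esub> y"
        using inj xy by (intro inv_into_f_f) auto
      thus "inv_into (carrier K) \<psi> (P \<otimes>\<^bsub>ec_group A B\<lparr>carrier := H\<rparr>\<^esub> Q) =
          inv_into (carrier K) \<psi> P \<otimes>\<^bsub>K\<^esub> inv_into (carrier K) \<psi> Q"
        using inj xy hom by simp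
    qed
  qed
  ultimately show ?lhs
    unfolding has_subgroup_iso_def is_iso_def by auto
qed

section \<open>Rational parameters for each torsion group\<close>

lemma ec_add_double:
  assumes "y \<noteq> 0" "3 * x ^ 2 + of_int A = m * (2 * y)"
  shows "ec_add A (Affine x y) (Affine x y) = Affine (m ^ 2 - 2 * x) (m * (x - (m ^ 2 - 2 * x)) - y)"
  using assms by (simp add: Let_def algebra_simps)

text \<open>A point of order 2 is its own reflection, so y = 0 and x is a root of the cubic;
  \<open>b\<close> is minus that root.\<close>

lemma Z2_param_iff:
  "contains_torsion Z2 A B \<longleftrightarrow> (\<exists>a b::rat. of_int A = param_f Z2 a b \<and> of_int B = param_g Z2 a b)"
proof -
  have car: "carrier (integer_mod_group 2) = {0, 1}"
    by (auto simp: carrier_integer_mod_group)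
  have "contains_torsion Z2 A B \<longleftrightarrow> (\<exists>x::rat. x ^ 3 + of_int A * x + of_int B = 0)"
  proof
    assume "contains_torsion Z2 A B"
    then obtain \<psi> where \<psi>': "inj_on \<psi> (carrier (integer_mod_group 2))"
      "\<psi> ` carrier (integer_mod_group 2) \<subseteq> ec_points A B" "\<psi> \<one>\<^bsub>integer_mod_group 2\<^esub> = Infinity"
      "\<And>x y. x \<in> carrier (integer_mod_group 2) \<Longrightarrow> y \<in> carrier (integer_mod_group 2) \<Longrightarrow>
        \<psi> (x \<otimes>\<^bsub>integer_mod_group 2\<^esub> y) = ec_add A (\<psi> x) (\<psi> y)"
      unfolding contains_torsion.simps has_subgroup_iso_ec_group_iff[OF group_integer_mod_group] by blast
    have \<psi>: "inj_on \<psi> {0::int, 1}" "\<psi> ` {0, 1} \<subseteq> ec_points A B" "\<psi> 0 = Infinity"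
      "ec_add A (\<psi> 1) (\<psi> 1) = \<psi> 0"
      using \<psi>'(1-3) \<psi>'(4)[of 1 1] by (simp_all add: car)
    obtain x y where P: "\<psi> 1 = Affine x y"
      using \<psi>(1,3) by (cases "\<psi> 1") (auto simp: inj_on_def)
    hence "y = 0"
      using \<psi>(3,4) by (auto simp: Let_def split: if_splits)
    thus "\<exists>x::rat. x ^ 3 + of_int A * x + of_int B = 0"
      using \<psi>(2) P by (auto intro!: exI[of _ x])
  next
    assume "\<exists>x::rat. x ^ 3 + of_int A * x + of_int B = 0"
    then obtain x :: rat where x: "x ^ 3 + of_int A * x + of_int B = 0"
      by blast
    show "contains_torsion Z2 A B"
      using x by (auto simp: has_subgroup_iso_ec_group_iff[OF group_integer_mod_group] car inj_on_def
          intro!: exI[of _ "\<lambda>i. if i = 0 then Infinity else Affine x 0"])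
  qed
  also have "\<dots> \<longleftrightarrow> (\<exists>b::rat. of_int B = b ^ 3 + of_int A * b)"
  proof
    assume "\<exists>x::rat. x ^ 3 + of_int A * x + of_int B = 0"
    then obtain x :: rat where x: "x ^ 3 + of_int A * x + of_int B = 0"
      by blast
    thus "\<exists>b::rat. of_int B = b ^ 3 + of_int A * b"
      by (intro exI[of _ "- x"]) (simp add: algebra_simps eq_neg_iff_add_eq_0)
  next
    assume "\<exists>b::rat. of_int B = b ^ 3 + of_int A * b"
    then obtain b :: rat where "of_int B = b ^ 3 + of_int A * b"
      by blast
    thus "\<exists>x::rat. x ^ 3 + of_int A * x + of_int B = 0"
      by (intro exI[of _ "- b"]) simp
  qed
  finally show ?thesis
    by auto
qed

text \<open>These factorisations of 4 f^3 + 27 g^2 show where the curve is singular. They yield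
  nonzero ordinates for the torsion points of order 3 and 4, help to exclude common zeros of f and
  g, and describe the singular parameters to be discarded.\<close>

lemma disc_Z3: "4 * param_f Z3 a b ^ 3 + 27 * param_g Z3 a b ^ 2 = 27 * (b + 9 * a ^ 3) ^ 3 * (b + 5 * a ^ 3)"
  for a b :: "'a::comm_ring_1"
  by (simp add: eval_nat_numeral algebra_simps)

lemma disc_Z4: "4 * param_f Z4 a b ^ 3 + 27 * param_g Z4 a b ^ 2 = - (b ^ 2 * (5 * b ^ 2 - 12 * a) * (b ^ 2 - 3 * a) ^ 4)"
  for a b :: "'a::comm_ring_1"
  by (simp add: eval_nat_numeral algebra_simps)

lemma disc_Z2: "4 * param_f Z2 a b ^ 3 + 27 * param_g Z2 a b ^ 2 = (3 * b ^ 2 + 4 * a) * (3 * b ^ 2 + a) ^ 2"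
  for a b :: "'a::comm_ring_1"
  by (simp add: eval_nat_numeral algebra_simps)

lemma disc_Z2xZ2: "4 * param_f Z2xZ2 a b ^ 3 + 27 * param_g Z2xZ2 a b ^ 2 = - (((a - b) * (2 * a + b) * (a + 2 * b)) ^ 2)"
  for a b :: "'a::comm_ring_1"
  by (simp add: eval_nat_numeral algebra_simps)

lemma of_int_disc_nonzero:
  assumes "4 * A ^ 3 + 27 * B ^ 2 \<noteq> (0::int)"
  shows "4 * of_int A ^ 3 + 27 * of_int B ^ 2 \<noteq> (0::'a::ring_char_0)"
proof -
  have "4 * of_int A ^ 3 + 27 * of_int B ^ 2 = (of_int (4 * A ^ 3 + 27 * B ^ 2) :: 'a)"
    by simp
  thus ?thesis
    using assms by (metis of_int_eq_0_iff)
qed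

text \<open>For P of order 3 the double 2P = -P has the same abscissa, so the tangent slope m
  satisfies m^2 = 3 x. With a = m / 3 this gives x = 3 a^2, and b = y - 9 a^3 is the intercept of
  the tangent.\<close>

lemma Z3_param_iff:
  assumes disc: "4 * A ^ 3 + 27 * B ^ 2 \<noteq> 0"
  shows "contains_torsion Z3 A B \<longleftrightarrow> (\<exists>a b::rat. of_int A = param_f Z3 a b \<and> of_int B = param_g Z3 a b)"
proof
  have car: "carrier (integer_mod_group 3) = {0, 1, 2}"
    by (auto simp: carrier_integer_mod_group)
  {
    assume "contains_torsion Z3 A B"
    then obtain \<psi> where \<psi>': "inj_on \<psi> (carrier (integer_mod_group 3))"
      "\<psi> ` carrier (integer_mod_group 3) \<subseteq> ec_points A B" "\<psi> \<one>\<^bsub>integer_mod_group 3\<^esub> = Infinity"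
      "\<And>x y. x \<in> carrier (integer_mod_group 3) \<Longrightarrow> y \<in> carrier (integer_mod_group 3) \<Longrightarrow>
        \<psi> (x \<otimes>\<^bsub>integer_mod_group 3\<^esub> y) = ec_add A (\<psi> x) (\<psi> y)"
      unfolding contains_torsion.simps has_subgroup_iso_ec_group_iff[OF group_integer_mod_group] by blast
    have \<psi>: "inj_on \<psi> {0::int, 1, 2}" "\<psi> ` {0, 1, 2} \<subseteq> ec_points A B" "\<psi> 0 = Infinity"
      "ec_add A (\<psi> 1) (\<psi> 1) = \<psi> 2" "ec_add A (\<psi> 1) (\<psi> 2) = \<psi> 0"
      using \<psi>'(1-3) \<psi>'(4)[of 1 1] \<psi>'(4)[of 1 2] by (simp_all add: car)
    obtain x y where P: "\<psi> 1 = Affine x y"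
      using \<psi>(1,3) by (cases "\<psi> 1") (auto simp: inj_on_def)
    obtain x' y' where Q: "\<psi> 2 = Affine x' y'"
      using \<psi>(1,3) by (cases "\<psi> 2") (auto simp: inj_on_def)
    have "y' = - y" "x' = x"
      using \<psi>(3,5) P Q by (auto simp: Let_def split: if_splits)
    hence Q: "\<psi> 2 = Affine x (- y)"
      using Q by simp
    have y: "y \<noteq> 0"
      using \<psi>(1) P Q by (auto simp: inj_on_def)
    define m where "m = (3 * x ^ 2 + of_int A) / (2 * y)"
    have m: "3 * x ^ 2 + of_int A = m * (2 * y)"
      using y by (simp add: m_def)
    have "m ^ 2 - 2 * x = x"
      using \<psi>(4) ec_add_double[OF y m] P Q by simp
    hence x: "x = m ^ 2 / 3"
      by simp
    have curve: "y ^ 2 = x ^ 3 + of_int A * x + of_int B"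
      using \<psi>(2) P by auto
    show "\<exists>a b::rat. of_int A = param_f Z3 a b \<and> of_int B = param_g Z3 a b"
    proof (intro exI conjI)
      define a where "a = m / 3"
      have mx: "m = 3 * a" "x = 3 * a ^ 2"
        by (simp_all add: a_def x power_divide)
      show A: "of_int A = param_f Z3 a (y - 9 * a ^ 3)"
        using m unfolding mx param_f.simps by algebra
      show "of_int B = param_g Z3 a (y - 9 * a ^ 3)"
        using curve A unfolding mx param_f.simps param_g.simps by algebra
    qed
  }
  {
    assume "\<exists>a b::rat. of_int A = param_f Z3 a b \<and> of_int B = param_g Z3 a b"
    then obtain a b :: rat where ab: "of_int A = param_f Z3 a b" "of_int B = param_g Z3 a b"
      by blast
    define x y where "x = 3 * a ^ 2" and "y = b + 9 * a ^ 3"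
    have y: "y \<noteq> 0"
      using of_int_disc_nonzero[OF disc, where 'a = rat] unfolding ab disc_Z3 y_def by auto
    have curve: "y ^ 2 = x ^ 3 + of_int A * x + of_int B"
      unfolding ab param_f.simps param_g.simps x_def y_def by algebra
    have m: "3 * x ^ 2 + of_int A = (3 * a) * (2 * y)"
      unfolding ab param_f.simps x_def y_def by algebra
    have "ec_add A (Affine x y) (Affine x y) = Affine x (- y)"
      unfolding ec_add_double[OF y m] by (simp add: x_def power2_eq_square)
    moreover have "ec_add A (Affine x (- y)) (Affine x (- y)) = Affine x y"
    proof -
      have "- y \<noteq> 0" "3 * x ^ 2 + of_int A = (- 3 * a) * (2 * - y)"
        using y m by simp_all
      from ec_add_double[OF this] show ?thesis
        by (simp add: x_def power2_eq_square)
    qed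
    ultimately show "contains_torsion Z3 A B"
      using y curve
      by (auto simp: has_subgroup_iso_ec_group_iff[OF group_integer_mod_group] car inj_on_def
          intro!: exI[of _ "\<lambda>i. if i = 0 then Infinity else if i = 1 then Affine x y else Affine x (- y)"])
  }
qed

text \<open>For P = (a, y) of order 4 the double is a point (c, 0). With tangent slope b the
  doubling formula gives c = b^2 - 2 a, and its vanishing ordinate gives y = b (3 a - b^2); slope
  and curve equations then determine A and B.\<close>

lemma Z4_param_iff:
  assumes disc: "4 * A ^ 3 + 27 * B ^ 2 \<noteq> 0"
  shows "contains_torsion Z4 A B \<longleftrightarrow> (\<exists>a b::rat. of_int A = param_f Z4 a b \<and> of_int B = param_g Z4 a b)"
proof
  have car: "carrier (integer_mod_group 4) = {0, 1, 2, 3}"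
    by (auto simp: carrier_integer_mod_group)
  {
    assume "contains_torsion Z4 A B"
    then obtain \<psi> where \<psi>': "inj_on \<psi> (carrier (integer_mod_group 4))"
      "\<psi> ` carrier (integer_mod_group 4) \<subseteq> ec_points A B" "\<psi> \<one>\<^bsub>integer_mod_group 4\<^esub> = Infinity"
      "\<And>x y. x \<in> carrier (integer_mod_group 4) \<Longrightarrow> y \<in> carrier (integer_mod_group 4) \<Longrightarrow>
        \<psi> (x \<otimes>\<^bsub>integer_mod_group 4\<^esub> y) = ec_add A (\<psi> x) (\<psi> y)"
      unfolding contains_torsion.simps has_subgroup_iso_ec_group_iff[OF group_integer_mod_group] by blast
    have \<psi>: "inj_on \<psi> {0::int, 1, 2, 3}" "\<psi> ` {0, 1, 2, 3} \<subseteq> ec_points A B" "\<psi> 0 = Infinity"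
      "ec_add A (\<psi> 1) (\<psi> 1) = \<psi> 2" "ec_add A (\<psi> 2) (\<psi> 2) = \<psi> 0"
      using \<psi>'(1-3) \<psi>'(4)[of 1 1] \<psi>'(4)[of 2 2] by (simp_all add: car)
    obtain x y where P: "\<psi> 1 = Affine x y"
      using \<psi>(1,3) by (cases "\<psi> 1") (auto simp: inj_on_def)
    obtain c c' where T: "\<psi> 2 = Affine c c'"
      using \<psi>(1,3) by (cases "\<psi> 2") (auto simp: inj_on_def)
    have "c' = 0"
      using \<psi>(3,5) T by (auto simp: Let_def split: if_splits)
    hence T: "\<psi> 2 = Affine c 0"
      using T by simp
    have y: "y \<noteq> 0"
      using \<psi>(4) P T by (auto simp: Let_def split: if_splits)
    define b where "b = (3 * x ^ 2 + of_int A) / (2 * y)"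
    have m: "3 * x ^ 2 + of_int A = b * (2 * y)"
      using y by (simp add: b_def)
    have c: "c = b ^ 2 - 2 * x" and y_eq: "y = b * (3 * x - b ^ 2)"
      using \<psi>(4) ec_add_double[OF y m] P T by (simp_all add: algebra_simps)
    have curve: "y ^ 2 = x ^ 3 + of_int A * x + of_int B"
      using \<psi>(2) P by auto
    show "\<exists>a b::rat. of_int A = param_f Z4 a b \<and> of_int B = param_g Z4 a b"
    proof (intro exI conjI)
      show A: "of_int A = param_f Z4 x b"
        using m unfolding y_eq param_f.simps by algebra
      show "of_int B = param_g Z4 x b"
        using curve A unfolding y_eq param_f.simps param_g.simps by algebra
    qed
  }
  {
    assume "\<exists>a b::rat. of_int A = param_f Z4 a b \<and> of_int B = param_g Z4 a b"
    then obtain a b :: rat where ab: "of_int A = param_f Z4 a b" "of_int B = param_g Z4 a b"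
      by blast
    define c y where "c = b ^ 2 - 2 * a" and "y = b * (3 * a - b ^ 2)"
    have y: "y \<noteq> 0"
      using of_int_disc_nonzero[OF disc, where 'a = rat] unfolding ab disc_Z4 y_def by auto
    have curve: "y ^ 2 = a ^ 3 + of_int A * a + of_int B" "0 = c ^ 3 + of_int A * c + of_int B"
      unfolding ab param_f.simps param_g.simps c_def y_def by algebra+
    have m: "3 * a ^ 2 + of_int A = b * (2 * y)"
      unfolding ab param_f.simps y_def by algebra
    have yac: "y = b * (a - c)"
      by (simp add: y_def c_def algebra_simps)
    hence ac: "a \<noteq> c"
      using y by auto
    have dbl: "ec_add A (Affine a y) (Affine a y) = Affine c 0"
      using ec_add_double[OF y m] unfolding c_def[symmetric] yac[symmetric] by simp
    have dbl': "ec_add A (Affine a (- y)) (Affine a (- y)) = Affine c 0"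
    proof -
      have "- y \<noteq> 0" "3 * a ^ 2 + of_int A = (- b) * (2 * - y)"
        using y m by simp_all
      from ec_add_double[OF this] show ?thesis
        unfolding power2_minus c_def[symmetric] by (simp add: yac)
    qed
    \<comment> \<open>(c, 0) is its own reflection, so the tangent at (a, y) passes through it: the
      chord has the tangent slope b, and -b for the reflected point.\<close>
    have slope: "(0 - y) / (c - a) = b" "(0 - - y) / (c - a) = - b" "(y - 0) / (a - c) = b" "(- y - 0) / (a - c) = - b"
      using ac by (simp_all add: yac field_simps)
    have sum: "ec_add A (Affine a y) (Affine c 0) = Affine a (- y)" "ec_add A (Affine c 0) (Affine a y) = Affine a (- y)"
      "ec_add A (Affine a (- y)) (Affine c 0) = Affine a y" "ec_add A (Affine c 0) (Affine a (- y)) = Affine a y"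
    proof -
      have c': "b ^ 2 = c + 2 * a"
        by (simp add: c_def)
      have y': "b * (c - a) = - y"
        by (simp add: yac algebra_simps)
      show "ec_add A (Affine a y) (Affine c 0) = Affine a (- y)" "ec_add A (Affine c 0) (Affine a y) = Affine a (- y)"
        "ec_add A (Affine a (- y)) (Affine c 0) = Affine a y" "ec_add A (Affine c 0) (Affine a (- y)) = Affine a y"
        using ac ac[symmetric] unfolding ec_add.simps slope power2_minus by (simp_all add: Let_def c' y')
    qed
    define \<psi> where "\<psi> = (\<lambda>i::int. if i = 0 then Infinity else if i = 1 then Affine a y
        else if i = 2 then Affine c 0 else Affine a (- y))"
    have \<psi>: "\<psi> 0 = Infinity" "\<psi> 1 = Affine a y" "\<psi> 2 = Affine c 0" "\<psi> 3 = Affine a (- y)"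
      by (simp_all add: \<psi>_def)
    have inv: "ec_add A (Affine a y) (Affine a (- y)) = Infinity" "ec_add A (Affine a (- y)) (Affine a y) = Infinity"
      "ec_add A (Affine c 0) (Affine c 0) = Infinity"
      by simp_all
    have "inj_on \<psi> {0, 1, 2, 3}" "\<psi> ` {0, 1, 2, 3} \<subseteq> ec_points A B"
      using y ac ac[symmetric] curve by (simp_all add: \<psi> inj_on_def)
    moreover have "\<forall>i\<in>{0, 1, 2, 3}. \<forall>j\<in>{0, 1, 2, 3}. \<psi> ((i + j) mod 4) = ec_add A (\<psi> i) (\<psi> j)"
      by (simp add: \<psi> inv dbl dbl' sum del: ec_add.simps(3))
    ultimately show "contains_torsion Z4 A B"
      unfolding contains_torsion.simps has_subgroup_iso_ec_group_iff[OF group_integer_mod_group] car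
      by (intro exI[of _ \<psi>]) (simp only: one_integer_mod_group mult_integer_mod_group of_nat_numeral \<psi>(1) simp_thms)
  }
qed

text \<open>Two distinct roots a, b of a cubic without quadratic term determine the third as - a -
  b, hence A and B by the elementary symmetric functions.\<close>

lemma Z2xZ2_param_iff:
  assumes disc: "4 * A ^ 3 + 27 * B ^ 2 \<noteq> 0"
  shows "contains_torsion Z2xZ2 A B \<longleftrightarrow> (\<exists>a b::rat. of_int A = param_f Z2xZ2 a b \<and> of_int B = param_g Z2xZ2 a b)"
proof
  let ?K = "integer_mod_group 2 \<times>\<times> integer_mod_group 2"
  have car: "carrier (integer_mod_group 2) = {0, 1}"
    by (auto simp: carrier_integer_mod_group)
  have grp: "group ?K"
    by (intro DirProd_group group_integer_mod_group)
  {
    assume "contains_torsion Z2xZ2 A B"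
    then obtain \<psi> where \<psi>: "inj_on \<psi> (carrier ?K)" "\<psi> ` carrier ?K \<subseteq> ec_points A B" "\<psi> \<one>\<^bsub>?K\<^esub> = Infinity"
      "\<And>x y. x \<in> carrier ?K \<Longrightarrow> y \<in> carrier ?K \<Longrightarrow> \<psi> (x \<otimes>\<^bsub>?K\<^esub> y) = ec_add A (\<psi> x) (\<psi> y)"
      unfolding contains_torsion.simps has_subgroup_iso_ec_group_iff[OF grp] by blast
    have \<psi>0: "\<psi> (0, 0) = Infinity" "ec_add A (\<psi> (0, 1)) (\<psi> (0, 1)) = \<psi> (0, 0)"
      "ec_add A (\<psi> (1, 0)) (\<psi> (1, 0)) = \<psi> (0, 0)"
      using \<psi>(3) \<psi>(4)[of "(0, 1)" "(0, 1)"] \<psi>(4)[of "(1, 0)" "(1, 0)"] by (simp_all add: car)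
    have root: "\<exists>r. \<psi> z = Affine r 0" if "z = (0, 1) \<or> z = (1, 0)" for z
    proof -
      have ne: "\<psi> z \<noteq> Infinity"
        using that inj_onD[OF \<psi>(1), of z "(0, 0)"] \<psi>0(1) by (auto simp: car)
      then obtain r s where rs: "\<psi> z = Affine r s"
        by (cases "\<psi> z") auto
      have "ec_add A (\<psi> z) (\<psi> z) = Infinity"
        using that \<psi>0 by auto
      thus ?thesis
        using rs by (auto simp: Let_def split: if_splits)
    qed
    obtain a where a: "\<psi> (0, 1) = Affine a 0"
      using root by blast
    obtain b where b: "\<psi> (1, 0) = Affine b 0"
      using root by blast
    have "a \<noteq> b"
      using inj_onD[OF \<psi>(1), of "(0, 1)" "(1, 0)"] a b by (auto simp: car)
    have "Affine a 0 \<in> ec_points A B" "Affine b 0 \<in> ec_points A B"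
      using \<psi>(2) a b by (auto simp: car)
    hence "0 = a ^ 3 + of_int A * a + of_int B" "0 = b ^ 3 + of_int A * b + of_int B"
      by simp_all
    hence root: "a ^ 3 + of_int A * a + of_int B = 0" "b ^ 3 + of_int A * b + of_int B = 0"
      by simp_all
    have "(a - b) * (a ^ 2 + a * b + b ^ 2 + of_int A) = 0"
      using root by algebra
    hence "a ^ 2 + a * b + b ^ 2 + of_int A = 0"
      using \<open>a \<noteq> b\<close> by simp
    hence A: "of_int A = param_f Z2xZ2 a b"
      by (simp only: param_f.simps eq_neg_iff_add_eq_0 add.commute)
    moreover have "of_int B = param_g Z2xZ2 a b"
      using root(1) A unfolding param_f.simps param_g.simps by algebra
    ultimately show "\<exists>a b::rat. of_int A = param_f Z2xZ2 a b \<and> of_int B = param_g Z2xZ2 a b"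
      by blast
  }
  {
    assume "\<exists>a b::rat. of_int A = param_f Z2xZ2 a b \<and> of_int B = param_g Z2xZ2 a b"
    then obtain a b :: rat where ab: "of_int A = param_f Z2xZ2 a b" "of_int B = param_g Z2xZ2 a b"
      by blast
    define c where "c = - a - b"
    have "(a - b) * (a - c) * (b - c) \<noteq> 0"
      using of_int_disc_nonzero[OF disc, where 'a = rat] unfolding ab disc_Z2xZ2 c_def
      by (auto simp: algebra_simps)
    hence ne: "a \<noteq> b" "a \<noteq> c" "b \<noteq> c"
      by auto
    have curve: "0 = a ^ 3 + of_int A * a + of_int B" "0 = b ^ 3 + of_int A * b + of_int B" "0 = c ^ 3 + of_int A * c + of_int B"
      unfolding ab param_f.simps param_g.simps c_def by algebra+
    have sum: "ec_add A (Affine r 0) (Affine s 0) = Affine (- r - s) 0" if "r \<noteq> s" for r s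
      using that by (simp add: Let_def)
    have sums: "- a - b = c" "- b - a = c" "- a - c = b" "- c - a = b" "- b - c = a" "- c - b = a"
      by (simp_all add: c_def)
    define \<psi> where "\<psi> = (\<lambda>z::int \<times> int. if z = (0, 0) then Infinity else if z = (0, 1) then Affine a 0
        else if z = (1, 0) then Affine b 0 else Affine c 0)"
    have "\<psi> (0, 0) = Infinity" "\<psi> (0, 1) = Affine a 0" "\<psi> (1, 0) = Affine b 0" "\<psi> (1, 1) = Affine c 0"
      by (simp_all add: \<psi>_def)
    moreover have "ec_add A (Affine r 0) (Affine r 0) = Infinity" for r
      by simp
    ultimately have "\<exists>\<psi>. inj_on \<psi> (carrier ?K) \<and> \<psi> ` carrier ?K \<subseteq> ec_points A B \<and> \<psi> \<one>\<^bsub>?K\<^esub> = Infinity \<and>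
      (\<forall>x\<in>carrier ?K. \<forall>y\<in>carrier ?K. \<psi> (x \<otimes>\<^bsub>?K\<^esub> y) = ec_add A (\<psi> x) (\<psi> y))"
      using ne ne[symmetric] curve
      by (intro exI[of _ \<psi>]) (simp add: car inj_on_def sum sums del: ec_add.simps(3))
    thus "contains_torsion Z2xZ2 A B"
      by (simp add: has_subgroup_iso_ec_group_iff[OF grp])
  }
qed

section \<open>Integrality of rational parameters\<close>

lemma rat_monic_cubic_root_Ints:
  fixes x :: rat
  assumes "x ^ 3 + of_int r * x ^ 2 + of_int q * x + of_int p = 0"
  shows "x \<in> \<int>"
proof (rule rational_algebraic_int_is_int)
  show "algebraic_int x"
  proof (rule algebraic_int.intros)
    show "lead_coeff [:of_int p, of_int q, of_int r, 1 :: rat:] = 1"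
      by simp
    show "\<forall>i. coeff [:of_int p, of_int q, of_int r, 1 :: rat:] i \<in> \<int>"
      by (simp add: coeff_pCons split: nat.split)
    show "poly [:of_int p, of_int q, of_int r, 1:] x = 0"
      using assms by (simp add: power2_eq_square power3_eq_cube algebra_simps)
  qed
qed (simp add: Rats_def of_rat_eq_id)

lemma rat_monic_octic_root_Ints:
  fixes x :: rat
  assumes "x ^ 8 + of_int r * x ^ 4 + of_int q * x ^ 2 + of_int p = 0"
  shows "x \<in> \<int>"
proof (rule rational_algebraic_int_is_int)
  show "algebraic_int x"
  proof (rule algebraic_int.intros)
    show "lead_coeff [:of_int p, 0, of_int q, 0, of_int r, 0, 0, 0, 1 :: rat:] = 1"
      by simp
    show "\<forall>i. coeff [:of_int p, 0, of_int q, 0, of_int r, 0, 0, 0, 1 :: rat:] i \<in> \<int>"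
      by (simp add: coeff_pCons split: nat.split)
    show "poly [:of_int p, 0, of_int q, 0, of_int r, 0, 0, 0, 1:] x = 0"
      using assms by (simp add: eval_nat_numeral algebra_simps)
  qed
qed (simp add: Rats_def of_rat_eq_id)

lemma rat_monic_quadratic_root_Ints:
  fixes x :: rat
  assumes "x ^ 2 + of_int r * x + of_int q = 0"
  shows "x \<in> \<int>"
proof -
  have "x ^ 3 + of_int r * x ^ 2 + of_int q * x + of_int 0 = x * (x ^ 2 + of_int r * x + of_int q)"
    by (simp add: power2_eq_square power3_eq_cube algebra_simps)
  thus ?thesis
    using rat_monic_cubic_root_Ints[of x r q 0] assms by simp
qed

lemma Ints_of_power2_Ints:
  fixes x :: rat
  assumes "x ^ 2 \<in> \<int>"
  shows "x \<in> \<int>"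
proof -
  obtain n where "x ^ 2 = of_int n"
    using assms Ints_cases by blast
  thus ?thesis
    using rat_monic_quadratic_root_Ints[of x 0 "- n"] by simp
qed

text \<open>The octic is 27 times the 3-division polynomial 3 x^4 + 6 A x^2 + 12 B x - A^2 at x =
  m^2 / 3, where m = 3 a is the slope at the flex. So 3 a is an integer, and reading the octic
  modulo 3 shows that it is divisible by 3.\<close>

lemma param_Z3_Ints:
  fixes a b :: rat
  assumes A: "of_int A = param_f Z3 a b" and B: "of_int B = param_g Z3 a b"
  shows "a \<in> \<int>"
proof -
  have oct: "(3 * a) ^ 8 + of_int (18 * A) * (3 * a) ^ 4 + of_int (108 * B) * (3 * a) ^ 2 + of_int (- 27 * A ^ 2) = 0"
    by (simp add: A B eval_nat_numeral algebra_simps)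
  then obtain k where k: "3 * a = of_int k"
    using rat_monic_octic_root_Ints Ints_cases by blast
  have "(of_int (k ^ 8 + 18 * A * k ^ 4 + 108 * B * k ^ 2 - 27 * A ^ 2) :: rat) = of_int 0"
    using oct unfolding k by simp
  hence "k ^ 8 = 3 * (9 * A ^ 2 - 6 * A * k ^ 4 - 36 * B * k ^ 2)"
    unfolding of_int_eq_iff by simp
  hence "3 dvd k ^ 8"
    by (metis dvd_triv_left)
  hence "3 dvd k"
    by (rule prime_dvd_power[rotated]) simp
  then obtain l where "k = 3 * l"
    by (elim dvdE)
  hence "a = of_int l"
    using k by simp
  thus ?thesis
    by simp
qed

text \<open>The parameters, or their squares, satisfy monic equations over the integers, possibly
  one after the other. Besides turning rational parameters into integers, this is the core of
  \<open>minimal_iff_primitive\<close>.\<close>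

lemma param_Ints:
  fixes a b :: rat
  assumes A: "of_int A = param_f G a b" and B: "of_int B = param_g G a b"
  shows "a \<in> \<int>" "b \<in> \<int>"
proof -
  have "a \<in> \<int> \<and> b \<in> \<int>"
  proof (cases G)
    case Z2
    have "a \<in> \<int>"
      using A Z2 by (metis Ints_of_int param_f.simps(1))
    moreover have "b ^ 3 + of_int 0 * b ^ 2 + of_int A * b + of_int (- B) = 0"
      using A B Z2 by simp
    hence "b \<in> \<int>"
      by (rule rat_monic_cubic_root_Ints)
    ultimately show ?thesis
      by simp
  next
    case Z3
    have a: "a \<in> \<int>"
      using param_Z3_Ints A B unfolding Z3 by blast
    have "b ^ 2 = of_int B + 27 * a ^ 6"
      using B Z3 by simp
    hence "b ^ 2 \<in> \<int>"
      using a by simp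
    thus ?thesis
      using a Ints_of_power2_Ints by blast
  next
    case Z4
    \<comment> \<open>The abscissa of the point of order 2: a root of the cubic, hence an integer.
      It then gives a monic quadratic for a, and b^2 = c + 2 a.\<close>
    define c where "c = b ^ 2 - 2 * a"
    have "c ^ 3 + of_int 0 * c ^ 2 + of_int A * c + of_int B = 0"
      unfolding A B Z4 param_f.simps param_g.simps c_def of_int_0 by algebra
    then obtain k where k: "c = of_int k"
      using rat_monic_cubic_root_Ints Ints_cases by blast
    have "a ^ 2 - 2 * c * a - (of_int A + 2 * c ^ 2) = 0"
      unfolding A B Z4 param_f.simps c_def by algebra
    hence "a ^ 2 + of_int (- 2 * k) * a + of_int (- (A + 2 * k ^ 2)) = 0"
      unfolding k by simp
    hence a: "a \<in> \<int>"
      by (rule rat_monic_quadratic_root_Ints)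
    have "b ^ 2 = of_int k + 2 * a"
      using k by (simp add: c_def)
    hence "b ^ 2 \<in> \<int>"
      using a by simp
    thus ?thesis
      using a Ints_of_power2_Ints by blast
  next
    case Z2xZ2
    have "r ^ 3 + of_int 0 * r ^ 2 + of_int A * r + of_int B = 0" if "r = a \<or> r = b" for r
      using that unfolding A B Z2xZ2 by (elim disjE) (simp_all add: eval_nat_numeral algebra_simps)
    thus ?thesis
      using rat_monic_cubic_root_Ints by blast
  qed
  thus "a \<in> \<int>" "b \<in> \<int>"
    by blast+
qed

lemma contains_torsion_iff_param:
  assumes "4 * A ^ 3 + 27 * B ^ 2 \<noteq> 0"
  shows "contains_torsion G A B \<longleftrightarrow> (\<exists>a b. A = param_f G a b \<and> B = param_g G a b)"
proof -
  have "contains_torsion G A B \<longleftrightarrow> (\<exists>a b::rat. of_int A = param_f G a b \<and> of_int B = param_g G a b)"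
    using Z2_param_iff Z3_param_iff[OF assms] Z4_param_iff[OF assms] Z2xZ2_param_iff[OF assms]
    by (cases G) blast+
  also have "\<dots> \<longleftrightarrow> (\<exists>a b. A = param_f G a b \<and> B = param_g G a b)"
  proof
    assume "\<exists>a b::rat. of_int A = param_f G a b \<and> of_int B = param_g G a b"
    then obtain a b :: rat where ab: "of_int A = param_f G a b" "of_int B = param_g G a b"
      by blast
    obtain a' b' where "a = of_int a'" "b = of_int b'"
      using param_Ints[OF ab] Ints_cases by metis
    hence "A = param_f G a' b'" "B = param_g G a' b'"
      using ab by (simp_all flip: of_int_param)
    thus "\<exists>a b. A = param_f G a b \<and> B = param_g G a b"
      by blast
  next
    assume "\<exists>a b. A = param_f G a b \<and> B = param_g G a b"
    then obtain a b where "A = param_f G a b" "B = param_g G a b"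
      by blast
    hence "of_int A = param_f G (of_int a :: rat) (of_int b)" "of_int B = param_g G (of_int a :: rat) (of_int b)"
      by (simp_all add: of_int_param)
    thus "\<exists>a b::rat. of_int A = param_f G a b \<and> of_int B = param_g G a b"
      by blast
  qed
  finally show ?thesis .
qed

section \<open>Weights, height and minimality\<close>

fun wt_a :: "torsion_group \<Rightarrow> nat" where
  "wt_a Z2 = 4" | "wt_a Z3 = 1" | "wt_a Z4 = 2" | "wt_a Z2xZ2 = 2"

fun wt_b :: "torsion_group \<Rightarrow> nat" where
  "wt_b Z2 = 2" | "wt_b Z3 = 3" | "wt_b Z4 = 1" | "wt_b Z2xZ2 = 2"

lemma param_f_weighted_homogeneous:
  fixes s :: "'a::comm_ring_1"
  shows "param_f G (s ^ wt_a G * a) (s ^ wt_b G * b) = s ^ 4 * param_f G a b"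
  by (cases G) (simp_all add: eval_nat_numeral algebra_simps)

lemma param_g_weighted_homogeneous:
  fixes s :: "'a::comm_ring_1"
  shows "param_g G (s ^ wt_a G * a) (s ^ wt_b G * b) = s ^ 6 * param_g G a b"
  by (cases G) (simp_all add: eval_nat_numeral algebra_simps)

lemmas param_weighted_homogeneous = param_f_weighted_homogeneous param_g_weighted_homogeneous

definition height :: "torsion_group \<Rightarrow> real \<Rightarrow> real \<Rightarrow> real" where
  "height G a b = max (\<bar>param_f G a b\<bar> ^ 3) (param_g G a b ^ 2)"

lemma height_le_iff:
  assumes "t \<ge> 0"
  shows "height G a b \<le> t ^ 12 \<longleftrightarrow> \<bar>param_f G a b\<bar> \<le> t ^ 4 \<and> \<bar>param_g G a b\<bar> \<le> t ^ 6"
proof -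
  have "\<bar>x\<bar> ^ 3 \<le> t ^ 12 \<longleftrightarrow> \<bar>x\<bar> \<le> t ^ 4" for x :: real
    using power_mono_iff[of "\<bar>x\<bar>" "t ^ 4" 3] assms by simp
  moreover have "x ^ 2 \<le> t ^ 12 \<longleftrightarrow> \<bar>x\<bar> \<le> t ^ 6" for x :: real
    using power_mono_iff[of "\<bar>x\<bar>" "t ^ 6" 2] assms by simp
  ultimately show ?thesis
    by (simp add: height_def)
qed

text \<open>Gives positivity of the height off the origin. For \<open>Z3\<close> and
  \<open>Z4\<close> a common zero lies on a factor of 4 f^3 + 27 g^2, and along each factor f or g
  becomes a nonzero multiple of a single power; for \<open>Z2xZ2\<close> the form f is negative
  definite.\<close>

lemma param_common_zero:
  fixes a b :: real
  assumes "param_f G a b = 0" "param_g G a b = 0"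
  shows "a = 0 \<and> b = 0"
proof (cases G)
  case Z3
  have "b = - 9 * a ^ 3 \<or> b = - 5 * a ^ 3"
  proof -
    have "27 * (b + 9 * a ^ 3) ^ 3 * (b + 5 * a ^ 3) = 0"
      using disc_Z3[of a b] assms unfolding Z3 by (simp del: param_f.simps param_g.simps)
    hence "b + 9 * a ^ 3 = 0 \<or> b + 5 * a ^ 3 = 0"
      by simp
    thus ?thesis
      by linarith
  qed
  moreover have "b ^ 2 = 27 * a ^ 6"
    using assms(2) by (simp add: Z3)
  ultimately show ?thesis
    by (auto simp: power_mult_distrib)
next
  case Z4
  have "b = 0 \<or> 12 * a = 5 * b ^ 2 \<or> b ^ 2 = 3 * a"
  proof -
    have "b ^ 2 * (5 * b ^ 2 - 12 * a) * (b ^ 2 - 3 * a) ^ 4 = 0"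
      using disc_Z4[of a b] assms unfolding Z4 by (simp del: param_f.simps param_g.simps)
    thus ?thesis
      by auto
  qed
  moreover have f: "- 3 * a ^ 2 + 6 * a * b ^ 2 - 2 * (b ^ 2) ^ 2 = 0"
    using assms(1) by (simp add: Z4)
  ultimately consider "b = 0" "a = 0" | "a = 5 / 12 * b ^ 2" | "b ^ 2 = 3 * a"
    by (auto simp: field_simps)
  thus ?thesis
  proof cases
    case 2
    have "(b ^ 2) ^ 2 = 0"
      using f unfolding 2 by (simp add: power2_eq_square algebra_simps)
    thus ?thesis
      using 2 by simp
  next
    case 3
    have "a = 0"
      using f unfolding 3 by (simp add: power2_eq_square algebra_simps)
    thus ?thesis
      using 3 by simp
  qed auto
next
  case Z2xZ2
  have "a ^ 2 + b ^ 2 + (a + b) ^ 2 = 0"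
    using assms(1) by (simp add: Z2xZ2 power2_eq_square algebra_simps)
  hence "a ^ 2 = 0 \<and> b ^ 2 = 0"
    by (smt (verit) zero_le_power2)
  thus ?thesis
    by simp
qed (use assms in auto)

interpretation param: weighted_height "height G" "wt_a G" "wt_b G" for G
proof
  show "wt_a G > 0" "wt_b G > 0"
    by (cases G; simp)+
  show "height G (t ^ wt_a G * a) (t ^ wt_b G * b) = t ^ 12 * height G a b" if "t \<ge> 0" for t a b
  proof -
    have "\<bar>t ^ 4 * x\<bar> ^ 3 = t ^ 12 * \<bar>x\<bar> ^ 3" "(t ^ 6 * x) ^ 2 = t ^ 12 * x ^ 2" for x
      using that by (simp_all add: abs_mult power_mult_distrib)
    thus ?thesis
      unfolding height_def param_weighted_homogeneous using that by (simp add: max_mult_distrib_left)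
  qed
  show "height G a b > 0" if "(a, b) \<noteq> (0, 0)" for a b
    using param_common_zero[of G a b] that by (auto simp: height_def less_max_iff_disj)
  show "continuous_on UNIV (\<lambda>(a, b). height G a b)"
    unfolding height_def case_prod_unfold by (cases G) (auto intro!: continuous_intros)
  show "lip (height G \<sigma>)" for \<sigma>
    unfolding height_def
    by (cases G) (simp_all, (intro lip_max lip_power lip_abs lip_mult lip_add lip_diff lip_minus lip_const lip_ident)+)
  show "lip (\<lambda>t. height G t \<sigma>)" for \<sigma>
    unfolding height_def
    by (cases G) (simp_all, (intro lip_max lip_power lip_abs lip_mult lip_add lip_diff lip_minus lip_const lip_ident)+)
qed

text \<open>If q^4 | f and q^6 | g, then f / q^4 and g / q^6 are integers parametrised by the
  rational pair (a / q^u, b / q^v). \<open>param_Ints\<close> forces that pair to be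
  integral.\<close>

lemma minimal_iff_primitive:
  "(\<exists>q::nat. prime q \<and> int q ^ 4 dvd param_f G a b \<and> int q ^ 6 dvd param_g G a b) \<longleftrightarrow> \<not> param.primitive G a b"
proof -
  have "int q ^ 4 dvd param_f G a b \<and> int q ^ 6 dvd param_g G a b \<longleftrightarrow> int q ^ wt_a G dvd a \<and> int q ^ wt_b G dvd b"
    if "prime q" for q
  proof
    assume "int q ^ 4 dvd param_f G a b \<and> int q ^ 6 dvd param_g G a b"
    then obtain A B where AB: "param_f G a b = int q ^ 4 * A" "param_g G a b = int q ^ 6 * B"
      by (auto elim!: dvdE)
    define s x y :: rat where "s = of_nat q" and "x = of_int a / s ^ wt_a G" and "y = of_int b / s ^ wt_b G"
    have s: "s \<noteq> 0"
      using that by (auto simp: s_def)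
    have eq: "of_int a = s ^ wt_a G * x" "of_int b = s ^ wt_b G * y"
      using s by (simp_all add: x_def y_def)
    have "s ^ 4 * param_f G x y = of_int (param_f G a b)" "s ^ 6 * param_g G x y = of_int (param_g G a b)"
      unfolding of_int_param eq by (simp_all add: param_weighted_homogeneous)
    hence "of_int A = param_f G x y" "of_int B = param_g G x y"
      using s unfolding AB by (simp_all add: s_def)
    from param_Ints[OF this] obtain i j where "x = of_int i" "y = of_int j"
      by (metis Ints_cases)
    hence "(of_int a :: rat) = of_int (int q ^ wt_a G * i)" "(of_int b :: rat) = of_int (int q ^ wt_b G * j)"
      using eq by (simp_all add: s_def)
    thus "int q ^ wt_a G dvd a \<and> int q ^ wt_b G dvd b"
      unfolding of_int_eq_iff by simp
  next
    assume "int q ^ wt_a G dvd a \<and> int q ^ wt_b G dvd b"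
    then obtain i j where "a = int q ^ wt_a G * i" "b = int q ^ wt_b G * j"
      by (auto elim!: dvdE)
    thus "int q ^ 4 dvd param_f G a b \<and> int q ^ 6 dvd param_g G a b"
      by (simp add: param_weighted_homogeneous)
  qed
  thus ?thesis
    unfolding param.primitive_def by blast
qed

section \<open>Fibres of the parametrisation\<close>

lemma (in weighted_height) coordinate_bounds_power:
  obtains K where "K > 0" "\<And>t a b. t > 0 \<Longrightarrow> H a b \<le> t ^ 12 \<Longrightarrow> \<bar>a\<bar> \<le> K * t ^ u \<and> \<bar>b\<bar> \<le> K * t ^ v"
proof -
  obtain K where K: "K > 0" "\<And>Y a b. H a b \<le> Y \<Longrightarrow> \<bar>a\<bar> \<le> K * Y powr (u / 12) \<and> \<bar>b\<bar> \<le> K * Y powr (v / 12)"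
    using coordinate_bounds by blast
  have pw: "(t ^ 12) powr (real k / 12) = t ^ k" if "t > 0" for t :: real and k :: nat
    using that powr_powr[of t 12 "real k / 12"] powr_realpow[OF that, of k] by simp
  show ?thesis
  proof (rule that[OF K(1)])
    fix t a b :: real assume "t > 0" "H a b \<le> t ^ 12"
    thus "\<bar>a\<bar> \<le> K * t ^ u \<and> \<bar>b\<bar> \<le> K * t ^ v"
      using K(2)[of a b "t ^ 12"] pw by simp
  qed
qed

definition param_pair :: "torsion_group \<Rightarrow> int \<times> int \<Rightarrow> int \<times> int" where
  "param_pair G = (\<lambda>(a, b). (param_f G a b, param_g G a b))"

lemma param_pair_simp [simp]: "param_pair G (a, b) = (param_f G a b, param_g G a b)"
  by (simp add: param_pair_def)

definition nonsingular :: "int \<times> int \<Rightarrow> bool" where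
  "nonsingular = (\<lambda>(A, B). 4 * A ^ 3 + 27 * B ^ 2 \<noteq> 0)"

lemma nonsingular_simp [simp]: "nonsingular (A, B) \<longleftrightarrow> 4 * A ^ 3 + 27 * B ^ 2 \<noteq> 0"
  by (simp add: nonsingular_def)

definition param_fiber :: "torsion_group \<Rightarrow> int \<times> int \<Rightarrow> (int \<times> int) set" where
  "param_fiber G z = {w. param_pair G w = param_pair G z}"

fun fiber_size :: "torsion_group \<Rightarrow> nat" where
  "fiber_size Z2 = 1" | "fiber_size Z3 = 2" | "fiber_size Z4 = 2" | "fiber_size Z2xZ2 = 6"

lemma height_int_le_iff:
  fixes a b :: int
  assumes "t \<ge> 0"
  shows "height G a b \<le> t ^ 12 \<longleftrightarrow>
    \<bar>real_of_int (param_f G a b)\<bar> \<le> t ^ 4 \<and> \<bar>real_of_int (param_g G a b)\<bar> \<le> t ^ 6"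
  using height_le_iff[OF assms] by (simp add: of_int_param)

lemma height_eq_of_param_fiber:
  assumes "(a', b') \<in> param_fiber G (a, b)"
  shows "height G (real_of_int a') (real_of_int b') = height G (real_of_int a) (real_of_int b)"
  using assms by (simp add: height_def param_fiber_def flip: of_int_param)

section \<open>Parameters that give the same curve\<close>

lemma cube_inject:
  fixes x y :: "'a::linordered_idom"
  assumes "x ^ 3 = y ^ 3"
  shows "x = y"
proof (rule ccontr)
  assume "x \<noteq> y"
  have "(x - y) * ((x + y) ^ 2 + (x ^ 2 + y ^ 2)) = 2 * (x ^ 3 - y ^ 3)"
    by (simp add: eval_nat_numeral algebra_simps)
  hence "(x + y) ^ 2 + (x ^ 2 + y ^ 2) = 0"
    using assms \<open>x \<noteq> y\<close> by simp
  hence "x ^ 2 + y ^ 2 = 0"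
    by (simp add: add_nonneg_eq_0_iff)
  thus False
    using \<open>x \<noteq> y\<close> by (simp add: sum_power2_eq_zero_iff)
qed

text \<open>
  Two lines \<open>y = 3 a x + b\<close> that are tangent at flexes give
  \<open>(3 a x + b)\<^sup>2 - (3 a' x + b')\<^sup>2 = (x - 3 a'\<^sup>2)\<^sup>3 - (x - 3 a\<^sup>2)\<^sup>3\<close>. At their
  intersection the left-hand side vanishes, so \<open>a\<^sup>2 = a'\<^sup>2\<close> by injectivity of cubing.
\<close>

lemma Z3_param_eq_iff:
  fixes a b a' b' :: int
  shows "param_pair Z3 (a', b') = param_pair Z3 (a, b) \<longleftrightarrow> (a', b') = (a, b) \<or> (a', b') = (- a, - b)"
proof
  assume "param_pair Z3 (a', b') = param_pair Z3 (a, b)"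
  hence f: "6 * a' * b' + 27 * a' ^ 4 = 6 * a * b + 27 * a ^ 4" and g: "b' ^ 2 - 27 * a' ^ 6 = b ^ 2 - 27 * a ^ 6"
    by simp_all
  have sq: "a' ^ 2 = a ^ 2"
  proof (cases "a' = a")
    case False
    define \<alpha> \<beta> \<alpha>' \<beta>' :: rat where "\<alpha> = of_int a" and "\<beta> = of_int b" and "\<alpha>' = of_int a'" and "\<beta>' = of_int b'"
    have fr: "6 * \<alpha>' * \<beta>' + 27 * \<alpha>' ^ 4 = 6 * \<alpha> * \<beta> + 27 * \<alpha> ^ 4"
      using arg_cong[OF f, of "of_int :: int \<Rightarrow> rat"] by (simp add: \<alpha>_def \<beta>_def \<alpha>'_def \<beta>'_def)
    have gr: "\<beta>' ^ 2 - 27 * \<alpha>' ^ 6 = \<beta> ^ 2 - 27 * \<alpha> ^ 6"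
      using arg_cong[OF g, of "of_int :: int \<Rightarrow> rat"] by (simp add: \<alpha>_def \<beta>_def \<alpha>'_def \<beta>'_def)
    have ne: "\<alpha>' \<noteq> \<alpha>"
      using False by (simp add: \<alpha>_def \<alpha>'_def)
    define x where "x = (\<beta> - \<beta>') / (3 * (\<alpha>' - \<alpha>))"
    have "3 * (\<alpha>' - \<alpha>) * x = \<beta> - \<beta>'"
      using ne by (simp add: x_def)
    hence x: "3 * \<alpha> * x + \<beta> = 3 * \<alpha>' * x + \<beta>'"
      by (simp add: algebra_simps)
    have "(3 * \<alpha> * x + \<beta>) ^ 2 + (x - 3 * \<alpha> ^ 2) ^ 3 = (3 * \<alpha>' * x + \<beta>') ^ 2 + (x - 3 * \<alpha>' ^ 2) ^ 3"
    proof -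
      have "(3 * r * x + s) ^ 2 + (x - 3 * r ^ 2) ^ 3 = x ^ 3 + (6 * r * s + 27 * r ^ 4) * x + (s ^ 2 - 27 * r ^ 6)" for r s :: rat
        by (simp add: eval_nat_numeral algebra_simps)
      thus ?thesis
        using fr gr by simp
    qed
    hence "(x - 3 * \<alpha> ^ 2) ^ 3 = (x - 3 * \<alpha>' ^ 2) ^ 3"
      using x by simp
    hence "x - 3 * \<alpha> ^ 2 = x - 3 * \<alpha>' ^ 2"
      by (rule cube_inject)
    hence "(of_int (a' ^ 2) :: rat) = of_int (a ^ 2)"
      by (simp add: \<alpha>_def \<alpha>'_def)
    thus ?thesis
      by (simp only: of_int_eq_iff)
  qed simp
  have pw: "a' ^ 4 = a ^ 4" "a' ^ 6 = a ^ 6"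
    using arg_cong[OF sq, of "\<lambda>x. x ^ 2"] arg_cong[OF sq, of "\<lambda>x. x ^ 3"] by simp_all
  have "b' ^ 2 = b ^ 2" "a' * b' = a * b"
    using f g pw by simp_all
  thus "(a', b') = (a, b) \<or> (a', b') = (- a, - b)"
    using sq by (auto simp: power2_eq_iff)
qed auto

lemma card_fiber_Z3:
  assumes "nonsingular (param_pair Z3 (a, b))"
  shows "card (param_fiber Z3 (a, b)) = 2"
proof -
  have "param_fiber Z3 (a, b) = {(a, b), (- a, - b)}"
    using Z3_param_eq_iff unfolding param_fiber_def by auto
  moreover have "(a, b) \<noteq> (- a, - b)"
    using assms by auto
  ultimately show ?thesis
    by simp
qed

text \<open>The fibre consists of the ordered pairs of distinct roots of a cubic with three
  different roots.\<close>

lemma card_fiber_Z2xZ2: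
  assumes ns: "nonsingular (param_pair Z2xZ2 (a, b))"
  shows "card (param_fiber Z2xZ2 (a, b)) = 6"
proof -
  define c where "c = - a - b"
  have ne: "a \<noteq> b" "a \<noteq> c" "b \<noteq> c"
    using ns disc_Z2xZ2[of a b] by (auto simp: c_def simp del: param_f.simps param_g.simps)
  have "param_fiber Z2xZ2 (a, b) = {(a, b), (b, a), (a, c), (c, a), (b, c), (c, b)}" (is "_ = ?S")
  proof
    show "?S \<subseteq> param_fiber Z2xZ2 (a, b)"
      by (auto simp: param_fiber_def c_def eval_nat_numeral algebra_simps)
    show "param_fiber Z2xZ2 (a, b) \<subseteq> ?S"
    proof
      fix z assume z: "z \<in> param_fiber Z2xZ2 (a, b)"
      obtain x y where xy: "z = (x, y)"
        by (cases z)
      have eq: "param_f Z2xZ2 x y = param_f Z2xZ2 a b" "param_g Z2xZ2 x y = param_g Z2xZ2 a b"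
        using z by (auto simp: param_fiber_def xy simp del: param_f.simps param_g.simps)
      have "(r - a) * (r - b) * (r - c) = r ^ 3 + param_f Z2xZ2 a b * r + param_g Z2xZ2 a b" for r
        by (simp add: c_def eval_nat_numeral algebra_simps)
      moreover have "x ^ 3 + param_f Z2xZ2 x y * x + param_g Z2xZ2 x y = 0" "y ^ 3 + param_f Z2xZ2 x y * y + param_g Z2xZ2 x y = 0"
        by (simp_all add: eval_nat_numeral algebra_simps)
      ultimately have "(x - a) * (x - b) * (x - c) = 0" "(y - a) * (y - b) * (y - c) = 0"
        unfolding eq by simp_all
      hence "x \<in> {a, b, c}" "y \<in> {a, b, c}"
        by auto
      moreover have "x \<noteq> y"
        using ns disc_Z2xZ2[of x y] by (auto simp: eq simp del: param_f.simps param_g.simps)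
      ultimately show "z \<in> ?S"
        using xy by auto
    qed
  qed
  moreover have "card ?S = 6"
    using ne by simp
  ultimately show ?thesis
    by simp
qed

text \<open>P and -P give (a, b) and (a, -b). Any further member of the fibre either has the same
  double, or leads to a second root of the cubic; in both cases 5 b^2 - 12 a is a square. So b and k
  determine a, which leaves few such points.\<close>

lemma fiber_Z4_square:
  fixes a b :: int
  assumes ns: "nonsingular (param_pair Z4 (a, b))" and card: "card (param_fiber Z4 (a, b)) \<noteq> 2"
  shows "\<exists>k. 12 * a = 5 * b ^ 2 - k ^ 2"
proof -
  have b: "b \<noteq> 0"
    using ns disc_Z4[of a b] by (auto simp del: param_f.simps param_g.simps)
  have "{(a, b), (a, - b)} \<subseteq> param_fiber Z4 (a, b)"
    by (auto simp: param_fiber_def)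
  moreover have "card {(a, b), (a, - b)} = 2"
    using b by simp
  ultimately have "\<not> param_fiber Z4 (a, b) \<subseteq> {(a, b), (a, - b)}"
    using card by (metis subset_antisym)
  then obtain a' b' where mem: "(a', b') \<in> param_fiber Z4 (a, b)" and new: "(a', b') \<noteq> (a, b)" "(a', b') \<noteq> (a, - b)"
    by auto
  have eq: "param_f Z4 a' b' = param_f Z4 a b" "param_g Z4 a' b' = param_g Z4 a b"
    using mem by (auto simp: param_fiber_def simp del: param_f.simps param_g.simps)
  define c c' where "c = b ^ 2 - 2 * a" and "c' = b' ^ 2 - 2 * a'"
  have fc: "param_f Z4 a b = a ^ 2 - 2 * a * c - 2 * c ^ 2" "param_f Z4 a' b' = a' ^ 2 - 2 * a' * c' - 2 * c' ^ 2"
    by (simp_all add: c_def c'_def eval_nat_numeral algebra_simps)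
  show ?thesis
  proof (cases "c' = c")
    case True
    have "(a' - a) * (a' + a - 2 * c) = 0"
      using eq(1) unfolding fc True by (simp add: power2_eq_square algebra_simps)
    moreover have "a' \<noteq> a"
    proof
      assume "a' = a"
      hence "b' ^ 2 = b ^ 2"
        using True by (simp add: c_def c'_def)
      thus False
        using new \<open>a' = a\<close> by (auto simp: power2_eq_iff)
    qed
    ultimately have "a' = 2 * c - a"
      by simp
    hence "12 * a = 5 * b ^ 2 - b' ^ 2"
      using True by (simp add: c_def c'_def)
    thus ?thesis
      by blast
  next
    case False
    have root: "c ^ 3 + param_f Z4 a b * c + param_g Z4 a b = 0" "c' ^ 3 + param_f Z4 a' b' * c' + param_g Z4 a' b' = 0"
      by (simp_all add: c_def c'_def eval_nat_numeral algebra_simps)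
    have "(c' - c) * (c' ^ 2 + c' * c + c ^ 2 + param_f Z4 a b) = 0"
      using root unfolding eq by algebra
    hence "c' ^ 2 + c' * c + c ^ 2 + param_f Z4 a b = 0"
      using False by simp
    \<comment> \<open>Completing the square: the right-hand side is the discriminant of the
      quadratic left after removing the root c.\<close>
    hence "(2 * c' + c) ^ 2 = - 3 * c ^ 2 - 4 * param_f Z4 a b"
      by algebra
    also have "\<dots> = b ^ 2 * (5 * b ^ 2 - 12 * a)"
      by (simp add: c_def eval_nat_numeral algebra_simps)
    finally have sq: "(2 * c' + c) ^ 2 = b ^ 2 * (5 * b ^ 2 - 12 * a)" .
    hence "b ^ 2 dvd (2 * c' + c) ^ 2"
      by simp
    hence "b dvd 2 * c' + c"
      by simp
    then obtain k where "2 * c' + c = b * k"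
      by (elim dvdE)
    hence "b ^ 2 * k ^ 2 = b ^ 2 * (5 * b ^ 2 - 12 * a)"
      using sq by (simp add: power_mult_distrib)
    hence "k ^ 2 = 5 * b ^ 2 - 12 * a"
      using b by simp
    thus ?thesis
      by (intro exI[of _ k]) simp
  qed
qed

text \<open>A larger fibre means a second integer root b', and two roots of size O(t^2) determine a.
  This leaves O(t^4) such points.\<close>

lemma fiber_Z2_second_root:
  fixes a b :: int
  assumes "card (param_fiber Z2 (a, b)) \<noteq> 1"
  obtains b' where "(a, b') \<in> param_fiber Z2 (a, b)" "a = - (b ^ 2 + b * b' + b' ^ 2)"
proof -
  have "(a, b) \<in> param_fiber Z2 (a, b)"
    by (simp add: param_fiber_def)
  moreover have "param_fiber Z2 (a, b) \<noteq> {(a, b)}"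
    using assms by auto
  ultimately obtain z where z: "z \<in> param_fiber Z2 (a, b)" "z \<noteq> (a, b)"
    by blast
  then obtain b' where b': "z = (a, b')"
    by (cases z) (auto simp: param_fiber_def)
  have "(b' - b) * (b ^ 2 + b * b' + b' ^ 2 + a) = 0"
    using z(1) unfolding b' param_fiber_def by (simp add: eval_nat_numeral algebra_simps)
  hence "b ^ 2 + b * b' + b' ^ 2 + a = 0"
    using z(2) b' by simp
  hence "a = - (b ^ 2 + b * b' + b' ^ 2)"
    by simp
  thus ?thesis
    using that z(1) b' by blast
qed

section \<open>Size of the exceptional set\<close>

definition int_box :: "real \<Rightarrow> int set" where
  "int_box R = {i. \<bar>real_of_int i\<bar> \<le> R}"

lemma int_box_card: "finite (int_box R)" "R \<ge> 0 \<Longrightarrow> real (card (int_box R)) \<le> 2 * R + 1"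
proof -
  have eq: "int_box R = {- \<lfloor>R\<rfloor> .. \<lfloor>R\<rfloor>}"
    by (auto simp: int_box_def abs_le_iff le_floor_iff) linarith+
  show "finite (int_box R)"
    by (simp add: eq)
  show "real (card (int_box R)) \<le> 2 * R + 1" if "R \<ge> 0"
    using that by (simp add: eq)
qed

lemma int_box_card_power:
  assumes "t \<ge> 1" "K \<ge> 0"
  shows "real (card (int_box (K * t ^ k))) \<le> (2 * K + 1) * t ^ k"
proof -
  have "real (card (int_box (K * t ^ k))) \<le> 2 * (K * t ^ k) + 1"
    using assms by (intro int_box_card) simp
  also have "1 \<le> t ^ k"
    using assms by (intro one_le_power)
  finally show ?thesis
    by (simp add: algebra_simps)
qed

definition exceptional :: "torsion_group \<Rightarrow> real \<Rightarrow> (int \<times> int) set" where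
  "exceptional G t = {(a, b). height G a b \<le> t ^ 12 \<and>
     (\<not> nonsingular (param_pair G (a, b)) \<or> card (param_fiber G (a, b)) \<noteq> fiber_size G)}"

lemma card_le_of_subset:
  assumes "S \<subseteq> T" "finite T" "real (card T) \<le> C"
  shows "real (card S) \<le> C"
  using card_mono[OF assms(2,1)] assms(3) by linarith

text \<open>The exceptional points are covered by images of small boxes: two roots of size t^2 for
  \<open>Z2\<close>, the parameter a of size t for \<open>Z3\<close>, either a of size t^2 or b and
  k of size t for \<open>Z4\<close>, and one parameter of size t^2 for \<open>Z2xZ2\<close>.\<close>

lemma exceptional_card:
  obtains C where "C \<ge> 0" "\<And>t. t \<ge> 1 \<Longrightarrow> real (card (exceptional G t)) \<le> C * t ^ max (wt_a G) (wt_b G)"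
proof -
  obtain K where K: "K > 0"
    "\<And>t a b. t > 0 \<Longrightarrow> height G a b \<le> t ^ 12 \<Longrightarrow> \<bar>a\<bar> \<le> K * t ^ wt_a G \<and> \<bar>b\<bar> \<le> K * t ^ wt_b G"
    using param.coordinate_bounds_power by blast
  \<comment> \<open>Large enough for the boxes of radius K t^k and for the box of radius (6 K + 6) t
    that contains the number k in the case \<open>Z4\<close>.\<close>
  define M where "M = 2 * (6 * K + 6) + 1"
  have M: "M \<ge> 1" "2 * K + 1 \<le> M"
    using K(1) by (simp_all add: M_def)
  have box: "finite (int_box (K * t ^ k))" "real (card (int_box (K * t ^ k))) \<le> M * t ^ k" if "t \<ge> 1" for t and k :: nat
  proof -
    show "finite (int_box (K * t ^ k))"
      by (rule int_box_card)
    have "(2 * K + 1) * t ^ k \<le> M * t ^ k"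
      using M that by (intro mult_right_mono) auto
    thus "real (card (int_box (K * t ^ k))) \<le> M * t ^ k"
      using int_box_card_power[OF that, of K k] K(1) by linarith
  qed
  have exc: "a \<in> int_box (K * t ^ wt_a G)" "b \<in> int_box (K * t ^ wt_b G)"
    if "(a, b) \<in> exceptional G t" "t \<ge> 1" for a b t
    using that K(2)[of t a b] by (auto simp: exceptional_def int_box_def)
  have "\<exists>C\<ge>0. \<forall>t\<ge>1. real (card (exceptional G t)) \<le> C * t ^ max (wt_a G) (wt_b G)"
  proof (cases G)
    case Z2
    have "real (card (exceptional G t)) \<le> M ^ 2 * t ^ 4" if t: "t \<ge> 1" for t
    proof (rule card_le_of_subset)
      let ?B = "int_box (K * t ^ 2)"
      show "exceptional G t \<subseteq> (\<lambda>(b, b'). (- (b ^ 2 + b * b' + b' ^ 2), b)) ` (?B \<times> ?B)"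
      proof clarify
        fix a b assume ab: "(a, b) \<in> exceptional G t"
        have b: "b \<in> ?B"
          using exc[OF ab t] Z2 by simp
        have "\<exists>b'. b' \<in> ?B \<and> a = - (b ^ 2 + b * b' + b' ^ 2)"
        proof (cases "nonsingular (param_pair Z2 (a, b))")
          case True
          hence "card (param_fiber Z2 (a, b)) \<noteq> 1"
            using ab Z2 by (auto simp: exceptional_def)
          then obtain b' where b': "(a, b') \<in> param_fiber Z2 (a, b)" "a = - (b ^ 2 + b * b' + b' ^ 2)"
            by (rule fiber_Z2_second_root)
          have "height G (real_of_int a) (real_of_int b') \<le> t ^ 12"
            using height_eq_of_param_fiber[OF b'(1)] ab Z2 by (auto simp: exceptional_def)
          hence "b' \<in> ?B"
            using K(2)[of t a b'] t Z2 by (simp add: int_box_def)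
          thus ?thesis
            using b'(2) by blast
        next
          case False
          \<comment> \<open>In the singular case b itself or - b / 2 is a double root of X^3 + a X -
            g. Taking b' to be the double root, both alternatives fit the map used for two distinct
            roots.\<close>
          hence "a = - (3 * b ^ 2) \<or> 4 * a = - (3 * b ^ 2)"
            using disc_Z2[of a b] by (auto simp del: param_f.simps param_g.simps)
          thus ?thesis
          proof
            assume "a = - (3 * b ^ 2)"
            thus ?thesis
              using b by (intro exI[of _ b]) (simp add: power2_eq_square)
          next
            assume a: "4 * a = - (3 * b ^ 2)"
            \<comment> \<open>The equation makes b even, so that - b / 2 is an integer.\<close>
            hence "even (3 * b ^ 2)"
              by (metis dvd_minus_iff dvd_triv_left even_mult_iff even_numeral)
            hence "even b"
              by simp
            then obtain l where l: "b = 2 * l"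
              by (elim evenE)
            have "- l \<in> ?B"
              using b l by (simp add: int_box_def)
            moreover have "a = - (b ^ 2 + b * (- l) + (- l) ^ 2)"
              using a l by (simp add: power2_eq_square)
            ultimately show ?thesis
              by blast
          qed
        qed
        thus "(a, b) \<in> (\<lambda>(b, b'). (- (b ^ 2 + b * b' + b' ^ 2), b)) ` (?B \<times> ?B)"
          using b by force
      qed
      show "finite ((\<lambda>(b, b'). (- (b ^ 2 + b * b' + b' ^ 2), b)) ` (?B \<times> ?B))"
        using box(1)[OF t] by simp
      have "card ((\<lambda>(b, b'). (- (b ^ 2 + b * b' + b' ^ 2), b)) ` (?B \<times> ?B)) \<le> card ?B * card ?B"
        using card_image_le[of "?B \<times> ?B"] box(1)[OF t] by (simp add: card_cartesian_product)
      hence "real (card ((\<lambda>(b, b'). (- (b ^ 2 + b * b' + b' ^ 2), b)) ` (?B \<times> ?B))) \<le> real (card ?B) * real (card ?B)"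
        by (simp flip: of_nat_mult)
      also have "\<dots> \<le> (M * t ^ 2) * (M * t ^ 2)"
        using box(2)[OF t] by (intro mult_mono) (use M t in auto)
      also have "\<dots> = M ^ 2 * t ^ 4"
        by (simp add: eval_nat_numeral algebra_simps)
      finally show "real (card ((\<lambda>(b, b'). (- (b ^ 2 + b * b' + b' ^ 2), b)) ` (?B \<times> ?B))) \<le> M ^ 2 * t ^ 4" .
    qed
    thus ?thesis
      using Z2 by (intro exI[of _ "M ^ 2"]) simp
  next
    case Z3
    have "real (card (exceptional G t)) \<le> 2 * M * t ^ 3" if t: "t \<ge> 1" for t
    proof (rule card_le_of_subset)
      let ?B = "int_box (K * t ^ 1)"
      let ?T = "(\<lambda>a. (a, - (9 * a ^ 3))) ` ?B \<union> (\<lambda>a. (a, - (5 * a ^ 3))) ` ?B"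
      show "exceptional G t \<subseteq> ?T"
      proof clarify
        fix a b assume ab: "(a, b) \<in> exceptional G t" and "(a, b) \<notin> (\<lambda>a. (a, - (5 * a ^ 3))) ` ?B"
        have a: "a \<in> ?B"
          using exc[OF ab t] Z3 by simp
        hence n5: "b \<noteq> - (5 * a ^ 3)"
          using \<open>(a, b) \<notin> (\<lambda>a. (a, - (5 * a ^ 3))) ` ?B\<close> by blast
        have "\<not> nonsingular (param_pair Z3 (a, b))"
          using ab Z3 card_fiber_Z3[of a b] by (auto simp: exceptional_def simp del: param_pair_simp)
        hence "27 * (b + 9 * a ^ 3) ^ 3 * (b + 5 * a ^ 3) = 0"
          using disc_Z3[of a b] by (simp del: param_f.simps param_g.simps)
        hence "b + 9 * a ^ 3 = 0"
          using n5 by (simp add: add_eq_0_iff)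
        hence "b = - (9 * a ^ 3)"
          by simp
        thus "(a, b) \<in> (\<lambda>a. (a, - (9 * a ^ 3))) ` ?B"
          using a by blast
      qed
      show "finite ?T"
        using box(1)[OF t, of 1] by simp
      have "card ?T \<le> card ?B + card ?B"
        using card_Un_le[of "(\<lambda>a. (a, - (9 * a ^ 3))) ` ?B" "(\<lambda>a. (a, - (5 * a ^ 3))) ` ?B"]
          card_image_le[OF box(1)[OF t, of 1], of "\<lambda>a. (a, - (9 * a ^ 3))"]
          card_image_le[OF box(1)[OF t, of 1], of "\<lambda>a. (a, - (5 * a ^ 3))"] by linarith
      hence "real (card ?T) \<le> 2 * real (card ?B)"
        by linarith
      also have "\<dots> \<le> 2 * (M * t ^ 1)"
        by (intro mult_left_mono box(2)[OF t]) auto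
      also have "\<dots> \<le> 2 * (M * t ^ 3)"
        using M t by (intro mult_left_mono power_increasing) auto
      finally show "real (card ?T) \<le> 2 * M * t ^ 3"
        by simp
    qed
    thus ?thesis
      using Z3 M by (intro exI[of _ "2 * M"]) simp
  next
    case Z4
    have "real (card (exceptional G t)) \<le> (M + M ^ 2) * t ^ 2" if t: "t \<ge> 1" for t
    proof (rule card_le_of_subset)
      let ?A = "int_box (K * t ^ 2)" and ?B = "int_box (K * t ^ 1)" and ?D = "int_box ((6 * K + 6) * t ^ 1)"
      let ?T = "(\<lambda>a. (a, 0)) ` ?A \<union> (\<lambda>(b, k). ((5 * b ^ 2 - k ^ 2) div 12, b)) ` (?B \<times> ?D)"
      have D: "finite ?D" "real (card ?D) \<le> M * t"
        using int_box_card(1) int_box_card_power[OF t, of "6 * K + 6" 1] K(1) by (auto simp: M_def)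
      show "exceptional G t \<subseteq> ?T"
      proof clarify
        fix a b assume ab: "(a, b) \<in> exceptional G t"
          and n: "(a, b) \<notin> (\<lambda>(b, k). ((5 * b ^ 2 - k ^ 2) div 12, b)) ` (?B \<times> ?D)"
        have a: "a \<in> ?A" and b: "b \<in> ?B"
          using exc[OF ab t] Z4 by simp_all
        have "b = 0 \<or> (\<exists>k. 12 * a = 5 * b ^ 2 - k ^ 2)"
        proof (cases "nonsingular (param_pair Z4 (a, b))")
          case True
          hence "card (param_fiber Z4 (a, b)) \<noteq> 2"
            using ab Z4 by (auto simp: exceptional_def)
          thus ?thesis
            using fiber_Z4_square[OF True] by blast
        next
          case False
          hence "b ^ 2 * (5 * b ^ 2 - 12 * a) * (b ^ 2 - 3 * a) ^ 4 = 0"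
            using disc_Z4[of a b] by (simp del: param_f.simps param_g.simps)
          \<comment> \<open>The singular parameters with b nonzero are the squares with k = 0 and k
            = b.\<close>
          hence "b = 0 \<or> 12 * a = 5 * b ^ 2 - 0 ^ 2 \<or> 12 * a = 5 * b ^ 2 - b ^ 2"
            by auto
          thus ?thesis
            by blast
        qed
        moreover have False if k: "12 * a = 5 * b ^ 2 - k ^ 2" for k
        proof -
          have "\<bar>real_of_int a\<bar> \<le> K * t ^ 2" "\<bar>real_of_int b\<bar> \<le> K * t"
            using a b by (simp_all add: int_box_def)
          moreover from this have "real_of_int b ^ 2 \<le> (K * t) ^ 2"
            by (metis abs_ge_zero power2_abs power_mono)
          moreover have "real_of_int k ^ 2 = 5 * real_of_int b ^ 2 - 12 * real_of_int a"
          proof -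
            have "real_of_int (k ^ 2) = real_of_int (5 * b ^ 2 - 12 * a)"
              using k by (simp only: of_int_eq_iff)
            thus ?thesis
              by simp
          qed
          ultimately have "real_of_int k ^ 2 \<le> 5 * (K * t) ^ 2 + 12 * (K * t ^ 2)"
            by linarith
          also have "\<dots> = (5 * K ^ 2 + 12 * K) * t ^ 2"
            by (simp add: power_mult_distrib algebra_simps)
          \<comment> \<open>Source of the radius 6 K + 6: its square dominates 5 K^2 + 12 K.\<close>
          also have "\<dots> \<le> (6 * K + 6) ^ 2 * t ^ 2"
            using K(1) by (intro mult_right_mono) (simp_all add: power2_eq_square algebra_simps)
          finally have "\<bar>real_of_int k\<bar> \<le> \<bar>(6 * K + 6) * t\<bar>"
            by (simp add: abs_le_square_iff power_mult_distrib)
          hence "k \<in> ?D"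
            using K(1) t by (simp add: int_box_def)
          moreover have "a = (5 * b ^ 2 - k ^ 2) div 12"
            using k by linarith
          ultimately show False
            using n b by force
        qed
        ultimately have "b = 0"
          by blast
        thus "(a, b) \<in> (\<lambda>a. (a, 0)) ` ?A"
          using a by simp
      qed
      show "finite ?T"
        using box(1)[OF t] D(1) by (intro finite_UnI finite_imageI finite_cartesian_product)
      have "card ?T \<le> card ?A + card ?B * card ?D"
      proof -
        have "finite (?B \<times> ?D)"
          by (intro finite_cartesian_product box(1)[OF t] D(1))
        from card_image_le[OF this, of "\<lambda>(b, k). ((5 * b ^ 2 - k ^ 2) div 12, b)"] show ?thesis
          using card_Un_le[of "(\<lambda>a. (a, 0::int)) ` ?A" "(\<lambda>(b, k). ((5 * b ^ 2 - k ^ 2) div 12, b)) ` (?B \<times> ?D)"]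
            card_image_le[OF box(1)[OF t, of 2], of "\<lambda>a. (a, 0::int)"]
          unfolding card_cartesian_product by linarith
      qed
      hence "real (card ?T) \<le> real (card ?A) + real (card ?B) * real (card ?D)"
        by (simp flip: of_nat_mult of_nat_add)
      also have "\<dots> \<le> M * t ^ 2 + (M * t ^ 1) * (M * t)"
        by (intro add_mono mult_mono box(2)[OF t] D(2)) (use M t in auto)
      also have "\<dots> = (M + M ^ 2) * t ^ 2"
        by (simp add: power2_eq_square algebra_simps)
      finally show "real (card ?T) \<le> (M + M ^ 2) * t ^ 2" .
    qed
    thus ?thesis
      using Z4 M by (intro exI[of _ "M + M ^ 2"]) (simp add: power2_eq_square)
  next
    case Z2xZ2
    have "real (card (exceptional G t)) \<le> 3 * M * t ^ 2" if t: "t \<ge> 1" for t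
    proof (rule card_le_of_subset)
      let ?B = "int_box (K * t ^ 2)"
      let ?T = "(\<lambda>a. (a, a)) ` ?B \<union> ((\<lambda>a. (a, - (2 * a))) ` ?B \<union> (\<lambda>b. (- (2 * b), b)) ` ?B)"
      show "exceptional G t \<subseteq> ?T"
      proof (rule subrelI)
        fix a b assume ab: "(a, b) \<in> exceptional G t"
        have a: "a \<in> ?B" and b: "b \<in> ?B"
          using exc[OF ab t] Z2xZ2 by simp_all
        have "\<not> nonsingular (param_pair Z2xZ2 (a, b))"
          using ab Z2xZ2 card_fiber_Z2xZ2[of a b] by (auto simp: exceptional_def simp del: param_pair_simp)
        hence "((a - b) * (2 * a + b) * (a + 2 * b)) ^ 2 = 0"
          using disc_Z2xZ2[of a b] by (simp del: param_f.simps param_g.simps)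
        hence "a = b \<or> b = - (2 * a) \<or> a = - (2 * b)"
          by auto
        thus "(a, b) \<in> ?T"
          using a b by blast
      qed
      show "finite ?T"
        using box(1)[OF t] by simp
      have "card ?T \<le> card ?B + (card ?B + card ?B)"
        using card_Un_le[of "(\<lambda>a. (a, a)) ` ?B" "(\<lambda>a. (a, - (2 * a))) ` ?B \<union> (\<lambda>b. (- (2 * b), b)) ` ?B"]
          card_Un_le[of "(\<lambda>a. (a, - (2 * a))) ` ?B" "(\<lambda>b. (- (2 * b), b)) ` ?B"]
          card_image_le[OF box(1)[OF t, of 2], of "\<lambda>a. (a, a)"]
          card_image_le[OF box(1)[OF t, of 2], of "\<lambda>a. (a, - (2 * a))"]
          card_image_le[OF box(1)[OF t, of 2], of "\<lambda>b. (- (2 * b), b)"] by linarith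
      hence "real (card ?T) \<le> 3 * real (card ?B)"
        by linarith
      also have "\<dots> \<le> 3 * (M * t ^ 2)"
        by (intro mult_left_mono box(2)[OF t]) auto
      finally show "real (card ?T) \<le> 3 * M * t ^ 2"
        by simp
    qed
    thus ?thesis
      using Z2xZ2 M by (intro exI[of _ "3 * M"]) simp
  qed
  thus ?thesis
    using that by blast
qed

section \<open>Counting curves\<close>

text \<open>Being bad depends only on the image, so the good points form complete fibres of size r.
  Hence |T| = r |\<Phi>(G)| + |Bad|, while |E| lies between |\<Phi>(G)| and |\<Phi>(G)| +
  |Bad|.\<close>

lemma card_image_fiber_bound:
  fixes \<Phi> :: "'a \<Rightarrow> 'b" and r :: nat and D :: "'b \<Rightarrow> bool"
  assumes fin: "finite T"
  defines "E \<equiv> \<Phi> ` {z \<in> T. D (\<Phi> z)}"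
    and "Bad \<equiv> {z \<in> T. \<not> D (\<Phi> z) \<or> card {w \<in> T. \<Phi> w = \<Phi> z} \<noteq> r}"
  shows "\<bar>real (card T) - real r * real (card E)\<bar> \<le> (real r + 1) * real (card Bad)"
proof -
  define G where "G = T - Bad"
  have finG: "finite G" and finBad: "finite Bad"
    using fin by (auto simp: G_def Bad_def)
  have "{w \<in> G. \<Phi> w = y} = {w \<in> T. \<Phi> w = y}" if "y \<in> \<Phi> ` G" for y
    using that by (auto simp: G_def Bad_def)
  hence fib: "card {w \<in> G. \<Phi> w = y} = r" if "y \<in> \<Phi> ` G" for y
    using that by (auto simp: G_def Bad_def)
  have "card G = (\<Sum>y\<in>\<Phi> ` G. card {w \<in> G. \<Phi> w = y})"
    unfolding card_eq_sum by (rule sum.image_gen[OF finG])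
  hence cardG: "card G = r * card (\<Phi> ` G)"
    using fib by simp
  have cardT: "card T = card G + card Bad"
    using fin by (simp add: G_def Bad_def card_Diff_subset card_mono)
  have finE: "finite E"
    using fin by (simp add: E_def)
  have "\<Phi> ` G \<subseteq> E"
    by (auto simp: G_def Bad_def E_def)
  hence lower: "card (\<Phi> ` G) \<le> card E"
    by (rule card_mono[OF finE])
  have "E \<subseteq> \<Phi> ` G \<union> \<Phi> ` Bad"
    by (auto simp: G_def E_def)
  hence "card E \<le> card (\<Phi> ` G \<union> \<Phi> ` Bad)"
    using finG finBad by (intro card_mono) auto
  also have "\<dots> \<le> card (\<Phi> ` G) + card (\<Phi> ` Bad)"
    by (rule card_Un_le)
  also have "\<dots> \<le> card (\<Phi> ` G) + card Bad"
    using card_image_le[OF finBad] by simp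
  finally have upper: "card E \<le> card (\<Phi> ` G) + card Bad" .
  have "real r * real (card (\<Phi> ` G)) \<le> real r * real (card E)"
    using lower by (intro mult_left_mono) auto
  moreover have "real r * real (card E) \<le> real r * (real (card (\<Phi> ` G)) + real (card Bad))"
    using upper by (intro mult_left_mono) (auto simp flip: of_nat_add)
  moreover have "real (card T) = real r * real (card (\<Phi> ` G)) + real (card Bad)"
    using cardT cardG by simp
  moreover have "0 \<le> real r * real (card Bad)"
    by simp
  ultimately show ?thesis
    unfolding abs_le_iff by (simp add: algebra_simps)
qed

section \<open>Local conditions read on the residues of the parameters\<close>

lemma param_mod:
  "param_f G (a mod m) (b mod m) mod m = param_f G a b mod (m::int)"
  "param_g G (a mod m) (b mod m) mod m = param_g G a b mod (m::int)"
proof -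
  have ab: "[a mod m = a] (mod m)" "[b mod m = b] (mod m)"
    by (simp_all add: cong_def)
  have "[param_f G (a mod m) (b mod m) = param_f G a b] (mod m)"
    using ab by (cases G) (auto intro!: cong_add cong_diff cong_mult cong_pow cong_minus_minus_iff[THEN iffD2] cong_refl)
  moreover have "[param_g G (a mod m) (b mod m) = param_g G a b] (mod m)"
    using ab by (cases G) (auto intro!: cong_add cong_diff cong_mult cong_pow cong_refl)
  ultimately show "param_f G (a mod m) (b mod m) mod m = param_f G a b mod m"
    "param_g G (a mod m) (b mod m) mod m = param_g G a b mod m"
    by (simp_all add: cong_def)
qed

lemma reduce_param_mod:
  "reduce p (param_pair G (a mod int p, b mod int p)) = reduce p (param_pair G (a, b))"
  by (simp add: reduce_def param_mod del: param_f.simps param_g.simps)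

definition param_points :: "torsion_group \<Rightarrow> nat \<Rightarrow> local_condition \<Rightarrow> real \<Rightarrow> (int \<times> int) set" where
  "param_points G p LC t = {(a, b). height G a b \<le> t ^ 12 \<and> param.primitive G a b \<and> LC (reduce p (param_pair G (a, b)))}"

lemma curves_LC_eq_image:
  assumes "t \<ge> 0" "X powr (1 / 3) = t ^ 4" "X powr (1 / 2) = t ^ 6"
  shows "curves_LC G p LC X = param_pair G ` {z \<in> param_points G p LC t. nonsingular (param_pair G z)}"
proof (intro Set.set_eqI iffI)
  fix E assume E: "E \<in> curves_LC G p LC X"
  obtain A B where AB: "E = (A, B)"
    by (cases E)
  have ns: "4 * A ^ 3 + 27 * B ^ 2 \<noteq> 0" and "contains_torsion G A B"
    using E by (auto simp: AB curves_LC_def curves_def)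
  then obtain a b where ab: "A = param_f G a b" "B = param_g G a b"
    using contains_torsion_iff_param by blast
  have "(a, b) \<in> param_points G p LC t"
    using E minimal_iff_primitive[of G a b] assms
    by (auto simp: AB ab curves_LC_def curves_def param_points_def height_int_le_iff simp del: param_f.simps param_g.simps)
  thus "E \<in> param_pair G ` {z \<in> param_points G p LC t. nonsingular (param_pair G z)}"
    using ns by (auto simp: AB ab simp del: param_f.simps param_g.simps intro!: image_eqI[of _ _ "(a, b)"])
next
  fix E assume "E \<in> param_pair G ` {z \<in> param_points G p LC t. nonsingular (param_pair G z)}"
  then obtain a b where ab: "E = param_pair G (a, b)" "(a, b) \<in> param_points G p LC t" "nonsingular (param_pair G (a, b))"
    by auto
  have "contains_torsion G (param_f G a b) (param_g G a b)"
    using ab(3) by (subst contains_torsion_iff_param) auto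
  thus "E \<in> curves_LC G p LC X"
    using ab minimal_iff_primitive[of G a b] assms
    by (auto simp: curves_LC_def curves_def param_points_def height_int_le_iff simp del: param_f.simps param_g.simps)
qed

lemma finite_param_points: "finite (param_points G p LC t)"
  by (rule finite_subset[OF _ param.finite_int_points[of G "t ^ 12"]]) (auto simp: param_points_def)

text \<open>Height, minimality and the local condition depend only on (A, B), so the counted points
  are unions of complete fibres.\<close>

lemma param_fiber_in_param_points:
  assumes "z \<in> param_points G p LC t" "t \<ge> 0"
  shows "{w \<in> param_points G p LC t. param_pair G w = param_pair G z} = param_fiber G z"
proof -
  have "w \<in> param_points G p LC t" if "w \<in> param_fiber G z" for w
  proof -
    obtain a b a' b' where zw: "z = (a, b)" "w = (a', b')"
      by (cases z; cases w)
    have eq: "param_f G a' b' = param_f G a b" "param_g G a' b' = param_g G a b"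
      using that by (auto simp: param_fiber_def zw simp del: param_f.simps param_g.simps)
    thus ?thesis
      using assms minimal_iff_primitive[of G a b] minimal_iff_primitive[of G a' b']
      by (auto simp: param_points_def zw height_int_le_iff simp del: param_f.simps param_g.simps)
  qed
  thus ?thesis
    by (auto simp: param_fiber_def)
qed

lemma param_points_count:
  obtains C where "C \<ge> 0"
    "\<And>p LC. p > 0 \<Longrightarrow> \<exists>\<kappa>. \<forall>t>0. \<bar>real (card (param_points G p LC t)) - \<kappa> * t ^ (wt_a G + wt_b G)\<bar>
       \<le> C * (real p * t ^ max (wt_a G) (wt_b G) + (real p)\<^sup>2 * t)"
proof -
  have w2: "max (wt_a G) (wt_b G) \<ge> 2"
    by (cases G) auto
  obtain C where C: "C \<ge> 0"
    "\<And>p S. p > 0 \<Longrightarrow> \<exists>\<kappa>. \<forall>t>0.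
       \<bar>real (card {(a :: int, b :: int). height G a b \<le> t ^ 12 \<and> param.primitive G a b \<and> S (a mod int p, b mod int p)})
          - \<kappa> * t ^ (wt_a G + wt_b G)\<bar>
         \<le> C * (real p * t ^ max (wt_a G) (wt_b G) + (real p)\<^sup>2 * t)"
    by (rule param.primitive_count[OF w2]) (rule that)
  show ?thesis
  proof (rule that[OF C(1)])
    fix p :: nat and LC assume "p > 0"
    from C(2)[OF this, of "\<lambda>z. LC (reduce p (param_pair G z))"]
    show "\<exists>\<kappa>. \<forall>t>0. \<bar>real (card (param_points G p LC t)) - \<kappa> * t ^ (wt_a G + wt_b G)\<bar>
       \<le> C * (real p * t ^ max (wt_a G) (wt_b G) + (real p)\<^sup>2 * t)"
      unfolding param_points_def reduce_param_mod .
  qed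
qed

lemma exponents:
  assumes "X > 0"
  defines "t \<equiv> X powr (1 / 12)"
  shows "X powr (1 / 3) = t ^ 4" "X powr (1 / 2) = t ^ 6" "X powr (1 / d_of G) = t ^ (wt_a G + wt_b G)"
    "X powr (1 / e_of G) = t ^ max (wt_a G) (wt_b G)"
proof -
  have pw: "t ^ k = X powr (real k / 12)" for k
    using assms powr_realpow[of t k] by (simp add: powr_powr)
  show "X powr (1 / 3) = t ^ 4" "X powr (1 / 2) = t ^ 6"
    by (simp_all add: pw)
  show "X powr (1 / d_of G) = t ^ (wt_a G + wt_b G)" "X powr (1 / e_of G) = t ^ max (wt_a G) (wt_b G)"
    unfolding pw by (cases G; simp)+
qed

text \<open>The constant precedes p and the local condition, which makes the error uniform in
  both.\<close>

theorem curves_LC_count: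
  obtains C where "C \<ge> 0"
    "\<And>p LC. p > 0 \<Longrightarrow> \<exists>\<kappa>. \<forall>X\<ge>1. \<bar>real (card (curves_LC G p LC X)) - \<kappa> * X powr (1 / d_of G)\<bar>
       \<le> C * (real p * X powr (1 / e_of G) + (real p)\<^sup>2 * X powr (1 / 12))"
proof -
  obtain C where C: "C \<ge> 0"
    "\<And>p LC. p > 0 \<Longrightarrow> \<exists>\<kappa>. \<forall>t>0. \<bar>real (card (param_points G p LC t)) - \<kappa> * t ^ (wt_a G + wt_b G)\<bar>
       \<le> C * (real p * t ^ max (wt_a G) (wt_b G) + (real p)\<^sup>2 * t)"
    using param_points_count by blast
  obtain C' where C': "C' \<ge> 0" "\<And>t. t \<ge> 1 \<Longrightarrow> real (card (exceptional G t)) \<le> C' * t ^ max (wt_a G) (wt_b G)"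
    using exceptional_card by blast
  define r where "r = real (fiber_size G)"
  have r: "r \<ge> 1"
    by (cases G) (auto simp: r_def)
  define D where "D = C + (r + 1) * C'"
  show ?thesis
  proof (rule that[of D])
    show "D \<ge> 0"
      using C(1) C'(1) r by (simp add: D_def)
    fix p :: nat and LC assume p: "p > 0"
    obtain \<kappa> where \<kappa>: "\<And>t. t > 0 \<Longrightarrow> \<bar>real (card (param_points G p LC t)) - \<kappa> * t ^ (wt_a G + wt_b G)\<bar>
       \<le> C * (real p * t ^ max (wt_a G) (wt_b G) + (real p)\<^sup>2 * t)"
      using C(2)[OF p, of LC] by blast
    show "\<exists>\<kappa>. \<forall>X\<ge>1. \<bar>real (card (curves_LC G p LC X)) - \<kappa> * X powr (1 / d_of G)\<bar>
       \<le> D * (real p * X powr (1 / e_of G) + (real p)\<^sup>2 * X powr (1 / 12))"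
    \<comment> \<open>Each curve outside the exceptional set is counted r times among the parameter
      points.\<close>
    proof (intro exI[of _ "\<kappa> / r"] allI impI)
      fix X :: real assume X: "X \<ge> 1"
      define t where "t = X powr (1 / 12)"
      have t: "t \<ge> 1"
        using X by (simp add: t_def ge_one_powr_ge_zero)
      have X0: "X > 0"
        using X by simp
      note ex = exponents[OF X0, folded t_def]
      define w where "w = max (wt_a G) (wt_b G)"
      define T where "T = param_points G p LC t"
      define Err where "Err = real p * t ^ w + (real p)\<^sup>2 * t"
      have finT: "finite T"
        unfolding T_def by (rule finite_param_points)
      have E: "curves_LC G p LC X = param_pair G ` {z \<in> T. nonsingular (param_pair G z)}"
        unfolding T_def using t ex(1,2) by (intro curves_LC_eq_image) auto
      have "{z \<in> T. \<not> nonsingular (param_pair G z) \<or> card {w \<in> T. param_pair G w = param_pair G z} \<noteq> fiber_size G}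
          \<subseteq> exceptional G t"
      proof
        fix z assume z: "z \<in> {z \<in> T. \<not> nonsingular (param_pair G z) \<or> card {w \<in> T. param_pair G w = param_pair G z} \<noteq> fiber_size G}"
        hence "{w \<in> T. param_pair G w = param_pair G z} = param_fiber G z"
          using t unfolding T_def by (intro param_fiber_in_param_points) auto
        thus "z \<in> exceptional G t"
          using z by (cases z) (auto simp: exceptional_def T_def param_points_def simp del: param_pair_simp)
      qed
      moreover have "finite (exceptional G t)"
        by (rule finite_subset[OF _ param.finite_int_points[of G "t ^ 12"]]) (auto simp: exceptional_def)
      ultimately have "real (card {z \<in> T. \<not> nonsingular (param_pair G z) \<or> card {w \<in> T. param_pair G w = param_pair G z} \<noteq> fiber_size G})
          \<le> C' * t ^ w"
        using C'(2)[OF t] unfolding w_def by (rule card_le_of_subset)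
      hence "(r + 1) * real (card {z \<in> T. \<not> nonsingular (param_pair G z) \<or> card {w \<in> T. param_pair G w = param_pair G z} \<noteq> fiber_size G})
          \<le> (r + 1) * (C' * t ^ w)"
        using r by (intro mult_left_mono) auto
      hence 1: "\<bar>real (card T) - r * real (card (curves_LC G p LC X))\<bar> \<le> (r + 1) * (C' * t ^ w)"
        using card_image_fiber_bound[OF finT, where \<Phi> = "param_pair G" and D = nonsingular and r = "fiber_size G"] unfolding E r_def by linarith
      have 2: "\<bar>real (card T) - \<kappa> * t ^ (wt_a G + wt_b G)\<bar> \<le> C * Err"
        using \<kappa>[of t] t unfolding T_def Err_def w_def by simp
      \<comment> \<open>The exceptional points cost O(t^w), which fits into the error because p
        \<ge> 1.\<close>
      have "1 * t ^ w \<le> real p * t ^ w"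
        using p t by (intro mult_right_mono) auto
      hence "t ^ w \<le> Err"
        using t by (simp add: Err_def add_increasing2)
      hence "(r + 1) * (C' * t ^ w) \<le> (r + 1) * (C' * Err)"
        using r C'(1) by (intro mult_left_mono) auto
      hence "\<bar>r * real (card (curves_LC G p LC X)) - \<kappa> * t ^ (wt_a G + wt_b G)\<bar> \<le> C * Err + (r + 1) * (C' * Err)"
        using 1 2 by linarith
      also have "\<dots> = D * Err"
        by (simp add: D_def algebra_simps)
      finally have *: "\<bar>r * real (card (curves_LC G p LC X)) - \<kappa> * t ^ (wt_a G + wt_b G)\<bar> \<le> D * Err" .
      have "\<bar>real (card (curves_LC G p LC X)) - \<kappa> / r * t ^ (wt_a G + wt_b G)\<bar>
          = \<bar>r * real (card (curves_LC G p LC X)) - \<kappa> * t ^ (wt_a G + wt_b G)\<bar> / r"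
        using r by (simp add: abs_div_pos[symmetric] field_simps del: abs_div_pos)
      also have "\<dots> \<le> \<bar>r * real (card (curves_LC G p LC X)) - \<kappa> * t ^ (wt_a G + wt_b G)\<bar> / 1"
        using r by (intro divide_left_mono) auto
      also have "\<dots> \<le> D * Err"
        using * by simp
      finally show "\<bar>real (card (curves_LC G p LC X)) - \<kappa> / r * X powr (1 / d_of G)\<bar>
          \<le> D * (real p * X powr (1 / e_of G) + (real p)\<^sup>2 * X powr (1 / 12))"
        unfolding ex Err_def w_def t_def[symmetric] .
    qed
  qed
qed

section \<open>Positivity of c(G)\<close>

lemma measure_pos_of_open_subset:
  fixes S U :: "(real \<times> real) set"
  assumes S: "S \<in> fmeasurable lborel" and U: "open U" "U \<noteq> {}" "U \<subseteq> S"
  shows "measure lborel S > 0"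
proof (rule ccontr)
  assume "\<not> measure lborel S > 0"
  hence "measure lborel S = 0"
    by (simp add: not_less measure_le_0_iff)
  hence "S \<in> null_sets lborel"
    using S by (simp add: fmeasurable_def null_sets_def emeasure_eq_ennreal_measure less_top)
  hence "S \<in> null_sets lebesgue"
    by (rule null_sets_completionI)
  hence "negligible S"
    by (simp add: negligible_iff_null_sets)
  hence "negligible U"
    using U(3) negligible_subset by blast
  thus False
    using open_not_negligible[OF U(1,2)] by blast
qed

text \<open>\<open>measure\<close> is 0 on a set of infinite measure, so positivity of the area
  needs finiteness. For \<open>Z2xZ2\<close> the region is in other coordinates than the height, and
  the ellipse a^2 + 3 b^2 \<le> 4 bounds it.\<close>

lemma region1_fmeasurable: "region1 G \<in> fmeasurable lborel"
proof (cases "G = Z2xZ2")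
  case False
  have "region1 G = {(a, b). height G a b \<le> 1}"
    using height_le_iff[of 1 G] False by (cases G) (auto simp: region1_def)
  thus ?thesis
    using param.region_fmeasurable[of G] by simp
next
  case True
  have "closed {z. \<bar>f_of Z2xZ2 (fst z) (snd z)\<bar> \<le> 1 \<and> \<bar>g_of Z2xZ2 (fst z) (snd z)\<bar> \<le> 1}"
    by (intro closed_Collect_conj closed_Collect_le) (auto intro!: continuous_intros)
  hence "closed (region1 G)"
    by (simp add: region1_def True case_prod_unfold)
  moreover have "region1 G \<subseteq> {-2..2} \<times> {-2..2}"
  proof (rule subrelI)
    fix a b assume "(a, b) \<in> region1 G"
    hence "a ^ 2 + 3 * b ^ 2 \<le> 4"
      by (simp add: region1_def True abs_le_iff)
    moreover have "0 \<le> a ^ 2" "0 \<le> b ^ 2"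
      by simp_all
    ultimately have "a ^ 2 \<le> 4" "b ^ 2 \<le> 4"
      by linarith+
    hence "\<bar>a\<bar> \<le> \<bar>2\<bar>" "\<bar>b\<bar> \<le> \<bar>2\<bar>"
      unfolding abs_le_square_iff by simp_all
    thus "(a, b) \<in> {-2..2} \<times> {-2..2}"
      by auto
  qed
  hence "bounded (region1 G)"
    by (rule bounded_subset[rotated]) (intro bounded_Times bounded_closed_interval)
  ultimately have "compact (region1 G)"
    by (simp add: compact_eq_bounded_closed)
  thus ?thesis
    by (rule fmeasurable_compact)
qed

lemma region1_measure_pos: "measure lborel (region1 G) > 0"
proof (rule measure_pos_of_open_subset[OF region1_fmeasurable])
  let ?U = "{z. \<bar>f_of G (fst z) (snd z)\<bar> < 1} \<inter> {z. \<bar>g_of G (fst z) (snd z)\<bar> < 1}"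
  have "continuous_on UNIV (\<lambda>z. f_of G (fst z) (snd z))" "continuous_on UNIV (\<lambda>z. g_of G (fst z) (snd z))"
    by (cases G; auto intro!: continuous_intros)+
  thus "open ?U"
    by (intro open_Int open_Collect_less continuous_intros)
  have "(0, 0) \<in> ?U"
    by (cases G) auto
  thus "?U \<noteq> {}"
    by blast
  show "?U \<subseteq> region1 G"
    by (auto simp: region1_def)
qed

lemma zeta_real_pos:
  assumes "s > 1"
  shows "zeta_real s > 0"
proof -
  have "summable (\<lambda>n. real n powr (- s))"
    using assms by (simp add: summable_real_powr_iff)
  hence "summable (\<lambda>n. real (Suc n) powr (- s))"
    by (subst summable_Suc_iff)
  hence "summable (\<lambda>n. 1 / real (Suc n) powr s)"
    by (simp only: powr_minus_divide)
  thus ?thesis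
    unfolding zeta_real_def by (rule suminf_pos) (simp add: add_pos_nonneg)
qed

text \<open>Allows the leading coefficient to be divided by c(G).\<close>

lemma c_of_pos: "c_of G > 0"
proof -
  have "zeta_real (12 / d_of G) > 0"
    by (rule zeta_real_pos) (cases G; simp)
  moreover have "r_of G > 0"
    by (cases G) auto
  ultimately show ?thesis
    using region1_measure_pos[of G] by (simp add: c_of_def)
qed

section \<open>The asymptotic formula\<close>

theorem theorem4:
  shows "\<exists>(c :: torsion_group \<Rightarrow> nat \<Rightarrow> local_condition \<Rightarrow> real)
          (h :: torsion_group \<Rightarrow> nat \<Rightarrow> local_condition \<Rightarrow> real \<Rightarrow> real).
      (\<exists>C. \<forall>G p LC. \<forall>X\<ge>1. prime p \<and> p \<ge> 5 \<longrightarrow>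
         \<bar>real (card (curves_LC G p LC X)) -
           c_of G * c G p LC *
             (real p powr (12 / d_of G) / (real p powr (12 / d_of G) - 1)) *
             X powr (1 / d_of G)\<bar>
         \<le> C * \<bar>h G p LC X\<bar>) \<and>
      (\<exists>D. \<forall>G p LC. \<forall>X\<ge>1. prime p \<and> p \<ge> 5 \<longrightarrow>
         \<bar>h G p LC X\<bar> \<le> D * (real p * X powr (1 / e_of G) + (real p)\<^sup>2 * X powr (1 / 12)))"
proof -
  \<comment> \<open>The admissible upper bound itself serves as the error function, so its order of
    magnitude holds with constant 1.\<close>
  define h where "h = (\<lambda>G (p::nat) (LC::local_condition) X. real p * X powr (1 / e_of G) + (real p)\<^sup>2 * X powr (1 / 12))"
  have h_nonneg: "h G p LC X \<ge> 0" for G p LC X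
    by (simp add: h_def)
  have "\<exists>C\<ge>0. \<forall>p LC. p > 0 \<longrightarrow> (\<exists>\<kappa>. \<forall>X\<ge>1.
      \<bar>real (card (curves_LC G p LC X)) - \<kappa> * X powr (1 / d_of G)\<bar> \<le> C * h G p LC X)" for G
    unfolding h_def by (rule curves_LC_count[of G]) blast
  then obtain C where C: "\<And>G. C G \<ge> 0" "\<And>G p LC. p > 0 \<Longrightarrow> \<exists>\<kappa>. \<forall>X\<ge>1.
      \<bar>real (card (curves_LC G p LC X)) - \<kappa> * X powr (1 / d_of G)\<bar> \<le> C G * h G p LC X"
    by metis
  define \<kappa> where "\<kappa> = (\<lambda>G p LC. SOME \<kappa>. \<forall>X\<ge>1.
      \<bar>real (card (curves_LC G p LC X)) - \<kappa> * X powr (1 / d_of G)\<bar> \<le> C G * h G p LC X)"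
  have \<kappa>: "\<bar>real (card (curves_LC G p LC X)) - \<kappa> G p LC * X powr (1 / d_of G)\<bar> \<le> C G * h G p LC X"
    if "p > 0" "X \<ge> 1" for G p LC X
    using someI_ex[OF C(2)[OF that(1), of G LC]] that(2) unfolding \<kappa>_def by blast
  define P where "P = (\<lambda>G (p::nat). real p powr (12 / d_of G) / (real p powr (12 / d_of G) - 1))"
  \<comment> \<open>Solves c(G) * c * P = \<kappa>; both divisors are positive when p \<ge>
    5.\<close>
  define c where "c = (\<lambda>G p LC. \<kappa> G p LC / (c_of G * P G p))"
  \<comment> \<open>The constants are nonnegative, so their sum over the four groups serves for all
    of them.\<close>
  define C' where "C' = C Z2 + C Z3 + C Z4 + C Z2xZ2"
  have C': "C G \<le> C'" for G
    using C(1)[of Z2] C(1)[of Z3] C(1)[of Z4] C(1)[of Z2xZ2] by (cases G) (simp_all add: C'_def)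
  have main: "\<bar>real (card (curves_LC G p LC X)) - c_of G * c G p LC * P G p * X powr (1 / d_of G)\<bar> \<le> C' * \<bar>h G p LC X\<bar>"
    if "X \<ge> 1" "p \<ge> 5" for G p LC X
  proof -
    have "real p powr 0 < real p powr (12 / d_of G)"
      using that by (intro powr_less_mono) (cases G; simp)+
    hence "P G p > 0"
      using that by (simp add: P_def)
    hence "c_of G * c G p LC * P G p = \<kappa> G p LC"
      using c_of_pos[of G] by (simp add: c_def)
    moreover have "C G * h G p LC X \<le> C' * \<bar>h G p LC X\<bar>"
      using C' h_nonneg by (simp add: mult_right_mono)
    ultimately show ?thesis
      using \<kappa>[of p X G LC] that by simp
  qed
  have "\<bar>h G p LC X\<bar> \<le> 1 * (real p * X powr (1 / e_of G) + (real p)\<^sup>2 * X powr (1 / 12))" for G p LC X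
    by (simp add: h_def)
  thus ?thesis
    using main unfolding P_def by (intro exI[of _ c] exI[of _ h] conjI) blast+
qed

end
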